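(* Let $H$ be a split graph with at least two vertices, with independence number $\alpha$ and clique number $\omega$, and let $\mathcal{H}=\mathrm{Forb}(H)$. Then $$\left(p_{\mathcal{H}}^*,d_{\mathcal{H}}^*\right)=\left(\frac{\omega-1}{\alpha+\omega-2},\frac{1}{\alpha+\omega-2}\right);$$ that is, the maximum value over $p\in[0,1]$ of the edit distance function $\mathrm{ed}_{\mathcal{H}}(p)$ is $d_{\mathcal{H}}^*=\frac{1}{\alpha+\omega-2}$, and it is attained exactly at $p=p_{\mathcal{H}}^*=\frac{\omega-1}{\alpha+\omega-2}$.
   Context: All graphs are finite and simple. A split graph is a graph whose vertex set can be partitioned into one clique and one independent set (either part may be empty, so complete graphs and edgeless graphs are split graphs). For two graphs $G,G'$ on the same labeled vertex set of size $n$, the normalized edit distance is $\mathrm{Dist}(G,G')=|E(G)\triangle E(G')|/\binom{n}{2}$. A hereditary property is a set of graphs closed under isomorphism and under taking induced subgraphs. For a hereditary property $\mathcal{H}$ and a graph $G$, $\mathrm{Dist}(G,\mathcal{H})=\min\{\mathrm{Dist}(G,G'): V(G')=V(G),\ G'\in\mathcal{H}\}$ (considered only when $\mathcal{H}$ contains a graph on $|V(G)|$ vertices). The edit distance function of a hereditary property $\mathcal{H}$ is the function of $p\in[0,1]$ given by $$\mathrm{ed}_{\mathcal{H}}(p)=\lim_{n\to\infty}\max\left\{\mathrm{Dist}(G,\mathcal{H}) : |V(G)|=n,\ |E(G)|=\left\lfloor p\tbinom{n}{2}\right\rfloor\right\}$$ (the limit is known to exist for nontrivial, i.e. infinite, hereditary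 properties, and $\mathrm{ed}_{\mathcal{H}}$ is then known to be continuous and concave on $[0,1]$, so it attains a maximum). The maximum value of $\mathrm{ed}_{\mathcal{H}}$ on $[0,1]$ is denoted $d_{\mathcal{H}}^*$ and the value of $p$ at which it is attained is denoted $p_{\mathcal{H}}^*$. For a graph $H$, $\mathrm{Forb}(H)$ denotes the hereditary property of all graphs that have no induced copy of $H$. *)

theory Defs
  imports Complex_Main "HOL-Library.Ramsey"
begin

text \<open>
  A graph is a pair of a vertex set and a set of two-element subsets of it. The graph \<open>H\<close> may
  live on any type; host graphs have vertices in \<^typ>\<open>nat\<close>, which represents every finite graph
  up to isomorphism.
\<close>

type_synonym 'a graph = "'a set \<times> 'a set set"

abbreviation verts :: "'a graph \<Rightarrow> 'a set" where "verts \<equiv> fst"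
abbreviation edges :: "'a graph \<Rightarrow> 'a set set" where "edges \<equiv> snd"

definition fin_simple_graph :: "'a graph \<Rightarrow> bool" where
  "fin_simple_graph G \<longleftrightarrow> finite (verts G) \<and> edges G \<subseteq> [verts G]\<^bsup>2\<^esup>"

definition split_graph :: "'a graph \<Rightarrow> bool" where
  "split_graph G \<longleftrightarrow>
    (\<exists>A B. A \<union> B = verts G \<and> A \<inter> B = {} \<and> clique A (edges G) \<and> indep B (edges G))"

definition clique_number :: "'a graph \<Rightarrow> nat" where
  "clique_number G = Max {card S |S. S \<subseteq> verts G \<and> clique S (edges G)}"

definition independence_number :: "'a graph \<Rightarrow> nat" where
  "independence_number G = Max {card S |S. S \<subseteq> verts G \<and> indep S (edges G)}"

definition has_induced_copy :: "'b graph \<Rightarrow> 'a graph \<Rightarrow> bool" where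
  "has_induced_copy G H \<longleftrightarrow>
    (\<exists>f. inj_on f (verts H) \<and> f ` verts H \<subseteq> verts G \<and>
      (\<forall>u\<in>verts H. \<forall>v\<in>verts H. {u, v} \<in> edges H \<longleftrightarrow> {f u, f v} \<in> edges G))"

definition Forb :: "'a graph \<Rightarrow> nat graph set" where
  "Forb H = {G. fin_simple_graph G \<and> \<not> has_induced_copy G H}"

definition graph_dist :: "nat graph \<Rightarrow> nat graph \<Rightarrow> real" where
  "graph_dist G G' =
    real (card (sym_diff (edges G) (edges G'))) / real (card (verts G) choose 2)"

definition property_dist :: "nat graph \<Rightarrow> nat graph set \<Rightarrow> real" where
  "property_dist G \<H> = Min {graph_dist G G' |G'. verts G' = verts G \<and> G' \<in> \<H>}"

text \<open>
  For fixed \<open>n\<close> the set under \<^const>\<open>Max\<close> is finite even though the vertex sets vary, because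
  normalized distances are multiples of \<open>1 / (n choose 2)\<close> in the unit interval (as long as
  \<open>\<H>\<close> contains graphs on every vertex set in question).
\<close>

definition ed :: "nat graph set \<Rightarrow> real \<Rightarrow> real" where
  "ed \<H> p = lim (\<lambda>n. Max {property_dist G \<H> |G.
     fin_simple_graph G \<and> card (verts G) = n \<and>
     int (card (edges G)) = \<lfloor>p * real (n choose 2)\<rfloor>})"

definition d_star :: "nat graph set \<Rightarrow> real" where
  "d_star \<H> = (GREATEST d. d \<in> ed \<H> ` {0..1})"

definition p_star :: "nat graph set \<Rightarrow> real" where
  "p_star \<H> = (THE p. p \<in> {0..1} \<and> ed \<H> p = d_star \<H>)"

end

(* The limit defining ed (Forb H) p is computed as min (p/(omega-1)) ((1-p)/(alpha-1)); the
   claim about the maximum is then immediate.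

   Upper bound: colour the vertices with omega-1 colours so that at most a 1/(omega-1) fraction
   of the edges is monochromatic and delete these edges; dually for non-edges.

   Lower bound at p0 = (omega-1)/(alpha+omega-2): let E be quasirandom of density p0 and F be
   H-free. Among all k-tuples of vertex sets choose one maximising
     sum of dens_F^2 - kappa * sum of dens_(E xor F) + eta * sum of log sizes.
   Splitting a set cannot increase this potential, so the tuple is F-regular, its sets have linear
   size, and the edit cost between its sets is on average no larger than the global one. Colouring
   pairs by their F-density and sets by Ramsey's theorem gives a coloured regularity graph (CRG)
   into which H does not map, and the cost is bounded below by a quadratic form of that CRG. Its
   minimum over the simplex is attained at weights for which, by the first and second order
   conditions, the gray graph is dense enough to place H greedily if the value is below
   1/(alpha+omega-2).

   For other p, put the quasirandom graph on a fraction x of the vertices and add no further edges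
   (p < p0, x^2 = p/p0) or all of them (p > p0, x^2 = (1-p)/(1-p0)). *)
theory Submission
  imports Defs "HOL-Analysis.Analysis" "HOL-Computational_Algebra.Primes"
begin

section \<open>Regular tuples of vertex sets\<close>

text \<open>The cost is only averaged over the pairs of a tuple, so the sets may overlap and need
  not cover the host, and no regularity partition is required. The logarithms keep the sets linear
  in size; a large \<open>\<kappa>\<close> makes the bounded density energy a negligible loss. A
  second regularisation inside each set is needed because a homomorphism may send many vertices of
  \<open>H\<close> to one CRG vertex. Put \<open>w\<close> = \<omega> - 1, \<open>b\<close> =
  \<alpha> - 1 and scale costs by \<open>w + b\<close>; the claim is then that a CRG without a copy
  of \<open>H\<close> has value at least 1. Complementation gives \<open>w \<le> b\<close>. A gray
  edge between a white and a black vertex already hosts a split graph, so the form decouples into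
  the two colours. White vertices are easy: every edge of an optimal core is gray. Among black
  vertices white edges can be cheaper than the vertices and survive, so weights become unequal and
  the gray degrees are needed. The hardest case there is a clique part of size \<open>w + 1\<close>
  whose vertices have no common neighbours in an independent part of size \<open>b + 1\<close>: it
  asks for a gray clique with one vertex more than the greedy bound supplies.\<close>

definition edge_count :: "('v \<Rightarrow> 'v \<Rightarrow> bool) \<Rightarrow> 'v set \<Rightarrow> 'v set \<Rightarrow> real" where
  "edge_count R X Y = (\<Sum>x\<in>X. \<Sum>y\<in>Y. of_bool (R x y))"

text \<open>Division by zero makes the density of an empty set 0, so that
  \<open>edge_density_mult\<close> needs only finiteness.\<close>

definition edge_density :: "('v \<Rightarrow> 'v \<Rightarrow> bool) \<Rightarrow> 'v set \<Rightarrow> 'v set \<Rightarrow> real" where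
  "edge_density R X Y = edge_count R X Y / (real (card X) * real (card Y))"

definition regular_pair :: "real \<Rightarrow> ('v \<Rightarrow> 'v \<Rightarrow> bool) \<Rightarrow> 'v set \<Rightarrow> 'v set \<Rightarrow> bool" where
  "regular_pair \<epsilon> R X Y \<longleftrightarrow> (\<forall>A\<subseteq>X. \<forall>B\<subseteq>Y. \<epsilon> * card X \<le> card A \<longrightarrow> \<epsilon> * card Y \<le> card B \<longrightarrow>
     \<bar>edge_density R A B - edge_density R X Y\<bar> \<le> \<epsilon>)"

lemma edge_count_nonneg: "0 \<le> edge_count R X Y"
  unfolding edge_count_def by (intro sum_nonneg) auto

lemma edge_count_le: "edge_count R X Y \<le> real (card X) * real (card Y)"
proof -
  have "edge_count R X Y \<le> (\<Sum>x\<in>X. \<Sum>y\<in>Y. 1)"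
    unfolding edge_count_def by (intro sum_mono) auto
  then show ?thesis by simp
qed

lemma edge_density_nonneg: "0 \<le> edge_density R X Y"
  unfolding edge_density_def using edge_count_nonneg
    by (metis divide_nonneg_nonneg mult_nonneg_nonneg of_nat_0_le_iff)

lemma edge_density_le_1: "edge_density R X Y \<le> 1"
  unfolding edge_density_def using edge_count_le[of R X Y]
  by (metis divide_le_eq_1 edge_count_nonneg less_eq_real_def divide_eq_0_iff zero_le_one
      mult_nonneg_nonneg of_nat_0_le_iff)

lemma edge_count_commute:
  assumes "\<And>x y. R x y = R y x" shows "edge_count R X Y = edge_count R Y X"
  unfolding edge_count_def by (subst sum.swap) (simp add: assms)

lemma edge_density_commute:
  assumes "\<And>x y. R x y = R y x" shows "edge_density R X Y = edge_density R Y X"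
  unfolding edge_density_def by (simp add: edge_count_commute[OF assms] mult.commute)

lemma edge_count_split:
  assumes "finite X" "P \<subseteq> X" shows "edge_count R X Y = edge_count R P Y + edge_count R (X - P) Y"
  unfolding edge_count_def using sum.subset_diff[OF assms(2,1)] by (simp add: add.commute)

lemma edge_density_mult:
  assumes "finite X" "finite Y"
  shows "edge_count R X Y = edge_density R X Y * (real (card X) * real (card Y))"
  using assms unfolding edge_density_def by (cases "X = {} \<or> Y = {}") (auto simp: edge_count_def)

lemma edge_density_split:
  assumes "finite X" "P \<subseteq> X" "P \<noteq> {}" "P \<noteq> X" "finite Y" "Y \<noteq> {}"
  defines "p \<equiv> real (card P) / real (card X)"
  shows "edge_density R X Y = p * edge_density R P Y + (1 - p) * edge_density R (X - P) Y"
proof -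
  have fP: "finite P" using assms finite_subset by blast
  have c: "real (card (X - P)) = real (card X) - real (card P)"
    using assms fP by (simp add: card_Diff_subset card_mono of_nat_diff)
  have pos: "real (card X) > 0" "real (card Y) > 0" "real (card P) > 0"
    using assms fP by (auto simp: card_gt_0_iff)
  have lt: "card P < card X" using assms by (intro psubset_card_mono) auto
  have "edge_density R X Y = (edge_count R P Y + edge_count R (X - P) Y) / (real (card X) * real (card Y))"
    unfolding edge_density_def using edge_count_split[OF assms(1,2)] by simp
  also have "\<dots> = p * edge_density R P Y + (1 - p) * edge_density R (X - P) Y"
    unfolding edge_density_def p_def c using pos lt by (simp add: field_simps)
  finally show ?thesis .
qed

text \<open>Defect form of the convexity of squaring: a part whose density \<open>a\<close> differs
  from the average \<open>d\<close> forces an increase proportional to the squared difference. The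
  surplus not recorded is exactly \<open>(1 - p) * (b - d)\<^sup>2\<close>.\<close>

lemma square_split:
  fixes d a b p :: real
  assumes "d = p * a + (1 - p) * b" "0 \<le> p" "p \<le> 1"
  shows "d\<^sup>2 + p * (a - d)\<^sup>2 \<le> p * a\<^sup>2 + (1 - p) * b\<^sup>2"
proof -
  have "p * a\<^sup>2 + (1 - p) * b\<^sup>2 - d\<^sup>2 - p * (a - d)\<^sup>2 = (1 - p) * (b - d)\<^sup>2"
    unfolding assms(1) by (simp add: power2_eq_square algebra_simps)
  moreover have "(1 - p) * (b - d)\<^sup>2 \<ge> 0" using assms by simp
  ultimately show ?thesis by linarith
qed

text \<open>The average of the logarithms of both parts falls short of \<open>ln u\<close> by the
  entropy of \<open>p\<close>. The crude estimate \<open>t - 1 \<le> t * ln t\<close>, applied to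
  \<open>p\<close> and \<open>1 - p\<close>, bounds this entropy by 1, whatever \<open>p\<close>
  is.\<close>

lemma entropy_split:
  fixes u v :: real
  assumes "0 < p" "p < 1" "0 < u"
  shows "ln u - 1 \<le> p * ln (p * u) + (1 - p) * ln ((1 - p) * u)"
proof -
  have *: "t - 1 \<le> t * ln t" if "t > 0" for t :: real
  proof -
    have "ln (1/t) \<le> 1/t - 1" using that by (intro ln_le_minus_one) auto
    then have "- ln t \<le> 1/t - 1" using that by (simp add: ln_div)
    then have "t * (- ln t) \<le> t * (1/t - 1)" using that by (intro mult_left_mono) auto
    then show ?thesis using that by (simp add: algebra_simps)
  qed
  have "p * ln (p * u) + (1 - p) * ln ((1 - p) * u) = p * ln p + (1-p) * ln (1-p) + ln u"
    using assms by (subst (1 2) ln_mult) (auto simp: algebra_simps)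
  then show ?thesis using *[of p] *[of "1-p"] assms by simp
qed

text \<open>Only the terms with index \<open>i\<close> change when \<open>W i\<close> is replaced;
  symmetry of \<open>F\<close> makes row and column equal, whence the factor 2.\<close>

lemma pair_sum_upd:
  fixes F :: "'b \<Rightarrow> 'b \<Rightarrow> real" and k i :: nat
  assumes "i < k" and F: "\<And>X Y. F X Y = F Y X"
  shows "(\<Sum>l<k. \<Sum>m\<in>{..<k}-{l}. F ((W(i:=P)) l) ((W(i:=P)) m)) =
    2 * (\<Sum>l\<in>{..<k}-{i}. F P (W l)) + (\<Sum>l\<in>{..<k}-{i}. \<Sum>m\<in>{..<k}-{l}-{i}. F (W l) (W m))"
proof -
  let ?W = "W(i:=P)"
  have "(\<Sum>l<k. \<Sum>m\<in>{..<k}-{l}. F (?W l) (?W m)) =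
     (\<Sum>m\<in>{..<k}-{i}. F (?W i) (?W m)) + (\<Sum>l\<in>{..<k}-{i}. \<Sum>m\<in>{..<k}-{l}. F (?W l) (?W m))"
    using assms by (intro sum.remove) auto
  also have "(\<Sum>m\<in>{..<k}-{i}. F (?W i) (?W m)) = (\<Sum>m\<in>{..<k}-{i}. F P (W m))"
    by (intro sum.cong) auto
  also have "(\<Sum>l\<in>{..<k}-{i}. \<Sum>m\<in>{..<k}-{l}. F (?W l) (?W m)) =
     (\<Sum>l\<in>{..<k}-{i}. F P (W l) + (\<Sum>m\<in>{..<k}-{l}-{i}. F (W l) (W m)))"
  proof (rule sum.cong)
    fix l assume l: "l \<in> {..<k}-{i}"
    have "(\<Sum>m\<in>{..<k}-{l}. F (?W l) (?W m)) = F (?W l) (?W i) + (\<Sum>m\<in>{..<k}-{l}-{i}. F (?W l) (?W m))"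
      using assms l by (intro sum.remove) auto
    also have "F (?W l) (?W i) = F P (W l)" using l F by auto
    also have "(\<Sum>m\<in>{..<k}-{l}-{i}. F (?W l) (?W m)) = (\<Sum>m\<in>{..<k}-{l}-{i}. F (W l) (W m))"
      using l by (intro sum.cong) auto
    finally show "(\<Sum>m\<in>{..<k}-{l}. F (?W l) (?W m)) =
       F P (W l) + (\<Sum>m\<in>{..<k}-{l}-{i}. F (W l) (W m))" .
  qed simp
  finally show ?thesis by (simp add: sum.distrib)
qed

lemma finite_tuples:
  fixes k :: nat
  assumes "finite U"
  shows "finite {W. (\<forall>i<k. W i \<subseteq> U \<and> W i \<noteq> {}) \<and> (\<forall>i\<ge>k. W i = ({}::'v set))}"
proof (rule finite_subset)
  show "{W. (\<forall>i<k. W i \<subseteq> U \<and> W i \<noteq> {}) \<and> (\<forall>i\<ge>k. W i = {})} \<subseteq>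
     {W. \<forall>i. (i \<in> {..<k} \<longrightarrow> W i \<in> Pow U) \<and> (i \<notin> {..<k} \<longrightarrow> W i = {})}" by auto
  show "finite {W. \<forall>i. (i \<in> {..<k} \<longrightarrow> W i \<in> Pow U) \<and> (i \<notin> {..<k} \<longrightarrow> W i = {})}"
    using assms by (intro finite_set_of_finite_funs) auto
qed

text \<open>A maximiser of the potential is compared with two kinds of tuples. Against its own
  splittings: the average over the two parts of a set loses at most \<open>\<eta>\<close> in the
  entropy term but gains the squared density deviation, so a maximiser has no irregular pair; the
  cost term is linear and unchanged by this averaging. Against the constant tuple
  \<open>U, ..., U\<close>: this gives the cost estimate and a lower bound on the sum of logarithms,
  from which \<open>\<gamma>\<close> arises.\<close>

lemma exists_regular_tuple:
  fixes k :: nat and \<epsilon> \<kappa> :: real and R C :: "'v \<Rightarrow> 'v \<Rightarrow> bool"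
  assumes \<epsilon>: "0 < \<epsilon>" "\<epsilon> \<le> 1" and \<kappa>: "0 \<le> \<kappa>" and U: "finite U" "U \<noteq> {}"
    and R: "\<And>x y. R x y = R y x" and C: "\<And>x y. C x y = C y x"
  defines "\<eta> \<equiv> \<epsilon> ^ 4 / 16"
  defines "\<gamma> \<equiv> exp (- (real k ^ 2 * (\<kappa> + 1) / \<eta>))"
  shows "\<exists>W. (\<forall>i<k. W i \<subseteq> U \<and> W i \<noteq> {} \<and> \<gamma> * card U \<le> card (W i)) \<and>
     (\<forall>i<k. \<forall>j<k. i \<noteq> j \<longrightarrow> regular_pair \<epsilon> R (W i) (W j)) \<and>
     \<kappa> * (\<Sum>i<k. \<Sum>j\<in>{..<k}-{i}. edge_density C (W i) (W j)) \<le> \<kappa> * (real k ^ 2 * edge_density C U U) + real k ^ 2"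
proof -
  define F where "F X Y = (edge_density R X Y)\<^sup>2 - \<kappa> * edge_density C X Y" for X Y
  have dR: "edge_density R X Y = edge_density R Y X" for X Y by (rule edge_density_commute, rule R)
  have dC: "edge_density C X Y = edge_density C Y X" for X Y by (rule edge_density_commute, rule C)
  have Fsym: "F X Y = F Y X" for X Y
    unfolding F_def by (simp add: dR[of X Y] dC[of X Y])
  define S where "S W = (\<Sum>l<k. \<Sum>m\<in>{..<k}-{l}. F (W l) (W m))" for W
  define L where "L W = (\<Sum>l<k. ln (real (card (W l)) / real (card U)))" for W :: "nat \<Rightarrow> 'v set"
  define \<Psi> where "\<Psi> W = S W + \<eta> * L W" for W
  define T where "T = {W. (\<forall>i<k. W i \<subseteq> U \<and> W i \<noteq> {}) \<and> (\<forall>i\<ge>k. W i = ({}::'v set))}"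
  have finT: "finite T" unfolding T_def by (rule finite_tuples[OF U(1)])
  define W0 where "W0 i = (if i < k then U else {})" for i
  have W0: "W0 \<in> T" unfolding T_def W0_def using U by auto
  obtain W where W: "W \<in> T" and max: "\<And>W'. W' \<in> T \<Longrightarrow> \<Psi> W' \<le> \<Psi> W"
  proof -
    have "Max (\<Psi> ` T) \<in> \<Psi> ` T" using finT W0 by (intro Max_in) auto
    then obtain W where "W \<in> T" "\<Psi> W = Max (\<Psi> ` T)" by (metis imageE)
    moreover have "\<Psi> W' \<le> Max (\<Psi> ` T)" if "W' \<in> T" for W'
      using finT that by (intro Max_ge) auto
    ultimately show ?thesis using that by metis
  qed
  have \<eta>: "\<eta> > 0" unfolding \<eta>_def using \<epsilon> by simp
  have cU: "real (card U) > 0" using U by (simp add: card_gt_0_iff)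
  have F_split: "F X Y + p * (edge_density R P Y - edge_density R X Y)\<^sup>2 \<le> p * F P Y + (1 - p) * F (X - P) Y"
    if "finite X" "P \<subseteq> X" "P \<noteq> {}" "P \<noteq> X" "finite Y" "Y \<noteq> {}" and p: "p = real (card P) / real (card X)"
    for X P Y p
  proof -
    note s = edge_density_split[OF that(1-6), folded p]
    have p01: "0 \<le> p" "p \<le> 1" using that p by (auto simp: divide_le_eq_1 card_mono)
    show ?thesis using square_split[OF s[of R] p01] arg_cong[OF s[of C], of "(*) \<kappa>"] unfolding F_def
      by (simp add: algebra_simps)
  qed
  \<comment> \<open>The expected potential when \<open>V i\<close> is replaced by \<open>P\<close>
    with probability \<open>p\<close> and by the rest otherwise. The pair \<open>(i, j)\<close> is
    summed in both orders, hence the factor 2.\<close>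
  have gain: "\<Psi> V - \<eta> + 2 * p * (edge_density R P (V j) - edge_density R (V i) (V j))\<^sup>2 \<le>
        p * \<Psi> (V(i:=P)) + (1 - p) * \<Psi> (V(i:=V i - P))"
    if V: "V \<in> T" and ij: "i < k" "j < k" "i \<noteq> j" and P: "P \<subseteq> V i" "P \<noteq> {}" "P \<noteq> V i"
      and p: "p = real (card P) / real (card (V i))" for V i j P p
  proof -
    have fin: "finite (V l)" "V l \<noteq> {}" if "l < k" for l
      using V that U(1) unfolding T_def by (auto intro: finite_subset)
    have fP: "finite P" using P fin[OF ij(1)] finite_subset by blast
    have lt: "card P < card (V i)" using P fin[OF ij(1)] by (intro psubset_card_mono) auto
    have cP: "card P > 0" using P fP by (simp add: card_gt_0_iff)
    have p01: "0 < p" "p < 1" using p lt cP by auto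
    define A where "A X = (\<Sum>l\<in>{..<k}-{i}. F X (V l))" for X
    define B where "B = (\<Sum>l\<in>{..<k}-{i}. \<Sum>m\<in>{..<k}-{l}-{i}. F (V l) (V m))"
    have SX: "S (V(i:=X)) = 2 * A X + B" for X
      unfolding S_def A_def B_def by (rule pair_sum_upd[OF ij(1) Fsym])
    have SV: "S V = 2 * A (V i) + B" using SX[of "V i"] by simp
    have Asplit: "A (V i) + p * (edge_density R P (V j) - edge_density R (V i) (V j))\<^sup>2 \<le> p * A P + (1 - p) * A (V i - P)"
    proof -
      have "A (V i) + p * (edge_density R P (V j) - edge_density R (V i) (V j))\<^sup>2 \<le>
         (\<Sum>l\<in>{..<k}-{i}. F (V i) (V l) + p * (edge_density R P (V l) - edge_density R (V i) (V l))\<^sup>2)"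
        unfolding A_def sum.distrib using ij p01
        by (intro add_left_mono member_le_sum) auto
      also have "\<dots> \<le> (\<Sum>l\<in>{..<k}-{i}. p * F P (V l) + (1 - p) * F (V i - P) (V l))"
        using fin ij P p by (intro sum_mono F_split) auto
      finally show ?thesis unfolding A_def by (simp add: sum.distrib sum_distrib_left)
    qed
    define D where "D = (\<Sum>l\<in>{..<k}-{i}. ln (real (card (V l)) / real (card U)))"
    have LX: "L (V(i:=X)) = ln (real (card X) / real (card U)) + D" for X
    proof -
      have "L (V(i:=X)) = ln (real (card ((V(i:=X)) i)) / real (card U)) +
          (\<Sum>l\<in>{..<k}-{i}. ln (real (card ((V(i:=X)) l)) / real (card U)))"
        unfolding L_def using ij by (intro sum.remove) auto
      also have "(\<Sum>l\<in>{..<k}-{i}. ln (real (card ((V(i:=X)) l)) / real (card U))) = D"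
        unfolding D_def by (intro sum.cong) auto
      finally show ?thesis unfolding fun_upd_same .
    qed
    have LV: "L V = ln (real (card (V i)) / real (card U)) + D" using LX[of "V i"] by simp
    have cVi: "real (card (V i)) > 0" using lt by simp
    have c2: "real (card (V i - P)) = (1 - p) * real (card (V i))"
      using P fP lt cVi by (simp add: p card_Diff_subset of_nat_diff field_simps)
    have c1: "real (card P) = p * real (card (V i))" using p cVi by simp
    have Lsplit: "L V - 1 \<le> p * L (V(i:=P)) + (1 - p) * L (V(i:=V i - P))"
      using entropy_split[OF p01, of "real (card (V i)) / real (card U)"] cVi cU
      unfolding LX LV c1 c2 by (simp add: algebra_simps)
    have "\<eta> * (L V - 1) \<le> \<eta> * (p * L (V(i:=P)) + (1 - p) * L (V(i:=V i - P)))"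
      using Lsplit \<eta> by (intro mult_left_mono) auto
    then show ?thesis using Asplit unfolding \<Psi>_def SX SV by (simp add: algebra_simps)
  qed
  have updT: "V(i:=P) \<in> T" if "V \<in> T" "i < k" "P \<subseteq> V i" "P \<noteq> {}" for V i P
    using that unfolding T_def by auto
  have reg: "regular_pair \<epsilon> R (W i) (W j)" if ij: "i < k" "j < k" "i \<noteq> j" for i j
    unfolding regular_pair_def
  proof (intro allI impI, rule ccontr)
    fix A B
    assume AB: "A \<subseteq> W i" "B \<subseteq> W j" and cA: "\<epsilon> * real (card (W i)) \<le> real (card A)"
      and cB: "\<epsilon> * real (card (W j)) \<le> real (card B)"
      and neg: "\<not> \<bar>edge_density R A B - edge_density R (W i) (W j)\<bar> \<le> \<epsilon>"
    have fin: "finite (W l)" "W l \<noteq> {}" "real (card (W l)) > 0" if "l < k" for l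
      using W that U(1) unfolding T_def by (auto intro: finite_subset simp: card_gt_0_iff)
    have pA: "\<epsilon> \<le> real (card A) / real (card (W i))" and pB: "\<epsilon> \<le> real (card B) / real (card (W j))"
      using cA cB fin[OF ij(1)] fin[OF ij(2)] by (auto simp: field_simps)
    have nA: "A \<noteq> {}" "B \<noteq> {}" using pA pB \<epsilon> by auto
    have bigsq: "\<epsilon> ^ 3 / 2 \<le> 2 * p * y\<^sup>2" if "\<epsilon> \<le> p" "\<epsilon> / 2 < \<bar>y\<bar>" for p y :: real
    proof -
      have "(\<epsilon>/2)\<^sup>2 \<le> y\<^sup>2" using that \<epsilon> by (simp add: abs_le_square_iff[symmetric])
      then have "\<epsilon> * (\<epsilon>/2)\<^sup>2 \<le> p * y\<^sup>2" using that \<epsilon> by (intro mult_mono) auto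
      then show ?thesis by (simp add: power2_eq_square power3_eq_cube)
    qed
    \<comment> \<open>This is what \<open>\<eta> = \<epsilon> ^ 4 / 16\<close> is made for:
      \<open>\<eta>\<close> and \<open>\<eta> / \<epsilon>\<close> are each at most
      \<open>\<epsilon> ^ 3 / 16\<close>, well below the gain \<open>\<epsilon> ^ 3 / 2\<close> from
      a deviation of \<open>\<epsilon> / 2\<close>.\<close>
    have small: "\<eta> + \<eta> / \<epsilon> < \<epsilon>^3 / 2"
    proof -
      have "\<eta> / \<epsilon> = \<epsilon>^3/16" using \<epsilon> unfolding \<eta>_def by (simp add: field_simps power_numeral_reduce)
      moreover have "\<eta> \<le> \<epsilon>^3/16" unfolding \<eta>_def using \<epsilon> power_decreasing[of 3 4 \<epsilon>] by simp
      moreover have "\<epsilon>^3 > 0" using \<epsilon> by simp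
      ultimately show ?thesis by linarith
    qed
    have \<eta>\<epsilon>: "\<eta> / \<epsilon> > 0" using \<eta> \<epsilon> by simp
    have ch: "\<Psi> V - \<eta> + \<epsilon>^3/2 \<le> \<Psi> W"
      if V: "V \<in> T" "P \<subseteq> V a" "P \<noteq> {}" "a < k" "b < k" "a \<noteq> b"
        "\<epsilon> \<le> real (card P) / real (card (V a))"
        "\<epsilon> / 2 < \<bar>edge_density R P (V b) - edge_density R (V a) (V b)\<bar>" for V P a b
    proof -
      have ne: "P \<noteq> V a" using that(8) \<epsilon> by auto
      define p where "p = real (card P) / real (card (V a))"
      have "V a \<subseteq> U" using V unfolding T_def by auto
      then have finV: "finite (V a)" using U(1) by (rule finite_subset)
      have p01: "0 \<le> p" "p \<le> 1" using V finV unfolding p_def by (auto simp: divide_le_eq_1 card_mono)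
      have "\<Psi> V - \<eta> + \<epsilon>^3/2 \<le> \<Psi> V - \<eta> + 2 * p * (edge_density R P (V b) - edge_density R (V a) (V b))\<^sup>2"
        using bigsq[of p "edge_density R P (V b) - edge_density R (V a) (V b)"] that unfolding p_def
          by simp
      also have "\<dots> \<le> p * \<Psi> (V(a:=P)) + (1 - p) * \<Psi> (V(a:=V a - P))"
        using gain[OF V(1,4,5,6,2,3) ne p_def] .
      also have "\<dots> \<le> p * \<Psi> W + (1 - p) * \<Psi> W"
        using V p01 ne by (intro add_mono mult_left_mono max updT) auto
      finally show ?thesis by (simp add: algebra_simps)
    qed
    \<comment> \<open>An irregular pair deviates by more than \<open>\<epsilon> / 2\<close> in one
      of two steps: when \<open>W i\<close> shrinks to \<open>A\<close>, or when afterwards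
      \<open>W j\<close> shrinks to \<open>B\<close>. In the second case the first step is carried
      out although it may lower the potential.\<close>
    show False
    proof (cases "\<epsilon> / 2 < \<bar>edge_density R A (W j) - edge_density R (W i) (W j)\<bar>")
      case True
      from ch[OF W AB(1) nA(1) ij pA True] small \<eta>\<epsilon> show False by linarith
    next
      case False
      let ?V = "W(i:=A)"
      have V: "?V \<in> T" using updT W ij AB nA by auto
      have dev: "\<epsilon> / 2 < \<bar>edge_density R B (?V i) - edge_density R (?V j) (?V i)\<bar>"
      proof -
        have "\<epsilon> / 2 < \<bar>edge_density R A B - edge_density R A (W j)\<bar>" using False neg by linarith
        then show ?thesis using ij dR[of B A] dR[of "W j" A] by auto
      qed
      have 1: "\<Psi> ?V - \<eta> + \<epsilon>^3/2 \<le> \<Psi> W"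
        using ch[OF V, of B j i] AB nA ij pB dev by auto
      \<comment> \<open>The other part \<open>W i - A\<close> cannot beat the maximum, so the loss
        \<open>\<eta>\<close> of the average falls on \<open>A\<close> alone, magnified by at most
        \<open>1 / \<epsilon>\<close>.\<close>
      have 2: "\<Psi> W - \<eta> / \<epsilon> \<le> \<Psi> ?V"
      proof (cases "A = W i")
        case True then show ?thesis using \<eta>\<epsilon> by (simp add: fun_upd_idem)
      next
        case False
        define p where "p = real (card A) / real (card (W i))"
        have p01: "0 < p" "p \<le> 1" using AB fin[OF ij(1)] pA \<epsilon> unfolding p_def
          by (auto simp: divide_le_eq_1 card_mono)
        have "\<Psi> W - \<eta> \<le> \<Psi> W - \<eta> + 2 * p * (edge_density R A (W j) - edge_density R (W i) (W j))\<^sup>2"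
          using p01 by simp
        also have "\<dots> \<le> p * \<Psi> ?V + (1 - p) * \<Psi> (W(i:=W i - A))"
          by (rule gain[OF W ij AB(1) nA(1) False p_def])
        also have "\<dots> \<le> p * \<Psi> ?V + (1 - p) * \<Psi> W"
          using p01 W ij AB False by (intro add_mono mult_left_mono max updT) auto
        finally have "p * \<Psi> W - \<eta> \<le> p * \<Psi> ?V" by (simp add: algebra_simps)
        then have "\<Psi> W - \<eta> / p \<le> \<Psi> ?V" using p01 by (simp add: field_simps)
        moreover have "\<eta> / p \<le> \<eta> / \<epsilon>" using \<eta> \<epsilon> p01 pA[folded p_def]
          by (intro frac_le) auto
        ultimately show ?thesis by linarith
      qed
      from 1 2 small show False by linarith
    qed
  qed
  have \<Psi>0: "\<Psi> W0 \<le> \<Psi> W" using max W0 by auto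
  have L0: "L W0 = 0" unfolding L_def W0_def using cU by simp
  have S0: "S W0 = (real k * (real k - 1)) * F U U"
  proof -
    have "S W0 = (\<Sum>l<k. \<Sum>m\<in>{..<k}-{l}. F U U)" unfolding S_def W0_def
      by (intro sum.cong refl) auto
    also have "\<dots> = (\<Sum>l<k. (real k - 1) * F U U)"
      by (intro sum.cong refl) (auto simp: of_nat_diff)
    finally show ?thesis by simp
  qed
  define CS where "CS V = (\<Sum>i<k. \<Sum>j\<in>{..<k}-{i}. edge_density C (V i) (V j))" for V
  have bound1: "(\<Sum>l<k. \<Sum>m\<in>{..<k}-{l}. t l m) \<le> real k ^ 2"
    if "\<And>l m. t l m \<le> 1" for t :: "nat \<Rightarrow> nat \<Rightarrow> real"
  proof -
    have "(\<Sum>l<k. \<Sum>m\<in>{..<k}-{l}. t l m) \<le> (\<Sum>l<k. \<Sum>m\<in>{..<k}-{l}. 1)"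
      using that by (intro sum_mono) auto
    also have "\<dots> \<le> (\<Sum>l<k. real k)" by (intro sum_mono) auto
    finally show ?thesis by (simp add: power2_eq_square)
  qed
  have SW: "S W \<le> real k ^ 2 - \<kappa> * CS W"
  proof -
    have "S W = (\<Sum>l<k. \<Sum>m\<in>{..<k}-{l}. (edge_density R (W l) (W m))\<^sup>2) - \<kappa> * CS W"
      unfolding S_def F_def CS_def by (simp add: sum_subtractf sum_distrib_left)
    moreover have "(\<Sum>l<k. \<Sum>m\<in>{..<k}-{l}. (edge_density R (W l) (W m))\<^sup>2) \<le> real k ^ 2"
      using edge_density_nonneg[of R] edge_density_le_1[of R] by (intro bound1) (auto simp: power_le_one)
    ultimately show ?thesis by simp
  qed
  have kk: "0 \<le> real k * (real k - 1)" "real k * (real k - 1) \<le> real k ^ 2"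
    by (cases k; simp add: power2_eq_square)+
  have FU: "- \<kappa> * (real k ^ 2 * edge_density C U U) \<le> (real k * (real k - 1)) * F U U"
  proof -
    have "(real k * (real k - 1)) * (\<kappa> * edge_density C U U) \<le> real k ^ 2 * (\<kappa> * edge_density C U U)"
      using kk \<kappa> edge_density_nonneg[of C U U] by (intro mult_right_mono) auto
    moreover have "(real k * (real k - 1)) * (edge_density R U U)\<^sup>2 \<ge> 0" using kk by simp
    ultimately show ?thesis unfolding F_def by (simp add: algebra_simps)
  qed
  have ln_le0: "ln (real (card (W l)) / real (card U)) \<le> 0" if "l < k" for l
  proof -
    have "W l \<subseteq> U" "W l \<noteq> {}" using W that unfolding T_def by auto
    then have "0 < card (W l)" "card (W l) \<le> card U"
      using U by (auto simp: card_gt_0_iff card_mono intro: finite_subset)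
    then show ?thesis using cU by (simp add: ln_div)
  qed
  have LW: "L W \<le> 0" unfolding L_def by (intro sum_nonpos) (use ln_le0 in auto)
  have CS0: "CS W \<ge> 0" unfolding CS_def by (intro sum_nonneg edge_density_nonneg)
  have cost: "\<kappa> * CS W \<le> \<kappa> * (real k ^ 2 * edge_density C U U) + real k ^ 2"
  proof -
    have "\<eta> * L W \<le> 0" using \<eta> LW by (simp add: mult_le_0_iff)
    then show ?thesis using \<Psi>0 SW FU unfolding \<Psi>_def L0 S0 by simp
  qed
  have size: "\<gamma> * card U \<le> card (W i)" if i: "i < k" for i
  proof -
    have "\<eta> * L W \<ge> - (real k ^ 2 * (\<kappa> + 1))"
    proof -
      have "\<kappa> * (real k ^ 2 * edge_density C U U) \<le> \<kappa> * (real k ^ 2 * 1)"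
        using \<kappa> edge_density_le_1 by (intro mult_left_mono) auto
      moreover have "\<kappa> * CS W \<ge> 0" using CS0 \<kappa> by simp
      ultimately show ?thesis using \<Psi>0 SW FU unfolding \<Psi>_def L0 S0 by (simp add: algebra_simps)
    qed
    then have 1: "- (real k ^ 2 * (\<kappa> + 1) / \<eta>) \<le> L W" using \<eta> by (simp add: field_simps)
    \<comment> \<open>All logarithms are nonpositive, so each one is bounded below by their
      sum.\<close>
    have "L W \<le> ln (real (card (W i)) / real (card U))"
    proof -
      have "- ln (real (card (W i)) / real (card U)) \<le> (\<Sum>l<k. - ln (real (card (W l)) / real (card U)))"
        using i ln_le0 by (intro member_le_sum) auto
      then show ?thesis unfolding L_def by (simp add: sum_negf)
    qed
    with 1 have "- (real k ^ 2 * (\<kappa> + 1) / \<eta>) \<le> ln (real (card (W i)) / real (card U))" by linarith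
    moreover have pos: "real (card (W i)) > 0"
      using W i U(1) unfolding T_def by (auto intro: finite_subset simp: card_gt_0_iff)
    ultimately have "\<gamma> \<le> real (card (W i)) / real (card U)"
      unfolding \<gamma>_def using cU by (subst (asm) ln_ge_iff) auto
    then show ?thesis using cU by (simp add: field_simps)
  qed
  show ?thesis
    using W size reg cost unfolding T_def CS_def by blast
qed

section \<open>Quadratic forms on the simplex\<close>

definition quad_form :: "('i \<Rightarrow> 'i \<Rightarrow> real) \<Rightarrow> 'i set \<Rightarrow> ('i \<Rightarrow> real) \<Rightarrow> real" where
  "quad_form M I x = (\<Sum>i\<in>I. \<Sum>j\<in>I. M i j * x i * x j)"

text \<open>The index type may be infinite, so a weight vector is a function fixed to 0 outside
  \<open>I\<close>; the box \<open>K\<close> of such functions is compact by Tychonoff's theorem,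
  and the condition on the sum is closed.\<close>

lemma simplex_minimizer:
  fixes M :: "'i \<Rightarrow> 'i \<Rightarrow> real"
  assumes "finite I" "I \<noteq> {}"
  shows "\<exists>x. (\<forall>i\<in>I. 0 \<le> x i) \<and> sum x I = 1 \<and>
    (\<forall>y. (\<forall>i\<in>I. 0 \<le> y i) \<and> sum y I = 1 \<longrightarrow> quad_form M I x \<le> quad_form M I y)"
proof -
  define K where "K = PiE UNIV (\<lambda>i. if i \<in> I then {0..1::real} else {0})"
  have "compactin (product_topology (\<lambda>i::'i. euclidean) UNIV) K"
    unfolding K_def compactin_PiE by (auto simp: compactin_euclidean_iff)
  then have "compact K" by (simp add: euclidean_product_topology compactin_euclidean_iff)
  have coord: "continuous_on UNIV (\<lambda>x::'i \<Rightarrow> real. x i)" for i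
    by (rule continuous_on_product_coordinates)
  have "closed {x::'i \<Rightarrow> real. sum x I = 1}"
    by (intro closed_Collect_eq continuous_on_sum continuous_on_const coord)
  with \<open>compact K\<close> have cpt: "compact (K \<inter> {x. sum x I = 1})" by (rule compact_Int_closed)
  obtain i0 where i0: "i0 \<in> I" using assms by auto
  have "(\<lambda>i. if i = i0 then 1 else 0) \<in> K \<inter> {x. sum x I = 1}"
    using i0 assms(1) unfolding K_def by (auto simp: sum.delta)
  then have ne: "K \<inter> {x. sum x I = 1} \<noteq> {}" by blast
  have "continuous_on (K \<inter> {x. sum x I = 1}) (quad_form M I)"
    unfolding quad_form_def
    by (intro continuous_on_sum continuous_on_mult continuous_on_const continuous_on_subset[OF coord]) auto
  from continuous_attains_inf[OF cpt ne this]
  obtain x where x: "x \<in> K" "sum x I = 1"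
    and min: "\<And>y. y \<in> K \<Longrightarrow> sum y I = 1 \<Longrightarrow> quad_form M I x \<le> quad_form M I y" by auto
  have "quad_form M I x \<le> quad_form M I y" if y: "\<forall>i\<in>I. 0 \<le> y i" "sum y I = 1" for y
  proof -
    define y' where "y' i = (if i \<in> I then y i else 0)" for i
    have "y i \<le> 1" if "i \<in> I" for i
      using member_le_sum[of i I y] that y assms(1) by auto
    then have "y' \<in> K" unfolding K_def y'_def using y by auto
    moreover have "sum y' I = 1" unfolding y'_def using y by simp
    ultimately have "quad_form M I x \<le> quad_form M I y'" by (rule min)
    also have "\<dots> = quad_form M I y" unfolding quad_form_def y'_def by simp
    finally show ?thesis .
  qed
  moreover have "\<forall>i\<in>I. 0 \<le> x i"
  proof
    fix i assume "i \<in> I"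
    then show "0 \<le> x i" using PiE_mem[OF x(1)[unfolded K_def] UNIV_I, of i] by simp
  qed
  ultimately show ?thesis using x(2) by blast
qed

text \<open>Moving weight \<open>s\<close> from \<open>j\<close> to \<open>i\<close> keeps the sum
  constant; the expansion displays the first and second derivatives used in the optimality
  conditions.\<close>

lemma quad_form_perturb:
  assumes fin: "finite I" and ij: "i \<in> I" "j \<in> I" "i \<noteq> j" and sym: "\<And>i j. M i j = M j i"
  shows "quad_form M I (x(i := x i + s, j := x j - s)) = quad_form M I x
     + 2 * s * ((\<Sum>k\<in>I. M i k * x k) - (\<Sum>k\<in>I. M j k * x k))
     + s\<^sup>2 * (M i i + M j j - 2 * M i j)"
proof -
  define v where "v k = (if k = i then 1 else 0) - (if k = j then 1 else (0::real))" for k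
  have y: "(x(i := x i + s, j := x j - s)) k = x k + s * v k" for k
    using ij unfolding v_def by auto
  have sv: "(\<Sum>k\<in>I. v k * f k) = f i - f j" for f
    using ij fin unfolding v_def
      by (simp add: left_diff_distrib sum_subtractf if_distrib[of "\<lambda>z. z * _"] cong: if_cong)
  have "quad_form M I (\<lambda>k. x k + s * v k) =
     (\<Sum>a\<in>I. \<Sum>b\<in>I. M a b * x a * x b + s * (v a * (M a b * x b)) + s * (v b * (M b a * x a)) + s\<^sup>2 * (v a * (v b * M a b)))"
    unfolding quad_form_def
    by (intro sum.cong refl) (simp add: algebra_simps power2_eq_square sym)
  also have "\<dots> = quad_form M I x + s * (\<Sum>a\<in>I. v a * (\<Sum>b\<in>I. M a b * x b))
     + s * (\<Sum>a\<in>I. \<Sum>b\<in>I. v b * (M b a * x a)) + s\<^sup>2 * (\<Sum>a\<in>I. v a * (\<Sum>b\<in>I. v b * M a b))"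
    unfolding quad_form_def by (simp add: sum.distrib sum_distrib_left)
  also have "(\<Sum>a\<in>I. \<Sum>b\<in>I. v b * (M b a * x a)) = (\<Sum>b\<in>I. v b * (\<Sum>a\<in>I. M b a * x a))"
    by (subst sum.swap) (simp add: sum_distrib_left)
  also have "(\<Sum>a\<in>I. v a * (\<Sum>b\<in>I. M a b * x b)) = (\<Sum>k\<in>I. M i k * x k) - (\<Sum>k\<in>I. M j k * x k)"
    by (rule sv)
  also have "(\<Sum>a\<in>I. v a * (\<Sum>b\<in>I. v b * M a b)) = M i i + M j j - 2 * M i j"
    unfolding sv by (simp add: sym)
  finally have "quad_form M I (\<lambda>k. x k + s * v k) = quad_form M I x
     + 2 * s * ((\<Sum>k\<in>I. M i k * x k) - (\<Sum>k\<in>I. M j k * x k))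
     + s\<^sup>2 * (M i i + M j j - 2 * M i j)" by simp
  moreover have "x(i := x i + s, j := x j - s) = (\<lambda>k. x k + s * v k)" using y by blast
  ultimately show ?thesis by simp
qed

lemma quadratic_nonneg_near_0:
  fixes d q a :: real
  assumes "a > 0" and nn: "\<And>s. \<bar>s\<bar> \<le> a \<Longrightarrow> 0 \<le> 2 * s * d + s\<^sup>2 * q"
  shows "d = 0"
proof (rule ccontr)
  assume "d \<noteq> 0"
  \<comment> \<open>A step against the sign of \<open>d\<close>, so short that the quadratic term is
    at most half of the linear one.\<close>
  define s where "s = - sgn d * min a (\<bar>d\<bar> / (\<bar>q\<bar> + 1))"
  have t: "0 < min a (\<bar>d\<bar> / (\<bar>q\<bar> + 1))" using assms(1) \<open>d \<noteq> 0\<close> by simp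
  define t where "t = min a (\<bar>d\<bar> / (\<bar>q\<bar> + 1))"
  have t0: "t > 0" using t t_def by simp
  have "\<bar>s\<bar> \<le> a" unfolding s_def using \<open>d \<noteq> 0\<close> t by (simp add: abs_mult abs_sgn_eq)
  then have "0 \<le> 2 * s * d + s\<^sup>2 * q" by (rule nn)
  moreover have "s * d = - t * \<bar>d\<bar>" unfolding s_def t_def by (simp add: abs_sgn mult.commute)
  moreover have "s\<^sup>2 = t\<^sup>2" unfolding s_def t_def using \<open>d \<noteq> 0\<close> by (simp add: power_mult_distrib sgn_if)
  ultimately have "0 \<le> t * (t * q - 2 * \<bar>d\<bar>)" by (simp add: power2_eq_square algebra_simps)
  then have "0 \<le> t * q - 2 * \<bar>d\<bar>" using t0 by (simp add: zero_le_mult_iff)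
  moreover have "t * q \<le> \<bar>d\<bar>"
  proof -
    have "t * q \<le> t * (\<bar>q\<bar> + 1)" using t0 by (intro mult_left_mono) auto
    also have "\<dots> \<le> (\<bar>d\<bar> / (\<bar>q\<bar> + 1)) * (\<bar>q\<bar> + 1)" unfolding t_def by (intro mult_right_mono) auto
    finally show ?thesis by (simp add: add_nonneg_eq_0_iff)
  qed
  ultimately show False using \<open>d \<noteq> 0\<close> by simp
qed

text \<open>Among the minimisers of the form one with the fewest positive weights is chosen.
  Shifting weight inside its support equalises the row sums to \<open>g\<close>, the minimum. If
  \<open>2 * M i j\<close> were at least \<open>M i i + M j j\<close>, the form would be concave
  along that shift, and moving all weight of \<open>j\<close> to \<open>i\<close> would give a
  minimiser with smaller support. The last conclusion is homogeneous so that it applies to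
  unnormalised weights.\<close>

lemma core_weights:
  fixes M :: "'i \<Rightarrow> 'i \<Rightarrow> real"
  assumes fin: "finite I" and ne: "I \<noteq> {}" and sym: "\<And>i j. M i j = M j i"
  obtains J x g where "J \<subseteq> I" "J \<noteq> {}" "\<And>i. i \<in> J \<Longrightarrow> 0 < x i" "sum x J = (1::real)"
    "\<And>i. i \<in> J \<Longrightarrow> (\<Sum>j\<in>J. M i j * x j) = g"
    "\<And>i j. i \<in> J \<Longrightarrow> j \<in> J \<Longrightarrow> i \<noteq> j \<Longrightarrow> 2 * M i j < M i i + M j j"
    "\<And>y. (\<And>i. i \<in> I \<Longrightarrow> 0 \<le> y i) \<Longrightarrow> g * (sum y I)\<^sup>2 \<le> quad_form M I y"
proof -
  define P where "P x \<longleftrightarrow> (\<forall>i\<in>I. 0 \<le> x i) \<and> sum x I = 1 \<and>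
    (\<forall>y. (\<forall>i\<in>I. 0 \<le> y i) \<and> sum y I = 1 \<longrightarrow> quad_form M I x \<le> quad_form M I y)" for x
  have "\<exists>x. P x" unfolding P_def by (rule simplex_minimizer[OF fin ne])
  then obtain x where Px: "P x" and least: "\<And>y. P y \<Longrightarrow> card {i\<in>I. 0 < x i} \<le> card {i\<in>I. 0 < y i}"
    using ex_has_least_nat[of P _ "\<lambda>x. card {i\<in>I. 0 < x i}"] by blast
  have x0: "\<And>i. i \<in> I \<Longrightarrow> 0 \<le> x i" and x1: "sum x I = 1"
    and min: "\<And>y. (\<forall>i\<in>I. 0 \<le> y i) \<Longrightarrow> sum y I = 1 \<Longrightarrow> quad_form M I x \<le> quad_form M I y"
    using Px unfolding P_def by auto
  define J where "J = {i\<in>I. 0 < x i}"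
  have J: "J \<subseteq> I" unfolding J_def by auto
  have sumJ: "(\<Sum>i\<in>I. f i * x i) = (\<Sum>i\<in>J. f i * x i)" for f
    using fin x0 J unfolding J_def by (intro sum.mono_neutral_right) (auto simp: less_le)
  have sJ: "sum x J = 1" using sumJ[of "\<lambda>_. 1"] x1 by simp
  define m where "m i = (\<Sum>k\<in>J. M i k * x k)" for i
  have mI: "(\<Sum>k\<in>I. M i k * x k) = m i" for i unfolding m_def by (rule sumJ)
  have pert: "0 \<le> 2 * s * (m i - m j) + s\<^sup>2 * (M i i + M j j - 2 * M i j)"
    "P (x(i := x i + s, j := x j - s)) \<longleftrightarrow> 2 * s * (m i - m j) + s\<^sup>2 * (M i i + M j j - 2 * M i j) \<le> 0"
    if ij: "i \<in> J" "j \<in> J" "i \<noteq> j" and s: "- x i \<le> s" "s \<le> x j" for i j s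
  proof -
    let ?y = "x(i := x i + s, j := x j - s)"
    have nn: "\<forall>k\<in>I. 0 \<le> ?y k" using x0 s ij by auto
    have "sum ?y I = sum x I"
    proof -
      have "sum ?y I = ?y i + (?y j + sum ?y (I - {i} - {j}))"
        using fin ij J by (subst sum.remove[of I i], simp, blast, subst sum.remove[of "I - {i}" j]) auto
      also have "sum ?y (I - {i} - {j}) = sum x (I - {i} - {j})" by (intro sum.cong) auto
      also have "?y i + (?y j + sum x (I - {i} - {j})) = x i + (x j + sum x (I - {i} - {j}))"
        using ij by simp
      also have "\<dots> = sum x I"
        using fin ij J by (subst sum.remove[of I i], simp, blast, subst sum.remove[of "I - {i}" j]) auto
      finally show ?thesis .
    qed
    then have s1: "sum ?y I = 1" using x1 by simp
    have Q: "quad_form M I ?y = quad_form M I x + 2 * s * (m i - m j) + s\<^sup>2 * (M i i + M j j - 2 * M i j)"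
      using quad_form_perturb[where M=M and x=x and s=s and I=I and i=i
        and j=j, OF fin _ _ ij(3) sym] ij J unfolding mI by auto
    show "0 \<le> 2 * s * (m i - m j) + s\<^sup>2 * (M i i + M j j - 2 * M i j)"
      using min[OF nn s1] Q by simp
    show "P ?y \<longleftrightarrow> 2 * s * (m i - m j) + s\<^sup>2 * (M i i + M j j - 2 * M i j) \<le> 0"
    proof -
      have "P ?y \<longleftrightarrow> quad_form M I ?y \<le> quad_form M I x"
        unfolding P_def using nn s1 min x0 x1 by (meson order_trans)
      then show ?thesis using Q by simp
    qed
  qed
  have meq: "m i = m j" if ij: "i \<in> J" "j \<in> J" for i j
  proof (cases "i = j")
    case False
    have "m i - m j = 0"
    proof (rule quadratic_nonneg_near_0[of "min (x i) (x j)"])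
      show "0 < min (x i) (x j)" using ij unfolding J_def by auto
      show "0 \<le> 2 * s * (m i - m j) + s\<^sup>2 * (M i i + M j j - 2 * M i j)" if "\<bar>s\<bar> \<le> min (x i) (x j)" for s
        using that by (intro pert(1)[OF ij False]) auto
    qed
    then show ?thesis by simp
  qed auto
  have strict: "2 * M i j < M i i + M j j" if ij: "i \<in> J" "j \<in> J" "i \<noteq> j" for i j
  proof (rule ccontr)
    assume neg: "\<not> 2 * M i j < M i i + M j j"
    let ?y = "x(i := x i + x j, j := x j - x j)"
    have pos: "0 < x i" "0 < x j" using ij unfolding J_def by auto
    have "P ?y"
      using neg meq[OF ij(1,2)] pos
      by (subst pert(2)[OF ij]) (auto simp: mult_le_0_iff)
    then have "card {i\<in>I. 0 < x i} \<le> card {i\<in>I. 0 < ?y i}" by (rule least)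
    moreover have "card {i\<in>I. 0 < ?y i} < card {i\<in>I. 0 < x i}"
    proof (rule psubset_card_mono)
      show "finite {i\<in>I. 0 < x i}" using fin by simp
      show "{i\<in>I. 0 < ?y i} \<subset> {i\<in>I. 0 < x i}"
      proof
        show "{i\<in>I. 0 < ?y i} \<subseteq> {i\<in>I. 0 < x i}" using pos by auto
        have "j \<in> {i\<in>I. 0 < x i}" "j \<notin> {i\<in>I. 0 < ?y i}" using ij J pos by auto
        then show "{i\<in>I. 0 < ?y i} \<noteq> {i\<in>I. 0 < x i}" by blast
      qed
    qed
    ultimately show False by simp
  qed
  have Jne: "J \<noteq> {}" using sJ by auto
  then obtain j0 where j0: "j0 \<in> J" by auto
  define g where "g = m j0"
  have mg: "m i = g" if "i \<in> J" for i using meq[OF that j0] g_def by simp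
  have Qx: "quad_form M I x = g"
  proof -
    have "quad_form M I x = (\<Sum>i\<in>I. (\<Sum>j\<in>I. M i j * x j) * x i)"
      unfolding quad_form_def sum_distrib_right by (intro sum.cong refl) (simp add: ac_simps)
    also have "\<dots> = (\<Sum>i\<in>J. m i * x i)" unfolding mI by (rule sumJ)
    also have "\<dots> = g * sum x J" using mg by (simp add: sum_distrib_left)
    finally show ?thesis using sJ by simp
  qed
  have low: "g * (sum y I)\<^sup>2 \<le> quad_form M I y" if y: "\<And>i. i \<in> I \<Longrightarrow> 0 \<le> y i" for y
  proof (cases "sum y I = 0")
    case True
    then have "y i = 0" if "i \<in> I" for i using that y fin sum_nonneg_eq_0_iff by blast
    then have "quad_form M I y = 0" unfolding quad_form_def by simp
    then show ?thesis using True by simp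
  next
    case False
    define t where "t = sum y I"
    have t: "t > 0" using False y sum_nonneg[of I y] unfolding t_def by fastforce
    define z where "z i = y i / t" for i
    have "quad_form M I x \<le> quad_form M I z"
    proof (rule min)
      show "\<forall>i\<in>I. 0 \<le> z i" using y t unfolding z_def by auto
      show "sum z I = 1" unfolding z_def using t t_def by (simp add: sum_divide_distrib[symmetric])
    qed
    moreover have "quad_form M I z = quad_form M I y / t\<^sup>2"
      unfolding quad_form_def z_def by (simp add: sum_divide_distrib power2_eq_square)
    ultimately show ?thesis using Qx t unfolding t_def[symmetric] by (simp add: field_simps)
  qed
  show ?thesis
    using that[of J x g] J Jne sJ mg strict low unfolding m_def J_def by blast
qed

section \<open>Split graphs and coloured regularity graphs\<close>

text \<open>A predicate argument makes cliques and independent sets instances of one notion,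
  exchanged by negation.\<close>

definition pairwise_adj :: "('a \<Rightarrow> 'a \<Rightarrow> bool) \<Rightarrow> 'a set \<Rightarrow> bool" where
  "pairwise_adj R S \<longleftrightarrow> (\<forall>u\<in>S. \<forall>v\<in>S. u \<noteq> v \<longrightarrow> R u v)"

text \<open>
  A coloured regularity graph is given by its vertex set \<open>I\<close>, the set \<open>col\<close> of its black vertices
  (the others are white) and its white and black edges \<open>wh\<close>, \<open>bl\<close>; pairs in neither are gray.
\<close>

definition crg_hom :: "'a set \<Rightarrow> ('a \<Rightarrow> 'a \<Rightarrow> bool) \<Rightarrow> 'i set \<Rightarrow> ('i \<Rightarrow> bool) \<Rightarrow>
    ('i \<Rightarrow> 'i \<Rightarrow> bool) \<Rightarrow> ('i \<Rightarrow> 'i \<Rightarrow> bool) \<Rightarrow> ('a \<Rightarrow> 'i) \<Rightarrow> bool" where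
  "crg_hom V adj I col wh bl \<psi> \<longleftrightarrow> \<psi> ` V \<subseteq> I \<and> (\<forall>u\<in>V. \<forall>v\<in>V. u \<noteq> v \<longrightarrow>
     (if \<psi> u = \<psi> v then adj u v \<longleftrightarrow> col (\<psi> u)
      else (adj u v \<longrightarrow> \<not> wh (\<psi> u) (\<psi> v)) \<and> (\<not> adj u v \<longrightarrow> \<not> bl (\<psi> u) (\<psi> v))))"

text \<open>Here \<open>w\<close> and \<open>b\<close> are the clique and independence numbers minus
  one, the quantities in which all bounds come out. The partition is a parameter because it may be
  changed while the graph stays fixed.\<close>

locale split_structure =
  fixes V :: "'a set" and adj :: "'a \<Rightarrow> 'a \<Rightarrow> bool" and A B :: "'a set" and w b :: nat
  assumes finV: "finite V"
    and adj_sym: "adj u v \<longleftrightarrow> adj v u"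
    and AB: "A \<union> B = V" "A \<inter> B = {}"
    and A_clique: "pairwise_adj adj A"
    and B_indep: "pairwise_adj (\<lambda>u v. \<not> adj u v) B"
    and clique_le: "S \<subseteq> V \<Longrightarrow> pairwise_adj adj S \<Longrightarrow> card S \<le> w + 1"
    and indep_le: "S \<subseteq> V \<Longrightarrow> pairwise_adj (\<lambda>u v. \<not> adj u v) S \<Longrightarrow> card S \<le> b + 1"
    and clique_ex: "\<exists>S\<subseteq>V. pairwise_adj adj S \<and> card S = w + 1"
    and indep_ex: "\<exists>S\<subseteq>V. pairwise_adj (\<lambda>u v. \<not> adj u v) S \<and> card S = b + 1"
begin

lemma finA: "finite A" and finB: "finite B"
  using finV AB by (metis finite_Un)+

lemma A_adj: "u \<in> A \<Longrightarrow> v \<in> A \<Longrightarrow> u \<noteq> v \<Longrightarrow> adj u v"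
  using A_clique unfolding pairwise_adj_def by blast

lemma B_nadj: "u \<in> B \<Longrightarrow> v \<in> B \<Longrightarrow> u \<noteq> v \<Longrightarrow> \<not> adj u v"
  using B_indep unfolding pairwise_adj_def by blast

lemma cardA: "card A \<le> w + 1" and cardB: "card B \<le> b + 1"
  using clique_le[of A] indep_le[of B] AB A_clique B_indep by auto

text \<open>Passing to the complement exchanges the parts and the roles of \<open>w\<close> and
  \<open>b\<close>; this permits the assumption \<open>w \<le> b\<close> in the computation of the
  CRG value.\<close>

lemma complement: "split_structure V (\<lambda>u v. \<not> adj u v) B A b w"
  by unfold_locales (use finV adj_sym AB A_clique B_indep clique_le indep_le clique_ex indep_ex
    in \<open>auto simp: Un_commute Int_commute\<close>)

text \<open>A maximum clique contains at most one vertex of the independent part \<open>B\<close>.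
  If \<open>A\<close> is too small to contain it, the clique consists of one vertex of
  \<open>B\<close> and all of \<open>A\<close>.\<close>

lemma card_A_dichotomy:
  assumes "card A \<noteq> w + 1"
  shows "\<exists>\<beta>\<in>B. (\<forall>a\<in>A. adj a \<beta>) \<and> card A = w"
proof -
  obtain Q where Q: "Q \<subseteq> V" "pairwise_adj adj Q" "card Q = w + 1" using clique_ex by blast
  have finQ: "finite Q" using Q finV finite_subset by blast
  have "\<not> Q \<subseteq> A" using Q(3) cardA assms finA card_mono[of A Q] by auto
  then obtain \<beta> where \<beta>: "\<beta> \<in> Q" "\<beta> \<in> B" using Q AB by blast
  have sub: "Q - {\<beta>} \<subseteq> A"
    using Q AB \<beta> B_nadj unfolding pairwise_adj_def by blast
  have "card (Q - {\<beta>}) = w" using \<beta> Q finQ by simp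
  then have "card A = w" "Q - {\<beta>} = A"
    using sub finA cardA assms card_mono[of A "Q - {\<beta>}"] card_subset_eq[of A "Q - {\<beta>}"] by auto
  then show ?thesis using \<beta> Q unfolding pairwise_adj_def by (metis Diff_iff insertCI)
qed

text \<open>If \<open>B\<close> is of maximal size but \<open>A\<close> is not, a vertex of
  \<open>B\<close> adjacent to all of \<open>A\<close> can change sides. What remains is the case of
  two parts of maximal size.\<close>

lemma small_independent_part:
  "card B = b + 1 \<and> card A = w + 1 \<or> (\<exists>A' B'. split_structure V adj A' B' w b \<and> card B' \<le> b)"
proof (cases "card B = b + 1")
  case False
  then have "card B \<le> b" using cardB by simp
  then show ?thesis using split_structure_axioms by blast
next
  case True
  show ?thesis
  proof (cases "card A = w + 1")
    case False
    then obtain \<beta> where \<beta>: "\<beta> \<in> B" "\<forall>a\<in>A. adj a \<beta>" using card_A_dichotomy by blast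
    have "split_structure V adj (insert \<beta> A) (B - {\<beta>}) w b"
    proof
      show "insert \<beta> A \<union> (B - {\<beta>}) = V" "insert \<beta> A \<inter> (B - {\<beta>}) = {}" using AB \<beta> by auto
      show "pairwise_adj adj (insert \<beta> A)"
        using A_clique \<beta> adj_sym unfolding pairwise_adj_def by auto
      show "pairwise_adj (\<lambda>u v. \<not> adj u v) (B - {\<beta>})"
        using B_indep unfolding pairwise_adj_def by auto
    qed (use finV adj_sym clique_le indep_le clique_ex indep_ex in auto)
    moreover have "card (B - {\<beta>}) \<le> b" using True \<beta> by simp
    ultimately show ?thesis by blast
  qed (use True in auto)
qed

text \<open>Otherwise \<open>a\<close> would extend the maximum independent set
  \<open>B\<close>.\<close>

lemma A_has_neighbour:
  assumes "card B = b + 1" "a \<in> A"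
  shows "\<exists>\<beta>\<in>B. adj a \<beta>"
proof (rule ccontr)
  assume "\<not> ?thesis"
  then have "pairwise_adj (\<lambda>u v. \<not> adj u v) (insert a B)"
    using B_indep adj_sym unfolding pairwise_adj_def by auto
  then have "card (insert a B) \<le> b + 1" using indep_le[of "insert a B"] assms AB by auto
  then show False using assms finB AB by (subst (asm) card_insert_disjoint) auto
qed

text \<open>Each white vertex takes an independent set and gray edges put no constraint, so the map
  is just a proper colouring with \<open>w + 1\<close> colours. If \<open>A\<close> is a maximum
  clique, every vertex of \<open>B\<close> misses some vertex of \<open>A\<close> and takes its
  colour; otherwise one colour is left over for all of \<open>B\<close>.\<close>

lemma white_clusters_hom:
  assumes J: "J \<subseteq> I" "finite J" "w < card J" and white: "\<And>i. i \<in> J \<Longrightarrow> \<not> col i"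
    and gray: "\<And>i j. i \<in> J \<Longrightarrow> j \<in> J \<Longrightarrow> i \<noteq> j \<Longrightarrow> \<not> wh i j \<and> \<not> bl i j"
  shows "\<exists>\<psi>. crg_hom V adj I col wh bl \<psi>"
proof -
  have key: ?thesis if \<psi>: "\<psi> ` V \<subseteq> J"
    and col: "\<And>u v. u \<in> V \<Longrightarrow> v \<in> V \<Longrightarrow> u \<noteq> v \<Longrightarrow> \<psi> u = \<psi> v \<Longrightarrow> \<not> adj u v" for \<psi>
  proof -
    have "crg_hom V adj I col wh bl \<psi>" unfolding crg_hom_def
    proof (intro conjI ballI impI)
      show "\<psi> ` V \<subseteq> I" using \<psi> J by auto
      fix u v assume uv: "u \<in> V" "v \<in> V" "u \<noteq> v"
      then show "if \<psi> u = \<psi> v then adj u v = col (\<psi> u)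
           else (adj u v \<longrightarrow> \<not> wh (\<psi> u) (\<psi> v)) \<and> (\<not> adj u v \<longrightarrow> \<not> bl (\<psi> u) (\<psi> v))"
        using \<psi> col[OF uv] white[of "\<psi> u"] gray[of "\<psi> u" "\<psi> v"] by (auto simp: image_subset_iff)
    qed
    then show ?thesis by blast
  qed
  show ?thesis
  proof (cases "card A = w + 1")
    case True
    have "card A \<le> card J" using True J by simp
    then obtain \<sigma> where \<sigma>: "inj_on \<sigma> A" "\<sigma> ` A \<subseteq> J"
      using card_le_inj[OF finA J(2)] by blast
    have "\<exists>a\<in>A. \<not> adj \<beta> a" if "\<beta> \<in> B" for \<beta>
    proof (rule ccontr)
      assume "\<not> ?thesis"
      then have "pairwise_adj adj (insert \<beta> A)"
        using A_clique adj_sym unfolding pairwise_adj_def by auto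
      then have "card (insert \<beta> A) \<le> w + 1" using clique_le[of "insert \<beta> A"] AB that by auto
      then show False using True that finA AB by (subst (asm) card_insert_disjoint) auto
    qed
    then obtain f where f: "\<And>\<beta>. \<beta> \<in> B \<Longrightarrow> f \<beta> \<in> A \<and> \<not> adj \<beta> (f \<beta>)" by metis
    define \<psi> where "\<psi> u = (if u \<in> A then \<sigma> u else \<sigma> (f u))" for u
    show ?thesis
    proof (rule key[of \<psi>])
      show "\<psi> ` V \<subseteq> J" using \<sigma> f AB unfolding \<psi>_def by auto
      fix u v assume uv: "u \<in> V" "v \<in> V" "u \<noteq> v" "\<psi> u = \<psi> v"
      consider "u \<in> A" "v \<in> A" | "u \<in> A" "v \<in> B" | "u \<in> B" "v \<in> A" | "u \<in> B" "v \<in> B"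
        using uv AB by blast
      then show "\<not> adj u v"
      proof cases
        case 1 then show ?thesis using uv \<sigma> unfolding \<psi>_def by (auto dest: inj_onD)
      next
        case 2
        then have "v \<notin> A" using AB by auto
        then have "u = f v" using uv 2 \<sigma> f[of v] unfolding \<psi>_def by (auto dest: inj_onD)
        then show ?thesis using f[of v] 2 adj_sym by auto
      next
        case 3
        then have "u \<notin> A" using AB by auto
        then have "v = f u" using uv 3 \<sigma> f[of u] unfolding \<psi>_def by (auto dest: inj_onD)
        then show ?thesis using f[of u] 3 adj_sym by auto
      next
        case 4 then show ?thesis using uv B_nadj by auto
      qed
    qed
  next
    case False
    then have "card A < card J" using cardA J by simp
    then obtain \<sigma> where \<sigma>: "inj_on \<sigma> A" "\<sigma> ` A \<subseteq> J"
      using card_le_inj[OF finA J(2)] by auto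
    have "card (\<sigma> ` A) < card J" using \<open>card A < card J\<close> \<sigma> by (simp add: card_image)
    then obtain j where j: "j \<in> J" "j \<notin> \<sigma> ` A" using \<sigma> J
      by (metis less_irrefl subset_antisym subsetI)
    define \<psi> where "\<psi> u = (if u \<in> A then \<sigma> u else j)" for u
    show ?thesis
    proof (rule key[of \<psi>])
      show "\<psi> ` V \<subseteq> J" using \<sigma> j unfolding \<psi>_def by auto
      fix u v assume uv: "u \<in> V" "v \<in> V" "u \<noteq> v" "\<psi> u = \<psi> v"
      then have "u \<in> B" "v \<in> B"
        using AB \<sigma> j unfolding \<psi>_def by (auto split: if_splits dest: inj_onD)
      then show "\<not> adj u v" using uv B_nadj by auto
    qed
  qed
qed

text \<open>Black vertices take cliques, so nonadjacent vertices must be separated; black edges are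
  absent, so separation is all they need. Adjacent vertices must share a cluster or lie in clusters
  joined by \<open>gr\<close>, as any other pair may be white. With \<open>\<tau>\<close> injective
  and \<open>S\<close> a \<open>gr\<close>-clique, only the pairs between \<open>A\<close> and
  \<open>B\<close> remain to be checked.\<close>

lemma black_clusters_hom:
  assumes S: "S \<subseteq> J" "\<And>i j. i \<in> S \<Longrightarrow> j \<in> S \<Longrightarrow> i \<noteq> j \<Longrightarrow> gr i j"
    and \<sigma>: "\<sigma> ` A \<subseteq> S" and \<tau>: "\<tau> ` B \<subseteq> J" "inj_on \<tau> B"
    and cross: "\<And>a \<beta>. a \<in> A \<Longrightarrow> \<beta> \<in> B \<Longrightarrow> adj a \<beta> \<Longrightarrow> \<tau> \<beta> = \<sigma> a \<or> gr (\<tau> \<beta>) (\<sigma> a)"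
      "\<And>a \<beta>. a \<in> A \<Longrightarrow> \<beta> \<in> B \<Longrightarrow> \<not> adj a \<beta> \<Longrightarrow> \<tau> \<beta> \<noteq> \<sigma> a"
    and J: "J \<subseteq> I" "\<And>i. i \<in> J \<Longrightarrow> col i" "\<And>i j. i \<in> J \<Longrightarrow> j \<in> J \<Longrightarrow> i \<noteq> j \<Longrightarrow> \<not> bl i j"
    and gr: "\<And>i j. gr i j \<Longrightarrow> \<not> wh i j" "\<And>i j. gr i j \<Longrightarrow> gr j i"
  shows "\<exists>\<psi>. crg_hom V adj I col wh bl \<psi>"
proof -
  define \<psi> where "\<psi> u = (if u \<in> A then \<sigma> u else \<tau> u)" for u
  have \<psi>A: "\<psi> u = \<sigma> u" if "u \<in> A" for u using that unfolding \<psi>_def by simp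
  have \<psi>B: "\<psi> u = \<tau> u" if "u \<in> B" for u using that AB unfolding \<psi>_def by auto
  have \<psi>J: "\<psi> u \<in> J" if "u \<in> V" for u using that AB \<psi>A \<psi>B \<sigma> \<tau> S by blast
  have adj: "\<psi> u = \<psi> v \<or> gr (\<psi> u) (\<psi> v)" if uv: "u \<in> V" "v \<in> V" "u \<noteq> v" "adj u v" for u v
  proof -
    consider "u \<in> A" "v \<in> A" | "u \<in> A" "v \<in> B" | "u \<in> B" "v \<in> A" | "u \<in> B" "v \<in> B"
      using uv(1,2) AB(1) by blast
    then show ?thesis
    proof cases
      case 1
      then have "\<sigma> u \<in> S" "\<sigma> v \<in> S" using \<sigma> by auto
      then show ?thesis using S(2)[of "\<sigma> u" "\<sigma> v"] \<psi>A 1 by auto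
    next
      case 2 then show ?thesis using cross(1)[OF 2] uv(4) \<psi>A[OF 2(1)] \<psi>B[OF 2(2)] gr(2)[of "\<tau> v" "\<sigma> u"]
        by auto
    next
      case 3 then show ?thesis using cross(1)[OF 3(2,1)] uv(4) adj_sym[of u v] \<psi>A[OF 3(2)] \<psi>B[OF 3(1)]
        by auto
    next
      case 4 then show ?thesis using uv 4 B_nadj by blast
    qed
  qed
  have nadj: "\<psi> u \<noteq> \<psi> v" if uv: "u \<in> V" "v \<in> V" "u \<noteq> v" "\<not> adj u v" for u v
  proof -
    consider "u \<in> A" "v \<in> A" | "u \<in> A" "v \<in> B" | "u \<in> B" "v \<in> A" | "u \<in> B" "v \<in> B"
      using uv(1,2) AB(1) by blast
    then show ?thesis
    proof cases
      case 1 then show ?thesis using A_adj uv 1 by blast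
    next
      case 2 then show ?thesis using cross(2)[OF 2] uv(4) \<psi>A[OF 2(1)] \<psi>B[OF 2(2)] by auto
    next
      case 3 then show ?thesis using cross(2)[OF 3(2,1)] uv(4) adj_sym[of u v] \<psi>A[OF 3(2)] \<psi>B[OF 3(1)]
        by auto
    next
      case 4 then show ?thesis using uv 4 \<psi>B \<tau>(2) by (auto dest: inj_onD)
    qed
  qed
  have "crg_hom V adj I col wh bl \<psi>" unfolding crg_hom_def
  proof (intro conjI ballI impI)
    show "\<psi> ` V \<subseteq> I" using \<psi>J J by auto
    fix u v assume uv: "u \<in> V" "v \<in> V" "u \<noteq> v"
    show "if \<psi> u = \<psi> v then adj u v = col (\<psi> u)
           else (adj u v \<longrightarrow> \<not> wh (\<psi> u) (\<psi> v)) \<and> (\<not> adj u v \<longrightarrow> \<not> bl (\<psi> u) (\<psi> v))"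
      using adj[OF uv] nadj[OF uv] J(2)[OF \<psi>J[OF uv(1)]] J(3)[OF \<psi>J[OF uv(1)] \<psi>J[OF uv(2)]] gr(1)
      by auto
  qed
  then show ?thesis by blast
qed

end

section \<open>Greedy cliques in an optimally weighted black core\<close>

lemma finite_argmax:
  fixes f :: "'i \<Rightarrow> real"
  assumes "finite S" "S \<noteq> {}"
  obtains v where "v \<in> S" "\<And>j. j \<in> S \<Longrightarrow> f j \<le> f v"
proof -
  have "Max (f ` S) \<in> f ` S" using assms by (intro Max_in) auto
  then obtain v where "v \<in> S" "f v = Max (f ` S)" by (metis imageE)
  moreover have "f j \<le> Max (f ` S)" if "j \<in> S" for j using assms that by (intro Max_ge) auto
  ultimately show ?thesis using that by metis
qed

text \<open>
  Optimal weights \<open>x\<close> on the support \<open>J\<close> of a CRG with black vertices and no black edges, whose gray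
  edges are \<open>gr\<close>: the assumption \<open>deg\<close> is the first order condition for the value \<open>g\<close>, solved for
  the gray degree.
\<close>

locale black_core =
  fixes J :: "'i set" and x :: "'i \<Rightarrow> real" and gr :: "'i \<Rightarrow> 'i \<Rightarrow> bool" and g :: real and w b :: nat
  assumes finJ: "finite J" and x_pos: "i \<in> J \<Longrightarrow> 0 < x i" and x_sum: "sum x J = 1"
    and gr_sym: "gr i j \<Longrightarrow> gr j i" and gr_irrefl: "\<not> gr i i"
    and wb: "1 \<le> w" "w \<le> b" and g: "g < 1"
    and deg: "i \<in> J \<Longrightarrow> real w * (\<Sum>j\<in>{j\<in>J. gr i j}. x j) = real w - g + (real b - real w) * x i"
    and x_le: "i \<in> J \<Longrightarrow> real b * x i \<le> g"
begin

text \<open>For \<open>S = {}\<close> this is all of \<open>J\<close>, the start of the greedy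
  construction.\<close>

definition common_nbrs :: "'i set \<Rightarrow> 'i set" where
  "common_nbrs S = {j\<in>J. \<forall>i\<in>S. gr i j}"

lemma common_nbrs_sub: "common_nbrs S \<subseteq> J" and finite_common_nbrs: "finite (common_nbrs S)"
  and common_nbrs_disj: "common_nbrs S \<inter> S = {}"
  unfolding common_nbrs_def using finJ gr_irrefl by auto

lemma g_pos: "0 < g"
proof -
  obtain i where "i \<in> J" using x_sum by fastforce
  then have "0 < real b * x i" using x_pos wb by simp
  then show ?thesis using x_le[OF \<open>i \<in> J\<close>] by linarith
qed

text \<open>Union bound: each vertex of \<open>S\<close> excludes at most the weight outside its
  gray neighbourhood, namely 1 minus its gray degree, and \<open>deg\<close> evaluates this degree.
  Heavy vertices exclude less, hence the bonus \<open>(real b - real w) * sum x S\<close>.\<close>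

lemma common_nbrs_weight:
  assumes "finite S" "S \<subseteq> J"
  shows "real w - real (card S) * g + (real b - real w) * sum x S \<le> real w * sum x (common_nbrs S)"
  using assms
proof (induction S rule: finite_induct)
  case empty
  then show ?case unfolding common_nbrs_def using x_sum by simp
next
  case (insert i S)
  let ?N = "{j\<in>J. gr i j}"
  have eq: "common_nbrs (insert i S) = common_nbrs S \<inter> ?N" unfolding common_nbrs_def by auto
  have "sum x (common_nbrs S) + sum x ?N = sum x (common_nbrs S \<union> ?N) + sum x (common_nbrs S \<inter> ?N)"
    using finite_common_nbrs finJ by (simp add: sum.union_inter)
  also have "sum x (common_nbrs S \<union> ?N) \<le> sum x J"
    using finJ x_pos common_nbrs_sub by (intro sum_mono2) (auto intro: less_imp_le)
  finally have "sum x (common_nbrs S) + sum x ?N - 1 \<le> sum x (common_nbrs (insert i S))" using x_sum eq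
    by simp
  then have "real w * (sum x (common_nbrs S) + sum x ?N - 1) \<le> real w * sum x (common_nbrs (insert i S))"
    by (intro mult_left_mono) auto
  moreover have "real w * sum x ?N = real w - g + (real b - real w) * x i"
    using insert by (intro deg) auto
  ultimately show ?case using insert by (simp add: algebra_simps)
qed

text \<open>
  The clique is built greedily from vertices of maximal weight, which keeps every common neighbour
  at most as heavy as every clique vertex.
\<close>

lemma clique_build:
  assumes "k \<le> w"
  shows "\<exists>S m. S \<subseteq> J \<and> card S = k \<and> finite S \<and> (\<forall>i\<in>S. \<forall>j\<in>S. i \<noteq> j \<longrightarrow> gr i j) \<and>
    (\<forall>i\<in>S. m \<le> x i) \<and> (\<forall>j\<in>common_nbrs S. x j \<le> m) \<and> real b * m < 1 \<and> 0 < m"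
  using assms
proof (induction k)
  case 0
  have "x j \<le> g / b" if "j \<in> J" for j using x_le[OF that] wb by (simp add: field_simps)
  moreover have "real b * (g / b) < 1" "0 < g / b" using g g_pos wb by auto
  ultimately show ?case using common_nbrs_sub by (intro exI[of _ "{}"] exI[of _ "g / b"]) auto
next
  case (Suc k)
  then obtain S m where S: "S \<subseteq> J" "card S = k" "finite S" "\<forall>i\<in>S. \<forall>j\<in>S. i \<noteq> j \<longrightarrow> gr i j"
    "\<forall>i\<in>S. m \<le> x i" "\<forall>j\<in>common_nbrs S. x j \<le> m" "real b * m < 1" by auto
  \<comment> \<open>Fewer than \<open>w\<close> vertices with \<open>g < 1\<close> cannot exhaust
    the weight, so a further common neighbour exists.\<close>
  have "real k * g < real w"
  proof -
    have "real k * g \<le> real k * 1" using g by (intro mult_left_mono) auto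
    then show ?thesis using Suc by simp
  qed
  moreover have "0 \<le> (real b - real w) * sum x S"
    using S(1) wb by (intro mult_nonneg_nonneg sum_nonneg) (auto intro!: less_imp_le x_pos)
  ultimately have "0 < real w * sum x (common_nbrs S)" using common_nbrs_weight[OF S(3,1), unfolded S(2)]
    by linarith
  then have "common_nbrs S \<noteq> {}" by auto
  then obtain v where v: "v \<in> common_nbrs S" "\<And>j. j \<in> common_nbrs S \<Longrightarrow> x j \<le> x v"
    using finite_argmax[OF finite_common_nbrs, of S x] by blast
  have vS: "v \<notin> S" and vJ: "v \<in> J" using v common_nbrs_disj[of S] common_nbrs_sub by auto
  have "common_nbrs (insert v S) \<subseteq> common_nbrs S" unfolding common_nbrs_def by auto
  moreover have "\<forall>i\<in>insert v S. \<forall>j\<in>insert v S. i \<noteq> j \<longrightarrow> gr i j"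
    using S(4) v(1) gr_sym unfolding common_nbrs_def by blast
  moreover have "\<forall>i\<in>insert v S. x v \<le> x i" using S v by force
  moreover have "real b * x v < 1" using x_le[OF vJ] g by simp
  ultimately show ?case using S v vS vJ x_pos
    by (intro exI[of _ "insert v S"] exI[of _ "x v"]) auto
qed

text \<open>Few common neighbours, each of weight at most \<open>m\<close>, contradict the lower
  bound on their total weight: with at most \<open>b - k\<close> of them the two bounds combine to
  \<open>w - k g \<le> (w - k) b m\<close>, which fails because \<open>g < 1\<close> and
  \<open>b m < 1\<close>. The clique vertices, of weight at least \<open>m\<close>, enter through
  the bonus term.\<close>

lemma common_nbrs_count:
  assumes S: "S \<subseteq> J" "card S = k" "finite S" "\<forall>i\<in>S. m \<le> x i" "\<forall>j\<in>common_nbrs S. x j \<le> m"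
    and m: "real b * m < 1" "0 < m" and k: "k \<le> w"
  shows "b < card (common_nbrs S) + k"
proof (rule ccontr)
  assume "\<not> ?thesis"
  then have c: "real (card (common_nbrs S)) \<le> real b - real k" by linarith
  have 1: "sum x (common_nbrs S) \<le> real (card (common_nbrs S)) * m"
    using S sum_bounded_above[of "common_nbrs S" x m] by auto
  also have "\<dots> \<le> (real b - real k) * m" using c m by (intro mult_right_mono) auto
  finally have "real w * sum x (common_nbrs S) \<le> real w * ((real b - real k) * m)"
    by (intro mult_left_mono) auto
  moreover have "real k * m \<le> sum x S" using S sum_bounded_below[of S m x] by auto
  then have "(real b - real w) * (real k * m) \<le> (real b - real w) * sum x S"
    using wb by (intro mult_left_mono) auto
  ultimately have "real w - real k * g + (real b - real w) * (real k * m) \<le> real w * ((real b - real k) * m)"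
    using common_nbrs_weight[OF S(3,1), unfolded S(2)] by linarith
  then have 2: "real w - real k * g \<le> (real w - real k) * (real b * m)"
    by (simp add: algebra_simps)
  have 3: "(real w - real k) * (real b * m) \<le> (real w - real k) * 1"
    using k m by (intro mult_left_mono) auto
  \<comment> \<open>For \<open>k = 0\<close> the strict inequality comes from
    \<open>b m < 1\<close>, otherwise from \<open>g < 1\<close>.\<close>
  show False
  proof (cases "k = 0")
    case True
    then have "real w * 1 \<le> real w * (real b * m)" using 2 by simp
    then show False using m wb by simp
  next
    case False
    then have "real k * g < real k * 1" using g by (intro mult_strict_left_mono) auto
    then show False using 2 3 by simp
  qed
qed

lemma exists_clique_with_neighbours:
  assumes "k \<le> w"
  shows "\<exists>S. S \<subseteq> J \<and> card S = k \<and> finite S \<and> (\<forall>i\<in>S. \<forall>j\<in>S. i \<noteq> j \<longrightarrow> gr i j) \<and> b < card (common_nbrs S) + k"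
proof -
  obtain S m where S: "S \<subseteq> J" "card S = k" "finite S" "\<forall>i\<in>S. \<forall>j\<in>S. i \<noteq> j \<longrightarrow> gr i j"
    "\<forall>i\<in>S. m \<le> x i" "\<forall>j\<in>common_nbrs S. x j \<le> m" "real b * m < 1" "0 < m"
    using clique_build[OF assms] by auto
  show ?thesis using S(1-4) common_nbrs_count[OF S(1-3,5-8) assms] by blast
qed

end

section \<open>Placing the split graph in a black core\<close>

locale black_split = split_structure V adj A B w b + black_core J x gr g w b
  for V :: "'a set" and adj A B w b and J :: "'i set" and x gr g +
  fixes I col wh bl
  assumes JI: "J \<subseteq> I" and colJ: "i \<in> J \<Longrightarrow> col i"
    and nblJ: "i \<in> J \<Longrightarrow> j \<in> J \<Longrightarrow> i \<noteq> j \<Longrightarrow> \<not> bl i j"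
    and gr_nwh: "gr i j \<Longrightarrow> \<not> wh i j"
begin

lemma hom_of_placement:
  assumes "S \<subseteq> J" "\<And>i j. i \<in> S \<Longrightarrow> j \<in> S \<Longrightarrow> i \<noteq> j \<Longrightarrow> gr i j"
    and "\<sigma> ` A \<subseteq> S" "\<tau> ` B \<subseteq> J" "inj_on \<tau> B"
    and "\<And>a \<beta>. a \<in> A \<Longrightarrow> \<beta> \<in> B \<Longrightarrow> adj a \<beta> \<Longrightarrow> \<tau> \<beta> = \<sigma> a \<or> gr (\<tau> \<beta>) (\<sigma> a)"
      "\<And>a \<beta>. a \<in> A \<Longrightarrow> \<beta> \<in> B \<Longrightarrow> \<not> adj a \<beta> \<Longrightarrow> \<tau> \<beta> \<noteq> \<sigma> a"
  shows "\<exists>\<psi>. crg_hom V adj I col wh bl \<psi>"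
  by (rule black_clusters_hom[OF assms JI colJ nblJ gr_nwh gr_sym])

text \<open>A gray star suffices when it has a leaf for each vertex of \<open>B\<close>: the clique
  \<open>A\<close> collapses into the centre, and gray edges to the centre permit every adjacency
  pattern.\<close>

lemma star_hom:
  assumes v: "v \<in> J" and c: "card B \<le> card (common_nbrs {v})"
  shows "\<exists>\<psi>. crg_hom V adj I col wh bl \<psi>"
proof -
  obtain \<tau> where \<tau>: "inj_on \<tau> B" "\<tau> ` B \<subseteq> common_nbrs {v}"
    using card_le_inj[OF finB finite_common_nbrs c] by blast
  have gr: "gr v (\<tau> \<beta>)" if "\<beta> \<in> B" for \<beta> using \<tau>(2) that unfolding common_nbrs_def by auto
  show ?thesis
  proof (rule hom_of_placement[of "{v}" "\<lambda>_. v" \<tau>])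
    show "\<tau> ` B \<subseteq> J" using \<tau> common_nbrs_sub by blast
    show "\<tau> \<beta> = v \<or> gr (\<tau> \<beta>) v" if "\<beta> \<in> B" for \<beta> using gr gr_sym that by blast
    show "\<tau> \<beta> \<noteq> v" if "\<beta> \<in> B" for \<beta> using gr gr_irrefl that by force
  qed (use v \<tau> in auto)
qed

text \<open>The greedy clique of size 1 already has \<open>b\<close> gray neighbours.\<close>

lemma hom_if_B_small:
  assumes "card B \<le> b"
  shows "\<exists>\<psi>. crg_hom V adj I col wh bl \<psi>"
proof -
  obtain S where S: "S \<subseteq> J" "card S = 1" "b < card (common_nbrs S) + 1"
    using exists_clique_with_neighbours[OF wb(1)] by blast
  then obtain v where "S = {v}" by (meson card_1_singletonE)
  then show ?thesis using S assms by (intro star_hom[of v]) auto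
qed

text \<open>
  Choosing for every vertex of \<open>A\<close> a neighbour in \<open>B\<close> to share its cluster with uses at most \<open>w\<close>
  clusters, because two vertices of \<open>A\<close> can choose the same neighbour.
\<close>

lemma hom_if_shared_neighbour:
  assumes cB: "card B = b + 1" and cA: "card A = w + 1"
    and b0: "b0 \<in> B" and a12: "a1 \<in> A" "a2 \<in> A" "a1 \<noteq> a2" "adj a1 b0" "adj a2 b0"
  shows "\<exists>\<psi>. crg_hom V adj I col wh bl \<psi>"
proof -
  have "\<forall>a\<in>A. \<exists>\<beta>\<in>B. adj a \<beta> \<and> (adj a b0 \<longrightarrow> \<beta> = b0)"
    using A_has_neighbour[OF cB] b0 by metis
  then obtain \<phi> where \<phi>: "\<And>a. a \<in> A \<Longrightarrow> \<phi> a \<in> B \<and> adj a (\<phi> a) \<and> (adj a b0 \<longrightarrow> \<phi> a = b0)"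
    by metis
  define k where "k = card (\<phi> ` A)"
  have "\<phi> ` A = \<phi> ` (A - {a1})" using \<phi> a12 by (auto simp: image_iff)
  then have "k \<le> card (A - {a1})" unfolding k_def using finA by (metis card_image_le finite_Diff)
  then have k: "k \<le> w" using a12 cA finA by simp
  obtain S where S: "S \<subseteq> J" "card S = k" "finite S" "\<forall>i\<in>S. \<forall>j\<in>S. i \<noteq> j \<longrightarrow> gr i j" "b < card (common_nbrs S) + k"
    using exists_clique_with_neighbours[OF k] by blast
  have \<phi>B: "\<phi> ` A \<subseteq> B" using \<phi> by auto
  obtain \<iota> where \<iota>: "bij_betw \<iota> (\<phi> ` A) S"
    using finite_same_card_bij[of "\<phi> ` A" S] S finA k_def by auto
  have "card (B - \<phi> ` A) = b + 1 - k" using \<phi>B finB cB k_def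
    by (simp add: card_Diff_subset finite_subset)
  \<comment> \<open>\<open>B\<close> needs \<open>k\<close> clusters in \<open>S\<close> and
    \<open>b + 1 - k\<close> others that see all of \<open>S\<close>; the strict bound on the common
    neighbours provides this number.\<close>
  then have "card (B - \<phi> ` A) \<le> card (common_nbrs S)" using S by simp
  then obtain t where t: "inj_on t (B - \<phi> ` A)" "t ` (B - \<phi> ` A) \<subseteq> common_nbrs S"
    using card_le_inj[of "B - \<phi> ` A" "common_nbrs S"] finB finite_common_nbrs by blast
  define \<tau> where "\<tau> \<beta> = (if \<beta> \<in> \<phi> ` A then \<iota> \<beta> else t \<beta>)" for \<beta>
  have \<iota>S: "\<iota> \<beta> \<in> S" if "\<beta> \<in> \<phi> ` A" for \<beta> using \<iota> that bij_betwE by blast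
  have tS: "t \<beta> \<in> common_nbrs S" if "\<beta> \<in> B" "\<beta> \<notin> \<phi> ` A" for \<beta> using t that by blast
  show ?thesis
  proof (rule hom_of_placement[of S "\<iota> \<circ> \<phi>" \<tau>])
    show "S \<subseteq> J" by fact
    show "gr i j" if "i \<in> S" "j \<in> S" "i \<noteq> j" for i j using S that by blast
    show "(\<iota> \<circ> \<phi>) ` A \<subseteq> S" using \<iota>S by auto
    show "\<tau> ` B \<subseteq> J"
      using \<iota>S subsetD[OF S(1)] subsetD[OF common_nbrs_sub tS] unfolding \<tau>_def by auto
    show "inj_on \<tau> B"
    proof (rule inj_onI)
      fix \<beta> \<gamma> assume bg: "\<beta> \<in> B" "\<gamma> \<in> B" "\<tau> \<beta> = \<tau> \<gamma>"
      have disj: "\<iota> \<beta>' \<noteq> t \<gamma>'" if "\<beta>' \<in> \<phi> ` A" "\<gamma>' \<in> B" "\<gamma>' \<notin> \<phi> ` A" for \<beta>' \<gamma>'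
        using \<iota>S[OF that(1)] tS[OF that(2,3)] common_nbrs_disj[of S] by auto
      show "\<beta> = \<gamma>"
      proof (cases "\<beta> \<in> \<phi> ` A"; cases "\<gamma> \<in> \<phi> ` A")
        assume "\<beta> \<in> \<phi> ` A" "\<gamma> \<in> \<phi> ` A"
        then show ?thesis using bg inj_onD[OF bij_betw_imp_inj_on[OF \<iota>]] unfolding \<tau>_def by simp
      next
        assume "\<beta> \<in> \<phi> ` A" "\<gamma> \<notin> \<phi> ` A"
        then show ?thesis using bg disj[of \<beta> \<gamma>] unfolding \<tau>_def by simp
      next
        assume "\<beta> \<notin> \<phi> ` A" "\<gamma> \<in> \<phi> ` A"
        then show ?thesis using bg disj[of \<gamma> \<beta>] unfolding \<tau>_def by simp
      next
        assume "\<beta> \<notin> \<phi> ` A" "\<gamma> \<notin> \<phi> ` A"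
        then show ?thesis using bg inj_onD[OF t(1), of \<beta> \<gamma>] unfolding \<tau>_def by simp
      qed
    qed
    fix a \<beta> assume a\<beta>: "a \<in> A" "\<beta> \<in> B"
    have \<sigma>S: "\<iota> (\<phi> a) \<in> S" using \<iota>S a\<beta> by blast
    show "\<tau> \<beta> = (\<iota> \<circ> \<phi>) a \<or> gr (\<tau> \<beta>) ((\<iota> \<circ> \<phi>) a)"
    proof (cases "\<beta> \<in> \<phi> ` A")
      case True
      then show ?thesis using S(4) \<iota>S[OF True] \<sigma>S unfolding \<tau>_def by auto
    next
      case False
      then have "gr (\<iota> (\<phi> a)) (t \<beta>)" using tS[OF a\<beta>(2) False] \<sigma>S unfolding common_nbrs_def by blast
      then show ?thesis using gr_sym False unfolding \<tau>_def by auto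
    qed
    assume nadj: "\<not> adj a \<beta>"
    show "\<tau> \<beta> \<noteq> (\<iota> \<circ> \<phi>) a"
    proof (cases "\<beta> \<in> \<phi> ` A")
      case True
      then show ?thesis
        using bij_betw_imp_inj_on[OF \<iota>] \<phi>[OF a\<beta>(1)] a\<beta> nadj unfolding \<tau>_def
        by (auto dest: inj_onD)
    next
      case False
      then show ?thesis using tS[OF a\<beta>(2) False] \<sigma>S common_nbrs_disj[of S] unfolding \<tau>_def by auto
    qed
  qed
qed

text \<open>
  Every vertex of \<open>A - {a0}\<close> shares its cluster in \<open>S\<close> with one of its private neighbours, \<open>a0\<close> does
  so in \<open>v\<close>. The remaining neighbours of \<open>a0\<close> need only see \<open>v\<close>, all others only \<open>S\<close>.
\<close>

lemma hom_if_private_neighbours: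
  assumes cB: "card B = b + 1" and cA: "card A = w + 1"
    and unique: "\<forall>\<beta>\<in>B. \<forall>a\<in>A. \<forall>a'\<in>A. adj a \<beta> \<longrightarrow> adj a' \<beta> \<longrightarrow> a = a'"
    and S: "S \<subseteq> J" "card S = w" "finite S" "\<forall>i\<in>S. \<forall>j\<in>S. i \<noteq> j \<longrightarrow> gr i j" "b < card (common_nbrs S) + w"
    and v: "v \<in> common_nbrs S" and a0: "a0 \<in> A"
    and leaves: "card {\<beta>\<in>B. adj a0 \<beta>} \<le> card (common_nbrs {v} - S) + 1"
  shows "\<exists>\<psi>. crg_hom V adj I col wh bl \<psi>"
proof -
  have priv: "a = a'" if "a \<in> A" "a' \<in> A" "\<beta> \<in> B" "adj a \<beta>" "adj a' \<beta>" for a a' \<beta>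
    using unique that by blast
  obtain e where e: "\<And>a. a \<in> A \<Longrightarrow> e a \<in> B \<and> adj a (e a)" using A_has_neighbour[OF cB] by metis
  have e_inj: "a = a'" if "a \<in> A" "a' \<in> A" "e a = e a'" for a a'
    using priv[of a a' "e a"] e[of a] e[of a'] that by auto
  have vJ: "v \<in> J" and vS: "v \<notin> S" and grv: "\<And>i. i \<in> S \<Longrightarrow> gr i v"
    using v common_nbrs_disj[of S] unfolding common_nbrs_def by auto
  define D where "D = {\<beta>\<in>B. adj a0 \<beta>}"
  have finD: "finite D" and DB: "D \<subseteq> B" unfolding D_def using finB by auto
  have e0: "e a0 \<in> D" unfolding D_def using e[OF a0] by auto
  have "card (D - {e a0}) = card D - 1" using e0 finD by simp
  then have "card (D - {e a0}) \<le> card (common_nbrs {v} - S)" using leaves unfolding D_def by simp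
  then obtain t1 where t1: "inj_on t1 (D - {e a0})" "t1 ` (D - {e a0}) \<subseteq> common_nbrs {v} - S"
    using card_le_inj[of "D - {e a0}" "common_nbrs {v} - S"] finD finite_common_nbrs by blast
  define T1 where "T1 = t1 ` (D - {e a0})"
  have cT1: "card T1 = card D - 1" and finT1: "finite T1"
    unfolding T1_def using t1 e0 finD by (simp_all add: card_image)
  define E where "E = e ` (A - {a0})"
  have cE: "card E = w" unfolding E_def
    using e_inj a0 cA finA by (subst card_image) (auto simp: inj_on_def)
  have EB: "E \<subseteq> B" unfolding E_def using e by auto
  have ED: "E \<inter> D = {}" unfolding E_def D_def using e priv a0 by blast
  define R where "R = B - D - E"
  have finE: "finite E" using EB finB finite_subset by blast
  have "card (D \<union> E) = card D + w"
    using finD finE ED cE by (subst card_Un_disjoint) auto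
  moreover have "R = B - (D \<union> E)" unfolding R_def by auto
  moreover have "card (B - (D \<union> E)) = card B - card (D \<union> E)"
    using DB EB finD finE by (intro card_Diff_subset) auto
  ultimately have cR: "card R = b + 1 - (card D + w)" using cB by simp
  \<comment> \<open>One common neighbour of \<open>S\<close> is taken by \<open>v\<close> and at
    most \<open>card D - 1\<close> by \<open>T1\<close>; at least \<open>b + 1 - w - card D\<close>
    remain, the size of \<open>R\<close>.\<close>
  have "card (common_nbrs S - {v} - T1) \<ge> card (common_nbrs S) - 1 - (card D - 1)"
  proof -
    have "card (common_nbrs S - {v}) - card T1 \<le> card (common_nbrs S - {v} - T1)"
      by (rule diff_card_le_card_Diff[OF finT1])
    moreover have "card (common_nbrs S - {v}) = card (common_nbrs S) - 1" using v finite_common_nbrs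
      by simp
    ultimately show ?thesis using cT1 by simp
  qed
  moreover have "card D \<ge> 1" using e0 finD by (metis One_nat_def Suc_leI card_gt_0_iff empty_iff)
  ultimately have "card R \<le> card (common_nbrs S - {v} - T1)" using cR S(5) by linarith
  then obtain t2 where t2: "inj_on t2 R" "t2 ` R \<subseteq> common_nbrs S - {v} - T1"
    using card_le_inj[of R "common_nbrs S - {v} - T1"] finB finite_common_nbrs unfolding R_def by blast
  obtain \<sigma>0 where \<sigma>0: "bij_betw \<sigma>0 (A - {a0}) S"
    using finite_same_card_bij[of "A - {a0}" S] finA S cA a0 by auto
  define \<sigma> where "\<sigma> a = (if a = a0 then v else \<sigma>0 a)" for a
  have \<sigma>S: "\<sigma> a \<in> S" if "a \<in> A" "a \<noteq> a0" for a
    using that \<sigma>0 bij_betwE unfolding \<sigma>_def by fastforce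
  have \<sigma>inj: "a = a'" if "a \<in> A" "a' \<in> A" "\<sigma> a = \<sigma> a'" for a a'
    using that \<sigma>S[of a] \<sigma>S[of a'] vS inj_onD[OF bij_betw_imp_inj_on[OF \<sigma>0], of a a']
    unfolding \<sigma>_def by (auto split: if_splits)
  \<comment> \<open>Private neighbours differ, so \<open>e\<close> is injective and the vertex that
    owns a chosen neighbour can be recovered.\<close>
  obtain \<nu> where \<nu>: "\<And>a. a \<in> A \<Longrightarrow> \<nu> (e a) = a"
  proof -
    have "inj_on e A" using e_inj by (auto simp: inj_on_def)
    then show ?thesis using that[of "inv_into A e"] by simp
  qed
  define \<tau> where "\<tau> \<beta> = (if \<beta> = e a0 \<or> \<beta> \<in> E then \<sigma> (\<nu> \<beta>) else if \<beta> \<in> D then t1 \<beta> else t2 \<beta>)" for \<beta>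
  have \<tau>e: "\<tau> (e a) = \<sigma> a" if "a \<in> A" for a
    using that \<nu> unfolding \<tau>_def E_def by auto
  have \<tau>D: "\<tau> \<beta> = t1 \<beta>" if "\<beta> \<in> D - {e a0}" for \<beta> using that ED unfolding \<tau>_def by auto
  have \<tau>R: "\<tau> \<beta> = t2 \<beta>" if "\<beta> \<in> R" for \<beta> using that e0 unfolding \<tau>_def R_def by auto
  have B_cases: "(\<exists>a\<in>A. \<beta> = e a) \<or> \<beta> \<in> D - {e a0} \<or> \<beta> \<in> R" if "\<beta> \<in> B" for \<beta>
    using that a0 unfolding R_def E_def by auto
  have T1v: "t1 \<beta> \<in> J \<and> gr v (t1 \<beta>) \<and> t1 \<beta> \<notin> S \<and> t1 \<beta> \<noteq> v \<and> t1 \<beta> \<in> T1" if "\<beta> \<in> D - {e a0}" for \<beta>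
  proof -
    have 1: "t1 \<beta> \<in> common_nbrs {v} - S" "t1 \<beta> \<in> T1" using t1(2) that unfolding T1_def by blast+
    then show ?thesis using gr_irrefl[of v] unfolding common_nbrs_def by auto
  qed
  have T2v: "t2 \<beta> \<in> J \<and> (\<forall>i\<in>S. gr i (t2 \<beta>)) \<and> t2 \<beta> \<notin> S \<and> t2 \<beta> \<noteq> v \<and> t2 \<beta> \<notin> T1" if "\<beta> \<in> R" for \<beta>
  proof -
    have "t2 \<beta> \<in> common_nbrs S - {v} - T1" using t2(2) that by blast
    then show ?thesis using common_nbrs_disj[of S] unfolding common_nbrs_def by auto
  qed
  have \<sigma>Sv: "\<sigma> a \<in> insert v S" if "a \<in> A" for a using \<sigma>S that unfolding \<sigma>_def by auto
  have \<sigma>J: "\<sigma> a \<in> J" if "a \<in> A" for a using \<sigma>Sv[OF that] S(1) vJ by blast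
  show ?thesis
  proof (rule hom_of_placement[of "insert v S" \<sigma> \<tau>])
    show "insert v S \<subseteq> J" using S vJ by auto
    show "gr i j" if "i \<in> insert v S" "j \<in> insert v S" "i \<noteq> j" for i j
      using that S(4) grv gr_sym by auto
    show "\<sigma> ` A \<subseteq> insert v S" using \<sigma>Sv by auto
    show "\<tau> ` B \<subseteq> J"
    proof
      fix z assume "z \<in> \<tau> ` B"
      then obtain \<beta> where \<beta>: "\<beta> \<in> B" "z = \<tau> \<beta>" by auto
      from B_cases[OF \<beta>(1)] show "z \<in> J"
        using \<beta> \<tau>e \<tau>D \<tau>R \<sigma>J T1v T2v by auto
    qed
    show "inj_on \<tau> B"
    proof (rule inj_onI)
      fix \<beta> \<gamma> assume bg: "\<beta> \<in> B" "\<gamma> \<in> B" "\<tau> \<beta> = \<tau> \<gamma>"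
      show "\<beta> = \<gamma>"
        using B_cases[OF bg(1)]
      proof (elim disjE bexE)
        fix a assume a: "a \<in> A" "\<beta> = e a"
        then have z: "\<tau> \<beta> = \<sigma> a" "\<sigma> a \<in> insert v S" using \<tau>e \<sigma>Sv by auto
        from B_cases[OF bg(2)] show ?thesis
        proof (elim disjE bexE)
          fix a' assume "a' \<in> A" "\<gamma> = e a'"
          then show ?thesis using a z bg(3) \<tau>e \<sigma>inj by auto
        next
          assume "\<gamma> \<in> D - {e a0}"
          then show ?thesis using T1v[of \<gamma>] \<tau>D[of \<gamma>] z bg(3) by auto
        next
          assume "\<gamma> \<in> R"
          then show ?thesis using T2v[of \<gamma>] \<tau>R[of \<gamma>] z bg(3) by auto
        qed
      next
        assume b: "\<beta> \<in> D - {e a0}"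
        from B_cases[OF bg(2)] show ?thesis
        proof (elim disjE bexE)
          fix a' assume "a' \<in> A" "\<gamma> = e a'"
          then show ?thesis using T1v[OF b] \<tau>D[OF b] \<tau>e[of a'] \<sigma>Sv[of a'] bg(3) by auto
        next
          assume "\<gamma> \<in> D - {e a0}"
          then show ?thesis using inj_onD[OF t1(1), of \<beta> \<gamma>] b \<tau>D[OF b] \<tau>D[of \<gamma>] bg(3) by auto
        next
          assume "\<gamma> \<in> R"
          then show ?thesis using T2v[of \<gamma>] \<tau>R[of \<gamma>] T1v[OF b] \<tau>D[OF b] bg(3) by auto
        qed
      next
        assume b: "\<beta> \<in> R"
        from B_cases[OF bg(2)] show ?thesis
        proof (elim disjE bexE)
          fix a' assume "a' \<in> A" "\<gamma> = e a'"
          then show ?thesis using T2v[OF b] \<tau>R[OF b] \<tau>e[of a'] \<sigma>Sv[of a'] bg(3) by auto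
        next
          assume "\<gamma> \<in> D - {e a0}"
          then show ?thesis using T1v[of \<gamma>] \<tau>D[of \<gamma>] T2v[OF b] \<tau>R[OF b] bg(3) by auto
        next
          assume "\<gamma> \<in> R"
          then show ?thesis using inj_onD[OF t2(1), of \<beta> \<gamma>] b \<tau>R[OF b] \<tau>R[of \<gamma>] bg(3) by auto
        qed
      qed
    qed
    fix a \<beta> assume a\<beta>: "a \<in> A" "\<beta> \<in> B"
    show "\<tau> \<beta> = \<sigma> a \<or> gr (\<tau> \<beta>) (\<sigma> a)" if adj: "adj a \<beta>"
      using B_cases[OF a\<beta>(2)]
    proof (elim disjE bexE)
      fix a' assume a': "a' \<in> A" "\<beta> = e a'"
      then have "a = a'" using priv[of a a' \<beta>] a\<beta> adj e[of a'] by auto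
      then show ?thesis using \<tau>e a' by simp
    next
      assume b: "\<beta> \<in> D - {e a0}"
      then have "a = a0" using priv[of a a0 \<beta>] a\<beta> adj a0 unfolding D_def by auto
      then show ?thesis using T1v[OF b] \<tau>D[OF b] gr_sym unfolding \<sigma>_def by auto
    next
      assume b: "\<beta> \<in> R"
      then have "a \<noteq> a0" using adj unfolding R_def D_def by auto
      then show ?thesis using \<sigma>S[of a] a\<beta> T2v[OF b] \<tau>R[OF b] gr_sym by auto
    qed
    show "\<tau> \<beta> \<noteq> \<sigma> a" if nadj: "\<not> adj a \<beta>"
      using B_cases[OF a\<beta>(2)]
    proof (elim disjE bexE)
      fix a' assume a': "a' \<in> A" "\<beta> = e a'"
      then have "a \<noteq> a'" using e[of a'] nadj by auto
      then show ?thesis using \<tau>e[OF a'(1)] a' \<sigma>inj[OF a'(1) a\<beta>(1)] by auto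
    next
      assume b: "\<beta> \<in> D - {e a0}"
      then show ?thesis using T1v[OF b] \<tau>D[OF b] \<sigma>Sv[OF a\<beta>(1)] by auto
    next
      assume b: "\<beta> \<in> R"
      then show ?thesis using T2v[OF b] \<tau>R[OF b] \<sigma>Sv[OF a\<beta>(1)] by auto
    qed
  qed
qed

lemma gray_degree: "i \<in> J \<Longrightarrow> real w * sum x (common_nbrs {i}) = real w - g + (real b - real w) * x i"
  using deg unfolding common_nbrs_def by simp

lemma sum_x_le: "T \<subseteq> J \<Longrightarrow> real b * sum x T \<le> real (card T) * g"
  unfolding sum_distrib_left using x_le sum_bounded_above[of T "\<lambda>i. real b * x i" g] by auto

text \<open>Every weight is at most \<open>g / b\<close>, and the gray neighbours of
  \<open>v\<close> are covered by the \<open>w\<close> vertices of \<open>S\<close> and, if the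
  claim fails, at most \<open>D - 2\<close> others. This is too little for the gray degree of
  \<open>v\<close>. With \<open>D \<le> (b + 1) / (w + 1)\<close> the comparison reduces to the
  factor \<open>w * w - w - 1\<close>, which is positive only from \<open>w = 2\<close> on; hence
  \<open>w = 1\<close> gets a separate argument.\<close>

lemma enough_leaves_clique:
  assumes w2: "2 \<le> w" and S: "S \<subseteq> J" "card S = w" and v: "v \<in> J"
    and D: "(w + 1) * D \<le> b + 1" "1 \<le> D"
  shows "D \<le> card (common_nbrs {v} - S) + 1"
proof (rule ccontr)
  assume "\<not> ?thesis"
  then have c: "real (card (common_nbrs {v} - S)) \<le> real D - 2" by linarith
  have finS: "finite S" using S finJ finite_subset by blast
  have "sum x (common_nbrs {v}) \<le> sum x ((common_nbrs {v} - S) \<union> S)"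
    using S(1) common_nbrs_sub finite_common_nbrs finS
      by (intro sum_mono2) (auto intro!: less_imp_le x_pos)
  also have "\<dots> = sum x (common_nbrs {v} - S) + sum x S"
    using finite_common_nbrs finS by (intro sum.union_disjoint) auto
  finally have 1: "real w * (real b * sum x (common_nbrs {v})) \<le>
     real w * (real b * sum x (common_nbrs {v} - S) + real b * sum x S)"
    using wb by (intro mult_left_mono) (auto simp: distrib_left[symmetric])
  have "common_nbrs {v} - S \<subseteq> J" using common_nbrs_sub by blast
  then have "real b * sum x (common_nbrs {v} - S) \<le> real (card (common_nbrs {v} - S)) * g"
    by (rule sum_x_le)
  also have "\<dots> \<le> (real D - 2) * g" using c g_pos by (intro mult_right_mono) auto
  finally have 2: "real w * (real b * sum x (common_nbrs {v} - S) + real b * sum x S) \<le>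
     real w * ((real D - 2) * g + real w * g)"
    using sum_x_le[OF S(1)] S(2) by (intro mult_left_mono) auto
  have "real b * (real w - g) \<le> real b * (real w * sum x (common_nbrs {v}))"
    using gray_degree[OF v] wb x_pos[OF v] by (intro mult_left_mono) auto
  then have 3: "real b * (real w - g) \<le> real w * ((real D - 2) * g + real w * g)"
    using 1 2 by (simp add: algebra_simps)
  have "real w * g < real w * 1" using g wb by (intro mult_strict_left_mono) auto
  then have "real b * (g * (real w - 1)) < real b * (real w - g)"
    using wb by (intro mult_strict_left_mono) (auto simp: algebra_simps)
  with 3 have "g * (real b * (real w - 1)) < g * (real w * (real D - 2 + real w))"
    by (simp add: algebra_simps)
  then have 4: "real b * (real w - 1) < real w * (real D - 2 + real w)"
    using g_pos by (simp add: mult_less_cancel_left_pos)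
  have "(real w + 1) * real D - 1 \<le> real b"
    using of_nat_mono[OF D(1), where 'a=real] by (simp add: algebra_simps)
  then have "((real w + 1) * real D - 1) * (real w - 1) \<le> real b * (real w - 1)"
    using w2 by (intro mult_right_mono) auto
  with 4 have 5: "(real w * real w - real w - 1) * real D < (real w * real w - real w - 1) * 1"
    by (simp add: algebra_simps)
  have "2 * real w \<le> real w * real w" using w2 by (intro mult_right_mono) auto
  moreover have "2 \<le> real w" using w2 by simp
  ultimately have "0 < real w * real w - real w - 1" by linarith
  with 5 have "real D < 1" by (simp add: mult_less_cancel_left_pos)
  then show False using D by simp
qed

text \<open>For \<open>w = 1\<close> the uniform bound \<open>g / b\<close> is replaced by a
  comparison of two weights, with \<open>v1\<close> heaviest and \<open>v2\<close> heaviest among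
  its gray neighbours: \<open>(b - 1) x v1 \<le> b x v2\<close> as \<open>v1\<close> has at most
  \<open>b\<close> neighbours, and the weight around \<open>v2\<close> is at most
  \<open>(1 + c) x v1\<close>, where \<open>c\<close> counts the neighbours of \<open>v2\<close>
  other than \<open>v1\<close>. Eliminating the weights leaves
  \<open>(b - 1) ^ 2 < b (1 + c)\<close>, hence \<open>b \<le> c + 2\<close>.\<close>

lemma enough_leaves_edge:
  assumes w1: "w = 1" and v1: "v1 \<in> J" "\<And>j. j \<in> J \<Longrightarrow> x j \<le> x v1" and small: "card (common_nbrs {v1}) \<le> b"
    and v2: "v2 \<in> common_nbrs {v1}" "\<And>j. j \<in> common_nbrs {v1} \<Longrightarrow> x j \<le> x v2"
    and D: "2 * D \<le> b + 1"
  shows "D \<le> card (common_nbrs {v2} - {v1}) + 1"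
proof (cases "b \<le> 2")
  case True then show ?thesis using D by linarith
next
  case False
  have b: "real b \<ge> 3" using False by simp
  have v2J: "v2 \<in> J" using v2 common_nbrs_sub by auto
  define c where "c = card (common_nbrs {v2} - {v1})"
  have X: "x v1 > 0" using x_pos v1 by blast
  have d1: "(real b - 1) * x v1 < sum x (common_nbrs {v1})" using gray_degree[OF v1(1)] w1 g by simp
  also have "\<dots> \<le> real (card (common_nbrs {v1})) * x v2"
    using v2 sum_bounded_above[of "common_nbrs {v1}" x] by auto
  also have "\<dots> \<le> real b * x v2" using small x_pos[OF v2J] by (intro mult_right_mono) auto
  finally have 1: "(real b - 1) * x v1 \<le> real b * x v2" by simp
  have "(real b - 1) * x v2 < sum x (common_nbrs {v2})" using gray_degree[OF v2J] w1 g by simp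
  also have "\<dots> \<le> sum x (insert v1 (common_nbrs {v2} - {v1}))"
  proof (rule sum_mono2)
    have sub: "insert v1 (common_nbrs {v2} - {v1}) \<subseteq> J" using common_nbrs_sub[of "{v2}"] v1(1) by auto
    show "0 \<le> x i" if "i \<in> insert v1 (common_nbrs {v2} - {v1}) - common_nbrs {v2}" for i
      using that sub by (intro less_imp_le x_pos) auto
  qed (use finite_common_nbrs in auto)
  also have "\<dots> = x v1 + sum x (common_nbrs {v2} - {v1})" using finite_common_nbrs
    by (subst sum.insert) auto
  also have "sum x (common_nbrs {v2} - {v1}) \<le> real c * x v1"
    unfolding c_def using v1(2) common_nbrs_sub sum_bounded_above[of "common_nbrs {v2} - {v1}" x "x v1"]
      by blast
  finally have "(real b - 1) * x v2 < x v1 + real c * x v1" by simp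
  then have "real b * ((real b - 1) * x v2) < real b * (x v1 + real c * x v1)"
    using b by (intro mult_strict_left_mono) auto
  moreover have "(real b - 1) * ((real b - 1) * x v1) \<le> (real b - 1) * (real b * x v2)"
    using 1 b by (intro mult_left_mono) auto
  ultimately have "x v1 * ((real b - 1) * (real b - 1)) < x v1 * (real b * (1 + real c))"
    by (simp add: algebra_simps)
  then have "(real b - 1) * (real b - 1) < real b * (1 + real c)"
    using X by (simp add: mult_less_cancel_left_pos)
  then have "real b * (real b - 3) < real b * real c" by (simp add: algebra_simps)
  then have "real b - 3 < real c" using b by (simp add: mult_less_cancel_left_pos)
  then have "b \<le> c + 2" by linarith
  then show ?thesis using D False unfolding c_def by linarith
qed

text \<open>If \<open>B\<close> can be chosen with at most \<open>b\<close> vertices, a star is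
  enough. Otherwise \<open>A\<close> has \<open>w + 1\<close> vertices, one more than the greedy
  clique provides. Either two of them share a neighbour in \<open>B\<close> and hence a cluster, or
  their neighbourhoods in \<open>B\<close> are disjoint and one vertex of \<open>A\<close> with few
  neighbours is put outside the greedy clique.\<close>

theorem black_clusters_contain_split_graph: "\<exists>\<psi>. crg_hom V adj I col wh bl \<psi>"
proof (cases "card B = b + 1 \<and> card A = w + 1")
  case False
  then obtain A' B' where s: "split_structure V adj A' B' w b" "card B' \<le> b"
    using small_independent_part by blast
  interpret s: black_split V adj A' B' w b J x gr g I col wh bl
    by (intro black_split.intro s(1) black_core_axioms black_split_axioms.intro JI colJ nblJ gr_nwh)
  show ?thesis by (rule s.hom_if_B_small[OF s(2)])
next
  case True
  then have cB: "card B = b + 1" and cA: "card A = w + 1" by auto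
  show ?thesis
  proof (cases "\<exists>b0\<in>B. \<exists>a1\<in>A. \<exists>a2\<in>A. a1 \<noteq> a2 \<and> adj a1 b0 \<and> adj a2 b0")
    case True
    then show ?thesis using hom_if_shared_neighbour[OF cB cA] by blast
  next
    case False
    then have priv: "\<forall>\<beta>\<in>B. \<forall>a\<in>A. \<forall>a'\<in>A. adj a \<beta> \<longrightarrow> adj a' \<beta> \<longrightarrow> a = a'" by blast
    define D where "D a = {\<beta>\<in>B. adj a \<beta>}" for a
    have finD: "finite (D a)" for a unfolding D_def using finB by auto
    have "A \<noteq> {}" using cA by auto
    \<comment> \<open>Disjoint neighbourhoods share the \<open>b + 1\<close> vertices of
      \<open>B\<close>, so the smallest has at most \<open>(b + 1) / (w + 1)\<close> of them; it
      asks for the fewest leaves.\<close>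
    then obtain a0 where a0: "a0 \<in> A" and min: "\<And>a. a \<in> A \<Longrightarrow> card (D a0) \<le> card (D a)"
      using finite_argmax[OF finA, of "\<lambda>a. - real (card (D a))"] by auto
    have "(w + 1) * card (D a0) = (\<Sum>a\<in>A. card (D a0))" using cA by simp
    also have "\<dots> \<le> (\<Sum>a\<in>A. card (D a))" using min by (intro sum_mono) auto
    also have "\<dots> = card (\<Union>a\<in>A. D a)"
      using finA finD priv unfolding D_def by (intro card_UN_disjoint[symmetric]) blast+
    also have "\<dots> \<le> card B" unfolding D_def using finB by (intro card_mono) auto
    finally have cD: "(w + 1) * card (D a0) \<le> b + 1" using cB by simp
    have "D a0 \<noteq> {}" unfolding D_def using A_has_neighbour[OF cB a0] by auto
    then have D1: "1 \<le> card (D a0)" using finD[of a0] by (simp add: Suc_le_eq card_gt_0_iff)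
    show ?thesis
    proof (cases "w = 1")
      case False
      then have w2: "2 \<le> w" using wb by simp
      obtain S where S: "S \<subseteq> J" "card S = w" "finite S" "\<forall>i\<in>S. \<forall>j\<in>S. i \<noteq> j \<longrightarrow> gr i j" "b < card (common_nbrs S) + w"
        using exists_clique_with_neighbours[of w] by auto
      then have "card (common_nbrs S) > 0" using wb by linarith
      then obtain v where v: "v \<in> common_nbrs S" by (metis card_gt_0_iff ex_in_conv)
      then have "card (D a0) \<le> card (common_nbrs {v} - S) + 1"
        using common_nbrs_sub by (intro enough_leaves_clique[OF w2 S(1,2) _ cD D1]) auto
      then show ?thesis
        using hom_if_private_neighbours[OF cB cA priv S v a0] unfolding D_def by blast
    next
      case True
      have "J \<noteq> {}" using x_sum by auto
      then obtain v1 where v1: "v1 \<in> J" "\<And>j. j \<in> J \<Longrightarrow> x j \<le> x v1"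
        using finite_argmax[OF finJ, of x] by auto
      \<comment> \<open>More than \<open>b\<close> gray neighbours make room for all of
        \<open>B\<close> around \<open>v1\<close> alone.\<close>
      show ?thesis
      proof (cases "card (common_nbrs {v1}) \<le> b")
        case False
        then show ?thesis using star_hom[OF v1(1)] cB by simp
      next
        case small: True
        have "0 \<le> (real b - 1) * x v1" using wb x_pos[OF v1(1)] by simp
        then have pos: "0 < sum x (common_nbrs {v1})" using gray_degree[OF v1(1)] True g by simp
        then have "common_nbrs {v1} \<noteq> {}" by auto
        then obtain v2 where v2: "v2 \<in> common_nbrs {v1}" "\<And>j. j \<in> common_nbrs {v1} \<Longrightarrow> x j \<le> x v2"
          using finite_argmax[OF finite_common_nbrs, of "{v1}" x] by auto
        have bm: "real b * x v1 < 1" using x_le[OF v1(1)] g by simp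
        have c1: "b < card (common_nbrs {v1}) + 1"
          using v1 common_nbrs_sub True bm x_pos[OF v1(1)]
          by (intro common_nbrs_count[of "{v1}" 1 "x v1"]) auto
        have "card (D a0) \<le> card (common_nbrs {v2} - {v1}) + 1"
          using cD True by (intro enough_leaves_edge[OF True v1 small v2]) auto
        then show ?thesis
          using hom_if_private_neighbours[OF cB cA priv _ _ _ _ _ v2(1) a0] v1(1) True c1
          unfolding D_def by auto
      qed
    qed
  qed
qed

end

text \<open>
  With density \<open>w / (w + b)\<close>, making a pair of sets empty (white) costs \<open>w / (w + b)\<close> and making it
  complete (black) costs \<open>b / (w + b)\<close>; these costs are scaled by \<open>w + b\<close>.
\<close>

definition crg_cost :: "nat \<Rightarrow> nat \<Rightarrow> ('i \<Rightarrow> bool) \<Rightarrow> ('i \<Rightarrow> 'i \<Rightarrow> bool) \<Rightarrow> ('i \<Rightarrow> 'i \<Rightarrow> bool) \<Rightarrow>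
    'i \<Rightarrow> 'i \<Rightarrow> real" where
  "crg_cost w b col wh bl i j =
     (if i = j then (if col i then real b else real w)
      else if wh i j then real w else if bl i j then real b else 0)"

lemma crg_cost_nonneg: "0 \<le> crg_cost w b col wh bl i j"
  unfolding crg_cost_def by auto

section \<open>The value of a coloured regularity graph without a homomorphism\<close>

context split_structure
begin

text \<open>On the core the strict condition forces edge costs below \<open>w\<close>, which with
  \<open>w \<le> b\<close> leaves only gray edges. The form there is diagonal, so
  \<open>w * x i = g\<close> for all \<open>i\<close> and \<open>w = card J * g\<close>; absence of
  a homomorphism limits \<open>card J\<close> to \<open>w\<close>.\<close>

lemma white_part_value:
  assumes fin: "finite I" and sym: "\<And>i j. wh i j = wh j i" "\<And>i j. bl i j = bl j i"
    and nohom: "\<nexists>\<psi>. crg_hom V adj I col wh bl \<psi>" and wb: "w \<le> b"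
    and W: "W \<subseteq> I" "\<And>i. i \<in> W \<Longrightarrow> \<not> col i" and y: "\<And>i. i \<in> W \<Longrightarrow> 0 \<le> y i"
  shows "(sum y W)\<^sup>2 \<le> quad_form (crg_cost w b col wh bl) W y"
proof (cases "W = {}")
  case True then show ?thesis by (simp add: quad_form_def)
next
  case False
  let ?M = "crg_cost w b col wh bl"
  have finW: "finite W" using W fin finite_subset by blast
  have M: "?M i j = ?M j i" for i j unfolding crg_cost_def using sym by auto
  obtain J x g where J: "J \<subseteq> W" "J \<noteq> {}" and x: "\<And>i. i \<in> J \<Longrightarrow> 0 < x i" "sum x J = (1::real)"
    and g: "\<And>i. i \<in> J \<Longrightarrow> (\<Sum>j\<in>J. ?M i j * x j) = g"
    and strict: "\<And>i j. i \<in> J \<Longrightarrow> j \<in> J \<Longrightarrow> i \<noteq> j \<Longrightarrow> 2 * ?M i j < ?M i i + ?M j j"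
    and low: "\<And>y. (\<And>i. i \<in> W \<Longrightarrow> 0 \<le> y i) \<Longrightarrow> g * (sum y W)\<^sup>2 \<le> quad_form ?M W y"
    using core_weights[where M="?M", OF finW False M] by blast
  have finJ: "finite J" using J finW finite_subset by blast
  have gray: "\<not> wh i j \<and> \<not> bl i j" if "i \<in> J" "j \<in> J" "i \<noteq> j" for i j
    using strict[OF that] that W(2) J(1) wb unfolding crg_cost_def by (auto split: if_splits)
  have card: "card J \<le> w"
  proof (rule ccontr)
    assume "\<not> card J \<le> w"
    then have "\<exists>\<psi>. crg_hom V adj I col wh bl \<psi>"
      using J W finJ gray by (intro white_clusters_hom[of J I]) auto
    then show False using nohom by blast
  qed
  have "w * x i = g" if i: "i \<in> J" for i
  proof -
    have "(\<Sum>j\<in>J. ?M i j * x j) = (\<Sum>j\<in>J. if j = i then w * x i else 0)"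
      using gray i W(2) J(1) by (intro sum.cong) (auto simp: crg_cost_def)
    then show ?thesis using g[OF i] finJ i by simp
  qed
  then have "(\<Sum>i\<in>J. w * x i) = real (card J) * g" by simp
  then have "real w = real (card J) * g" using x(2) by (simp add: sum_distrib_left[symmetric])
  moreover have "0 < card J" using finJ J by (simp add: card_gt_0_iff)
  ultimately have "1 \<le> g"
  proof (intro leI notI)
    assume "g < 1"
    then have "real (card J) * g < real (card J) * 1"
      using \<open>0 < card J\<close> by (intro mult_strict_left_mono) auto
    then show False using \<open>real w = real (card J) * g\<close> card by simp
  qed
  then have "1 * (sum y W)\<^sup>2 \<le> g * (sum y W)\<^sup>2" by (intro mult_right_mono) auto
  then show ?thesis using low[of y] y by simp
qed

text \<open>A black vertex costs \<open>b\<close>, so the strict condition rules out black edges in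
  the core but tolerates white ones when \<open>w < b\<close>. The equal row sums, solved for the
  gray degree, are the hypothesis \<open>deg\<close> of \<open>black_core\<close>; a value
  \<open>g < 1\<close> would then yield a homomorphism.\<close>

lemma black_part_value:
  assumes fin: "finite I" and sym: "\<And>i j. wh i j = wh j i" "\<And>i j. bl i j = bl j i"
    and wh_bl: "\<And>i j. \<not> (wh i j \<and> bl i j)"
    and nohom: "\<nexists>\<psi>. crg_hom V adj I col wh bl \<psi>" and wb: "w \<le> b" "1 \<le> b"
    and W: "W \<subseteq> I" "\<And>i. i \<in> W \<Longrightarrow> col i" and y: "\<And>i. i \<in> W \<Longrightarrow> 0 \<le> y i"
  shows "(sum y W)\<^sup>2 \<le> quad_form (crg_cost w b col wh bl) W y"
proof (cases "W = {}")
  case True then show ?thesis by (simp add: quad_form_def)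
next
  case False
  let ?M = "crg_cost w b col wh bl"
  have finW: "finite W" using W fin finite_subset by blast
  have M: "?M i j = ?M j i" for i j unfolding crg_cost_def using sym by auto
  obtain J x g where J: "J \<subseteq> W" "J \<noteq> {}" and x: "\<And>i. i \<in> J \<Longrightarrow> 0 < x i" "sum x J = (1::real)"
    and g: "\<And>i. i \<in> J \<Longrightarrow> (\<Sum>j\<in>J. ?M i j * x j) = g"
    and strict: "\<And>i j. i \<in> J \<Longrightarrow> j \<in> J \<Longrightarrow> i \<noteq> j \<Longrightarrow> 2 * ?M i j < ?M i i + ?M j j"
    and low: "\<And>y. (\<And>i. i \<in> W \<Longrightarrow> 0 \<le> y i) \<Longrightarrow> g * (sum y W)\<^sup>2 \<le> quad_form ?M W y"
    using core_weights[where M="?M", OF finW False M] by blast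
  have finJ: "finite J" using J finW finite_subset by blast
  have colJ: "\<And>i. i \<in> J \<Longrightarrow> col i" using J W by blast
  have JI: "J \<subseteq> I" using J W by blast
  have nbl: "\<not> bl i j" if "i \<in> J" "j \<in> J" "i \<noteq> j" for i j
  proof
    assume "bl i j"
    then have wh: "wh i j" and "w < b" using strict[OF that] that colJ unfolding crg_cost_def
      by (auto split: if_splits)
    then show False using wh_bl \<open>bl i j\<close> by blast
  qed
  have xg: "b * x i \<le> g" if i: "i \<in> J" for i
  proof -
    have "?M i i * x i \<le> (\<Sum>j\<in>J. ?M i j * x j)"
      using finJ i x(1) by (intro member_le_sum) (auto simp: crg_cost_nonneg x(1) less_imp_le)
    then show ?thesis using g[OF i] colJ[OF i] unfolding crg_cost_def by simp
  qed
  have "1 \<le> g"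
  proof (rule ccontr)
    assume "\<not> 1 \<le> g"
    then have g1: "g < 1" by simp
    show False
    proof (cases "w = 0")
      \<comment> \<open>\<open>black_core\<close> covers only \<open>w \<ge> 1\<close>. For
        \<open>w = 0\<close> the graph has no edges and white edges cost nothing, so the form is
        diagonal; more than \<open>b\<close> black vertices accommodate the graph
        injectively.\<close>
      case True
      have "b * x i = g" if i: "i \<in> J" for i
      proof -
        have "(\<Sum>j\<in>J. ?M i j * x j) = (\<Sum>j\<in>J. if j = i then b * x i else 0)"
          using nbl i colJ True by (intro sum.cong) (auto simp: crg_cost_def)
        then show ?thesis using g[OF i] finJ i by simp
      qed
      then have "(\<Sum>i\<in>J. b * x i) = real (card J) * g" by simp
      then have bg: "real b = real (card J) * g" using x(2) by (simp add: sum_distrib_left[symmetric])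
      have "0 < card J" using finJ J by (simp add: card_gt_0_iff)
      then have "real (card J) * g < real (card J) * 1" using g1 by (intro mult_strict_left_mono) auto
      then have cJ: "b + 1 \<le> card J" using bg by linarith
      have nadj: "\<not> adj u v" if "u \<in> V" "v \<in> V" "u \<noteq> v" for u v
      proof
        assume "adj u v"
        then have "pairwise_adj adj {u, v}" unfolding pairwise_adj_def using adj_sym by auto
        then have "card {u, v} \<le> w + 1" using clique_le[of "{u, v}"] that by simp
        then show False using True that by simp
      qed
      then have "card V \<le> b + 1" by (intro indep_le) (auto simp: pairwise_adj_def)
      then obtain \<psi> where \<psi>: "inj_on \<psi> V" "\<psi> ` V \<subseteq> J"
        using card_le_inj[OF finV finJ] cJ by (meson le_trans)
      have "crg_hom V adj I col wh bl \<psi>" unfolding crg_hom_def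
      proof (intro conjI ballI impI)
        show "\<psi> ` V \<subseteq> I" using \<psi> JI by auto
        fix u v assume uv: "u \<in> V" "v \<in> V" "u \<noteq> v"
        then have "\<psi> u \<noteq> \<psi> v" using \<psi> by (auto dest: inj_onD)
        moreover have "\<psi> u \<in> J" "\<psi> v \<in> J" using \<psi> uv by auto
        ultimately show "if \<psi> u = \<psi> v then adj u v = col (\<psi> u)
          else (adj u v \<longrightarrow> \<not> wh (\<psi> u) (\<psi> v)) \<and> (\<not> adj u v \<longrightarrow> \<not> bl (\<psi> u) (\<psi> v))"
          using nadj[OF uv] nbl by auto
      qed
      then show False using nohom by blast
    next
      case False
      \<comment> \<open>Black edges being excluded, gray means not white inside the core.\<close>
      define gr where "gr i j \<longleftrightarrow> i \<in> J \<and> j \<in> J \<and> i \<noteq> j \<and> \<not> wh i j" for i j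
      have deg: "real w * (\<Sum>j\<in>{j\<in>J. gr i j}. x j) = real w - g + (real b - real w) * x i"
        if i: "i \<in> J" for i
      proof -
        have "g = (\<Sum>j\<in>J. ?M i j * x j)" using g[OF i] by simp
        \<comment> \<open>Every term is first charged \<open>w * x j\<close> as for a white edge;
          then the diagonal is raised to \<open>b\<close> and the gray edges are refunded.\<close>
        also have "\<dots> = (\<Sum>j\<in>J. (if j = i then (real b - real w) * x i else 0) + real w * x j
            - real w * (if gr i j then x j else 0))"
          using i nbl colJ by (intro sum.cong refl) (auto simp: crg_cost_def gr_def algebra_simps)
        also have "\<dots> = (real b - real w) * x i + real w - real w * (\<Sum>j\<in>J. if gr i j then x j else 0)"
          using finJ i x(2) by (simp add: sum.distrib sum_subtractf sum_distrib_left[symmetric])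
        also have "(\<Sum>j\<in>J. if gr i j then x j else 0) = (\<Sum>j\<in>{j\<in>J. gr i j}. x j)"
          using finJ by (simp add: sum.inter_filter)
        finally show ?thesis by simp
      qed
      interpret black_split V adj A B w b J x gr g I col wh bl
      proof
        show "gr i j \<Longrightarrow> gr j i" "\<not> gr i i" "gr i j \<Longrightarrow> \<not> wh i j" for i j
          unfolding gr_def using sym by auto
      qed (use finJ x wb False g1 deg xg JI colJ nbl in auto)
      show False using black_clusters_contain_split_graph nohom by blast
    qed
  qed
  then have "1 * (sum y W)\<^sup>2 \<le> g * (sum y W)\<^sup>2" by (intro mult_right_mono) auto
  then show ?thesis using low[of y] y by simp
qed

text \<open>The square of \<open>sum y I\<close> expands into the squares of the two colour classes
  and twice their product. A white and a black vertex joined by a gray edge would host the whole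
  graph, \<open>A\<close> in the black and \<open>B\<close> in the white one, so each cross pair
  costs at least 1 and the product is paid for.\<close>

lemma crg_value_aux:
  assumes fin: "finite I" and sym: "\<And>i j. wh i j = wh j i" "\<And>i j. bl i j = bl j i"
    and wh_bl: "\<And>i j. \<not> (wh i j \<and> bl i j)"
    and nohom: "\<nexists>\<psi>. crg_hom V adj I col wh bl \<psi>" and wb: "w \<le> b" "1 \<le> b"
    and y: "\<And>i. i \<in> I \<Longrightarrow> 0 \<le> y i"
  shows "(sum y I)\<^sup>2 \<le> quad_form (crg_cost w b col wh bl) I y"
proof -
  let ?M = "crg_cost w b col wh bl"
  define W where "W = {i\<in>I. \<not> col i}"
  define K where "K = {i\<in>I. col i}"
  have I: "I = W \<union> K" "W \<inter> K = {}" and finWK: "finite W" "finite K" unfolding W_def K_def using fin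
    by auto
  have M: "?M i j = ?M j i" for i j unfolding crg_cost_def using sym by auto
  have cross: "1 \<le> ?M i j" if ij: "i \<in> W" "j \<in> K" for i j
  proof -
    have ne: "i \<noteq> j" and cols: "\<not> col i" "col j" "i \<in> I" "j \<in> I" using ij unfolding W_def K_def by auto
    \<comment> \<open>With \<open>w = 0\<close> a single white vertex would host the graph; so white
      edges at a white vertex do cost at least 1.\<close>
    have "1 \<le> w"
    proof (rule ccontr)
      assume "\<not> 1 \<le> w"
      then have "\<exists>\<psi>. crg_hom V adj I col wh bl \<psi>"
        using cols by (intro white_clusters_hom[of "{i}" I]) auto
      then show False using nohom by blast
    qed
    moreover have "wh i j \<or> bl i j"
    proof (rule ccontr)
      assume gray: "\<not> (wh i j \<or> bl i j)"
      have "crg_hom V adj I col wh bl (\<lambda>u. if u \<in> A then j else i)"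
        unfolding crg_hom_def using cols ne gray sym A_adj B_nadj AB by auto
      then show False using nohom by blast
    qed
    ultimately show ?thesis using ne wb unfolding crg_cost_def by auto
  qed
  have WW: "(sum y W)\<^sup>2 \<le> quad_form ?M W y"
    by (rule white_part_value[OF fin sym nohom wb(1)]) (use y in \<open>auto simp: W_def\<close>)
  have KK: "(sum y K)\<^sup>2 \<le> quad_form ?M K y"
    by (rule black_part_value[OF fin sym wh_bl nohom wb]) (use y in \<open>auto simp: K_def\<close>)
  have WK: "sum y W * sum y K \<le> (\<Sum>i\<in>W. \<Sum>j\<in>K. ?M i j * y i * y j)"
    unfolding sum_product
  proof (intro sum_mono)
    fix i j assume ij: "i \<in> W" "j \<in> K"
    then have "0 \<le> y i * y j" using y I by auto
    then have "1 * (y i * y j) \<le> ?M i j * (y i * y j)" using cross[OF ij] by (intro mult_right_mono) auto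
    then show "y i * y j \<le> ?M i j * y i * y j" by (simp add: mult.assoc)
  qed
  have KW: "(\<Sum>i\<in>K. \<Sum>j\<in>W. ?M i j * y i * y j) = (\<Sum>i\<in>W. \<Sum>j\<in>K. ?M i j * y i * y j)"
    by (subst sum.swap) (simp add: M mult_ac)
  have "quad_form ?M I y = quad_form ?M W y + quad_form ?M K y
      + (\<Sum>i\<in>W. \<Sum>j\<in>K. ?M i j * y i * y j) + (\<Sum>i\<in>K. \<Sum>j\<in>W. ?M i j * y i * y j)"
    unfolding quad_form_def I(1) using finWK I(2)
    by (simp add: sum.union_disjoint sum.distrib)
  moreover have "sum y I = sum y W + sum y K" unfolding I(1) using finWK I(2)
    by (simp add: sum.union_disjoint)
  ultimately show ?thesis using WW KK WK KW by (simp add: power2_sum)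
qed

end

text \<open>If \<open>b < w\<close>, complementation flips the vertex colours and exchanges white
  with black edges, which leaves costs and homomorphisms the same.\<close>

theorem (in split_structure) crg_value:
  assumes fin: "finite I" and sym: "\<And>i j. wh i j = wh j i" "\<And>i j. bl i j = bl j i"
    and disj: "\<And>i j. \<not> (wh i j \<and> bl i j)"
    and nohom: "\<nexists>\<psi>. crg_hom V adj I col wh bl \<psi>" and wb: "1 \<le> w + b"
    and y: "\<And>i. i \<in> I \<Longrightarrow> 0 \<le> y i"
  shows "(sum y I)\<^sup>2 \<le> quad_form (crg_cost w b col wh bl) I y"
proof (cases "w \<le> b")
  case True
  then show ?thesis using wb by (intro crg_value_aux[OF fin sym disj nohom _ _ y]) auto
next
  case False
  interpret c: split_structure V "\<lambda>u v. \<not> adj u v" B A b w by (rule complement)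
  have "crg_hom V (\<lambda>u v. \<not> adj u v) I (\<lambda>i. \<not> col i) bl wh \<psi> = crg_hom V adj I col wh bl \<psi>" for \<psi>
    unfolding crg_hom_def by (auto split: if_splits)
  then have "(sum y I)\<^sup>2 \<le> quad_form (crg_cost b w (\<lambda>i. \<not> col i) bl wh) I y"
    using False nohom disj by (intro c.crg_value_aux[OF fin sym(2,1) _ _ _ _ y]) auto
  moreover have "crg_cost b w (\<lambda>i. \<not> col i) bl wh = crg_cost w b col wh bl"
    unfolding crg_cost_def using disj by (intro ext) auto
  ultimately show ?thesis by simp
qed

section \<open>Embedding into regular tuples\<close>

text \<open>Only a lower density bound, stated for a relation so that edges and nonedges can be
  demanded in the same way.\<close>

definition full_pair :: "real \<Rightarrow> real \<Rightarrow> ('v \<Rightarrow> 'v \<Rightarrow> bool) \<Rightarrow> 'v set \<Rightarrow> 'v set \<Rightarrow> bool" where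
  "full_pair \<mu> \<delta> R X Y \<longleftrightarrow> (\<forall>A\<subseteq>X. \<forall>B\<subseteq>Y. \<mu> * card X \<le> card A \<longrightarrow> \<mu> * card Y \<le> card B \<longrightarrow>
     \<delta> * (real (card A) * real (card B)) \<le> edge_count R A B)"

text \<open>Vertices are placed one after the other; \<open>C u\<close> is the set of images still
  possible for \<open>u\<close>. A good choice for \<open>v\<close> keeps a \<open>\<delta>\<close>
  fraction of every other candidate set, and for each \<open>u\<close> at most a
  \<open>\<mu>\<close> fraction of \<open>U v\<close> is bad, by \<open>full_pair\<close> applied to
  the bad vertices and \<open>C u\<close>. The condition on \<open>h * \<mu>\<close> keeps the
  candidate sets larger than all bad sets together.\<close>

lemma greedy_transversal:
  fixes P :: "'a \<Rightarrow> 'a \<Rightarrow> 'v \<Rightarrow> 'v \<Rightarrow> bool" and U :: "'a \<Rightarrow> 'v set"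
  assumes "finite V" "card V \<le> h"
    and \<mu>: "0 \<le> \<mu>" and \<delta>: "0 < \<delta>" "\<delta> \<le> 1" and t: "real h * \<mu> < t * \<delta> ^ card V"
    and Psym: "\<And>u v x y. P u v x y = P v u y x"
    and U: "\<And>u. u \<in> V \<Longrightarrow> finite (U u) \<and> U u \<noteq> {}"
    and full: "\<And>u v. u \<in> V \<Longrightarrow> v \<in> V \<Longrightarrow> u \<noteq> v \<Longrightarrow> full_pair \<mu> \<delta> (P u v) (U u) (U v)"
    and C: "\<And>u. u \<in> V \<Longrightarrow> C u \<subseteq> U u \<and> t * card (U u) \<le> card (C u)"
  shows "\<exists>f. \<forall>u\<in>V. f u \<in> C u \<and> (\<forall>v\<in>V. u \<noteq> v \<longrightarrow> P u v (f u) (f v))"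
  using assms
proof (induction V arbitrary: C t rule: finite_induct)
  case empty
  then show ?case by simp
next
  case (insert v V)
  have tpos: "0 < t"
  proof -
    have "0 < t * \<delta> ^ card (insert v V)"
      using insert.prems(2,5) by (meson le_less_trans mult_nonneg_nonneg of_nat_0_le_iff)
    then show ?thesis using \<delta> by (simp add: zero_less_mult_iff)
  qed
  have h\<mu>: "real h * \<mu> < t"
  proof -
    have "t * \<delta> ^ card (insert v V) \<le> t * 1"
      using \<delta> tpos by (intro mult_left_mono power_le_one) auto
    then show ?thesis using insert.prems(5) by linarith
  qed
  have h1: "1 \<le> real h" using insert.prems(1) insert.hyps by simp
  have \<mu>t: "\<mu> \<le> t"
  proof -
    have "1 * \<mu> \<le> real h * \<mu>" using h1 \<mu> by (intro mult_right_mono) auto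
    then show ?thesis using h\<mu> by linarith
  qed
  have finU: "finite (U u)" "0 < card (U u)" if "u \<in> insert v V" for u
    using insert.prems(7)[OF that] by (auto simp: card_gt_0_iff)
  have finC: "finite (C u)" if "u \<in> insert v V" for u
    using insert.prems(9)[OF that] finU[OF that] finite_subset by blast
  define Bad where "Bad u = {x\<in>C v. real (card {y\<in>C u. P v u x y}) < \<delta> * card (C u)}" for u
  have bad: "card (Bad u) \<le> \<mu> * card (U v)" if u: "u \<in> V" for u
  proof (rule ccontr)
    assume neg: "\<not> card (Bad u) \<le> \<mu> * card (U v)"
    have uv: "u \<in> insert v V" "v \<noteq> u" using u insert.hyps by auto
    have sub: "Bad u \<subseteq> U v" "C u \<subseteq> U u" using insert.prems(9)[OF uv(1)] insert.prems(9)[of v]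
      unfolding Bad_def by auto
    have "\<mu> * card (U u) \<le> t * card (U u)" using \<mu>t by (intro mult_right_mono) auto
    also have "\<dots> \<le> card (C u)" using insert.prems(9)[OF uv(1)] by auto
    finally have cC: "\<mu> * card (U u) \<le> card (C u)" .
    have 1: "\<delta> * (real (card (Bad u)) * real (card (C u))) \<le> edge_count (P v u) (Bad u) (C u)"
      using insert.prems(8)[of v u] uv sub neg cC unfolding full_pair_def by auto
    have finB: "finite (Bad u)" using finC unfolding Bad_def by auto
    have neB: "Bad u \<noteq> {}" using neg \<mu> by auto
    have "edge_count (P v u) (Bad u) (C u) = (\<Sum>x\<in>Bad u. real (card {y\<in>C u. P v u x y}))"
      unfolding edge_count_def using finC[OF uv(1)]
      by (intro sum.cong refl) (simp add: of_bool_def sum.If_cases Int_def)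
    also have "\<dots> < (\<Sum>x\<in>Bad u. \<delta> * card (C u))"
      using finB neB by (intro sum_strict_mono) (auto simp: Bad_def)
    finally show False using 1 by (simp add: mult_ac)
  qed
  have "\<not> C v \<subseteq> (\<Union>u\<in>V. Bad u)"
  proof
    assume "C v \<subseteq> (\<Union>u\<in>V. Bad u)"
    moreover have "finite (\<Union>u\<in>V. Bad u)" using insert.hyps finC unfolding Bad_def by auto
    ultimately have "card (C v) \<le> card (\<Union>u\<in>V. Bad u)" by (intro card_mono)
    also have "\<dots> \<le> (\<Sum>u\<in>V. card (Bad u))" using insert.hyps by (intro card_UN_le) auto
    finally have "real (card (C v)) \<le> (\<Sum>u\<in>V. real (card (Bad u)))"
      by (metis of_nat_le_iff of_nat_sum)
    also have "\<dots> \<le> (\<Sum>u\<in>V. \<mu> * card (U v))" using bad by (intro sum_mono) auto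
    also have "\<dots> = (real (card V) * \<mu>) * card (U v)" by simp
    also have "\<dots> \<le> (real h * \<mu>) * card (U v)"
      using insert.prems(1) insert.hyps \<mu> by (intro mult_right_mono) auto
    also have "\<dots> < t * card (U v)" using h\<mu> finU[of v] by (intro mult_strict_right_mono) auto
    finally show False using insert.prems(9)[of v] by auto
  qed
  then obtain x where x: "x \<in> C v" "\<And>u. u \<in> V \<Longrightarrow> x \<notin> Bad u" by blast
  define C' where "C' u = {y\<in>C u. P v u x y}" for u
  have "\<exists>f. \<forall>u\<in>V. f u \<in> C' u \<and> (\<forall>w\<in>V. u \<noteq> w \<longrightarrow> P u w (f u) (f w))"
  \<comment> \<open>The new candidate sets keep the fraction \<open>\<delta> * t\<close>, and one
    power of \<open>\<delta>\<close> disappears from the condition, so its right-hand side is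
    unchanged.\<close>
  proof (rule insert.IH[of "\<delta> * t"])
    show "card V \<le> h" using insert.prems(1) insert.hyps by simp
    show "real h * \<mu> < \<delta> * t * \<delta> ^ card V" using insert.prems(5) insert.hyps by (simp add: mult_ac)
    show "C' u \<subseteq> U u \<and> \<delta> * t * real (card (U u)) \<le> real (card (C' u))" if u: "u \<in> V" for u
    proof
      show "C' u \<subseteq> U u" using insert.prems(9)[of u] u unfolding C'_def by auto
      have "\<delta> * (t * card (U u)) \<le> \<delta> * card (C u)"
        using insert.prems(9)[of u] u \<delta> by (intro mult_left_mono) auto
      also have "\<dots> \<le> card (C' u)" using x u unfolding Bad_def C'_def by (auto simp: not_less)
      finally show "\<delta> * t * real (card (U u)) \<le> real (card (C' u))" by simp
    qed
  qed (use insert.prems \<delta> \<mu> Psym in auto)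
  then obtain f where f: "\<And>u. u \<in> V \<Longrightarrow> f u \<in> C' u"
    "\<And>u w. u \<in> V \<Longrightarrow> w \<in> V \<Longrightarrow> u \<noteq> w \<Longrightarrow> P u w (f u) (f w)" by blast
  have 1: "f u \<in> C u" "P v u x (f u)" "P u v (f u) x" if "u \<in> V" for u
    using f(1)[OF that] Psym[of v u x "f u"] unfolding C'_def by auto
  show ?case
  proof (intro exI[of _ "f(v := x)"] ballI conjI impI)
    fix u assume u: "u \<in> insert v V"
    show "(f(v := x)) u \<in> C u" using 1 x u by auto
    fix z assume z: "z \<in> insert v V" "u \<noteq> z"
    show "P u z ((f(v := x)) u) ((f(v := x)) z)"
      using u z 1 f(2) by auto
  qed
qed

lemma full_pair_adj:
  fixes \<mu> \<delta> :: real
  assumes fin: "finite X" "finite Y"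
    and d: "\<And>A B. A \<subseteq> X \<Longrightarrow> B \<subseteq> Y \<Longrightarrow> \<mu> * card X \<le> card A \<Longrightarrow> \<mu> * card Y \<le> card B \<Longrightarrow> \<delta> \<le> edge_density R A B"
    and irr: "\<And>x. \<not> R x x"
  shows "full_pair \<mu> \<delta> (\<lambda>x y. x \<noteq> y \<and> R x y) X Y"
  unfolding full_pair_def
proof (intro allI impI)
  fix A B assume AB: "A \<subseteq> X" "B \<subseteq> Y" "\<mu> * card X \<le> card A" "\<mu> * card Y \<le> card B"
  have finAB: "finite A" "finite B" using AB fin finite_subset by auto
  have "edge_count (\<lambda>x y. x \<noteq> y \<and> R x y) A B = edge_count R A B"
    unfolding edge_count_def using irr by (intro sum.cong refl) (auto simp: of_bool_def)
  also have "\<dots> = edge_density R A B * (real (card A) * real (card B))"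
    by (rule edge_density_mult[OF finAB])
  also have "\<dots> \<ge> \<delta> * (real (card A) * real (card B))"
    using d[OF AB] by (intro mult_right_mono) auto
  finally show "\<delta> * (real (card A) * real (card B)) \<le> edge_count (\<lambda>x y. x \<noteq> y \<and> R x y) A B" .
qed

text \<open>Pairs with equal entries must be discarded from the nonedges. There are at most
  \<open>card A\<close> of them, and \<open>\<delta> * card B \<ge> 1\<close> lets them be paid with
  one of the two \<open>\<delta>\<close> by which the density stays below 1.\<close>

lemma full_pair_nonadj:
  fixes \<mu> \<delta> :: real
  assumes fin: "finite X" "finite Y"
    and d: "\<And>A B. A \<subseteq> X \<Longrightarrow> B \<subseteq> Y \<Longrightarrow> \<mu> * card X \<le> card A \<Longrightarrow> \<mu> * card Y \<le> card B \<Longrightarrow> edge_density R A B \<le> 1 - 2 * \<delta>"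
    and big: "1 \<le> \<delta> * (\<mu> * card Y)" and \<delta>: "0 < \<delta>"
  shows "full_pair \<mu> \<delta> (\<lambda>x y. x \<noteq> y \<and> \<not> R x y) X Y"
  unfolding full_pair_def
proof (intro allI impI)
  fix A B assume AB: "A \<subseteq> X" "B \<subseteq> Y" "\<mu> * card X \<le> card A" "\<mu> * card Y \<le> card B"
  have finAB: "finite A" "finite B" using AB fin finite_subset by auto
  have "(\<Sum>x\<in>A. \<Sum>y\<in>B. (1::real)) \<le>
    (\<Sum>x\<in>A. \<Sum>y\<in>B. of_bool (x \<noteq> y \<and> \<not> R x y) + of_bool (R x y) + of_bool (x = y))"
    by (intro sum_mono) auto
  also have "\<dots> = edge_count (\<lambda>x y. x \<noteq> y \<and> \<not> R x y) A B + edge_count R A B + (\<Sum>x\<in>A. \<Sum>y\<in>B. of_bool (x = y))"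
    unfolding edge_count_def by (simp add: sum.distrib)
  also have "(\<Sum>x\<in>A. \<Sum>y\<in>B. of_bool (x = y)) \<le> (\<Sum>x\<in>A. (1::real))"
    using finAB by (intro sum_mono) (auto simp: of_bool_def)
  also have "edge_count R A B = edge_density R A B * (real (card A) * real (card B))"
    by (rule edge_density_mult[OF finAB])
  also have "\<dots> \<le> (1 - 2 * \<delta>) * (real (card A) * real (card B))"
    using d[OF AB] by (intro mult_right_mono) auto
  finally have "2 * \<delta> * (real (card A) * real (card B)) \<le> edge_count (\<lambda>x y. x \<noteq> y \<and> \<not> R x y) A B + card A"
    by (simp add: algebra_simps)
  moreover have "real (card A) * 1 \<le> real (card A) * (\<delta> * card B)"
  proof (intro mult_left_mono)
    have "\<delta> * (\<mu> * card Y) \<le> \<delta> * card B" using AB \<delta> by (intro mult_left_mono) auto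
    then show "1 \<le> \<delta> * card B" using big by linarith
  qed auto
  ultimately show "\<delta> * (real (card A) * real (card B)) \<le> edge_count (\<lambda>x y. x \<noteq> y \<and> \<not> R x y) A B"
    by (simp add: algebra_simps)
qed

lemma edge_density_sym_diff:
  "\<bar>edge_density E X Y - edge_density F X Y\<bar> \<le> edge_density (\<lambda>x y. E x y \<noteq> F x y) X Y"
proof -
  have "\<bar>edge_count E X Y - edge_count F X Y\<bar> = \<bar>\<Sum>x\<in>X. \<Sum>y\<in>Y. of_bool (E x y) - of_bool (F x y)\<bar>"
    unfolding edge_count_def by (simp add: sum_subtractf)
  also have "\<dots> \<le> (\<Sum>x\<in>X. \<Sum>y\<in>Y. \<bar>of_bool (E x y) - of_bool (F x y)\<bar>)"
    by (intro order_trans[OF sum_abs] sum_mono sum_abs)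
  also have "\<dots> = edge_count (\<lambda>x y. E x y \<noteq> F x y) X Y"
    unfolding edge_count_def by (intro sum.cong refl) (auto simp: of_bool_def)
  finally have "\<bar>edge_count E X Y - edge_count F X Y\<bar> / (real (card X) * real (card Y)) \<le> edge_density (\<lambda>x y. E x y \<noteq> F x y) X Y"
    unfolding edge_density_def by (intro divide_right_mono) auto
  then show ?thesis unfolding edge_density_def by (simp add: diff_divide_distrib[symmetric] abs_divide)
qed

lemma exists_homogeneous_indices:
  fixes D :: "nat \<Rightarrow> nat \<Rightarrow> real"
  assumes sym: "\<And>a b. D a b = D b a"
    and ram: "\<And>E. \<exists>R\<subseteq>{..<r}. card R = h \<and> clique R E \<or> card R = h \<and> indep R (E :: nat set set)"
  shows "\<exists>T black. T \<subseteq> {..<r} \<and> card T = h \<and>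
    (\<forall>a\<in>T. \<forall>b\<in>T. a \<noteq> b \<longrightarrow> (if black then 1/2 \<le> D a b else D a b < 1/2))"
proof -
  define E where "E = {{a, b} |a b. 1/2 \<le> D a b}"
  have E: "{a, b} \<in> E \<longleftrightarrow> 1/2 \<le> D a b" for a b
    unfolding E_def using sym by (auto simp: doubleton_eq_iff)
  obtain R where R: "R \<subseteq> {..<r}" "card R = h" "clique R E \<or> indep R E" using ram[of E] by blast
  from R(3) show ?thesis
  proof
    assume "clique R E"
    then show ?thesis using R E unfolding clique_def by (intro exI[of _ R] exI[of _ True]) auto
  next
    assume "indep R E"
    then show ?thesis using R E unfolding indep_def
      by (intro exI[of _ R] exI[of _ False]) (auto simp: not_le)
  qed
qed

text \<open>A homomorphism may send up to \<open>h\<close> vertices into one set, so each set needs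
  \<open>h\<close> clusters whose pair densities all stay away from 0 or all stay away from 1. They
  come from a regular tuple of Ramsey length \<open>r\<close>, its pairs coloured by density at
  least 1/2; regularity carries the colour over to large subsets with tolerance 1/4.\<close>

lemma homogeneous_clusters:
  fixes h :: nat and \<mu> :: real
  assumes \<mu>: "0 < \<mu>"
  shows "\<exists>\<gamma>::real. 0 < \<gamma> \<and> (\<forall>(U::'v set) R. finite U \<longrightarrow> U \<noteq> {} \<longrightarrow> (\<forall>x y. R x y = R y x) \<longrightarrow>
    (\<exists>Z black. (\<forall>a<h. Z a \<subseteq> U \<and> Z a \<noteq> {} \<and> \<gamma> * card U \<le> card (Z a)) \<and>
      (\<forall>a<h. \<forall>b<h. a \<noteq> b \<longrightarrow> (\<forall>A\<subseteq>Z a. \<forall>B\<subseteq>Z b. \<mu> * card (Z a) \<le> card A \<longrightarrow> \<mu> * card (Z b) \<le> card B \<longrightarrow>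
         (if black then 1/4 \<le> edge_density R A B else edge_density R A B \<le> 3/4)))))"
proof -
  obtain r where r: "\<And>(V::nat set) E. finite V \<Longrightarrow> card V \<ge> r \<Longrightarrow>
     \<exists>R \<subseteq> V. card R = h \<and> clique R E \<or> card R = h \<and> indep R E"
    using ramsey2[of h h] by meson
  define \<epsilon> where "\<epsilon> = min \<mu> (1/4)"
  have \<epsilon>: "0 < \<epsilon>" "\<epsilon> \<le> 1" "\<epsilon> \<le> \<mu>" "\<epsilon> \<le> 1/4" unfolding \<epsilon>_def using \<mu> by auto
  \<comment> \<open>The size bound of \<open>exists_regular_tuple\<close> for
    \<open>\<kappa> = 0\<close>: only regularity is wanted inside a set.\<close>
  define \<gamma> where "\<gamma> = exp (- (real r ^ 2 * (0 + 1) / (\<epsilon> ^ 4 / 16)))"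
  have \<gamma>: "\<gamma> > 0" unfolding \<gamma>_def by simp
  have main: "\<exists>Z black. (\<forall>a<h. Z a \<subseteq> U \<and> Z a \<noteq> {} \<and> \<gamma> * card U \<le> card (Z a)) \<and>
      (\<forall>a<h. \<forall>b<h. a \<noteq> b \<longrightarrow> (\<forall>A\<subseteq>Z a. \<forall>B\<subseteq>Z b. \<mu> * card (Z a) \<le> card A \<longrightarrow> \<mu> * card (Z b) \<le> card B \<longrightarrow>
         (if black then 1/4 \<le> edge_density R A B else edge_density R A B \<le> 3/4)))"
    if U: "finite U" "U \<noteq> {}" and R: "\<forall>x y. R x y = R y x" for U :: "'v set" and R
  proof -
    have R': "\<And>x y. R x y = R y x" using R by blast
    obtain W where W: "\<forall>i<r. W i \<subseteq> U \<and> W i \<noteq> {} \<and> \<gamma> * card U \<le> card (W i)"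
      and reg: "\<forall>i<r. \<forall>j<r. i \<noteq> j \<longrightarrow> regular_pair \<epsilon> R (W i) (W j)"
      using exists_regular_tuple[where k = r and \<kappa> = 0 and R = R and C = R,
          OF \<epsilon>(1,2) order_refl U R' R', folded \<gamma>_def] by (elim exE conjE) blast
    obtain T black where T: "T \<subseteq> {..<r}" "card T = h"
      and hom: "\<forall>a\<in>T. \<forall>b\<in>T. a \<noteq> b \<longrightarrow> (if black then 1/2 \<le> edge_density R (W a) (W b) else edge_density R (W a) (W b) < 1/2)"
    proof -
      have "edge_density R (W a) (W b) = edge_density R (W b) (W a)" for a b
        by (rule edge_density_commute, rule R')
      moreover have "\<exists>T\<subseteq>{..<r}. card T = h \<and> clique T E \<or> card T = h \<and> indep T E" for E
        using r[of "{..<r}"] by simp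
      ultimately have "\<exists>T black. T \<subseteq> {..<r} \<and> card T = h \<and> (\<forall>a\<in>T. \<forall>b\<in>T. a \<noteq> b \<longrightarrow>
          (if black then 1/2 \<le> edge_density R (W a) (W b) else edge_density R (W a) (W b) < 1/2))"
        by (rule exists_homogeneous_indices)
      then show ?thesis using that by (elim exE conjE)
    qed
    have "finite T" using T finite_subset by blast
    then obtain e where e: "bij_betw e {..<h} T" using T by (metis bij_betw_from_nat_into_finite)
    have eT: "e a \<in> T" "e a < r" if "a < h" for a using e that T bij_betwE by fastforce+
    show ?thesis
    proof (intro exI[of _ "\<lambda>a. W (e a)"] exI[of _ black] conjI allI impI)
      fix a assume a: "a < h"
      show "W (e a) \<subseteq> U" "W (e a) \<noteq> {}" "\<gamma> * card U \<le> card (W (e a))" using W eT a by auto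
      fix b A B assume b: "b < h" "a \<noteq> b" and AB: "A \<subseteq> W (e a)" "B \<subseteq> W (e b)"
        and cA: "\<mu> * card (W (e a)) \<le> card A" and cB: "\<mu> * card (W (e b)) \<le> card B"
      have ne: "e a \<noteq> e b" using e a b unfolding bij_betw_def inj_on_def by auto
      have "\<epsilon> * card (W (e a)) \<le> \<mu> * card (W (e a))" "\<epsilon> * card (W (e b)) \<le> \<mu> * card (W (e b))"
        using \<epsilon> by (auto intro: mult_right_mono)
      then have "\<bar>edge_density R A B - edge_density R (W (e a)) (W (e b))\<bar> \<le> \<epsilon>"
        using reg eT[OF a] eT[OF b(1)] ne AB cA cB unfolding regular_pair_def by (meson order_trans)
      moreover have "if black then 1/2 \<le> edge_density R (W (e a)) (W (e b)) else edge_density R (W (e a)) (W (e b)) < 1/2"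
        using hom eT[OF a] eT[OF b(1)] ne by blast
      ultimately show "if black then 1/4 \<le> edge_density R A B else edge_density R A B \<le> 3/4"
        using \<epsilon>(4) by (auto split: if_splits)
    qed
  qed
  show ?thesis
    by (rule exI[of _ \<gamma>], rule conjI[OF \<gamma>], intro allI impI, rule main; assumption)
qed

text \<open>The densities of \<open>F\<close> on a regular tuple define a CRG without homomorphisms,
  since one could be lifted to a forbidden copy by \<open>greedy_transversal\<close>. Turning
  \<open>E\<close>, of density about \<open>p\<close>, into \<open>F\<close> costs on each pair at
  least the CRG cost divided by \<open>w + b\<close>, up to \<open>4 * \<delta>\<close>;
  \<open>crg_value\<close> at uniform weights then bounds the average.\<close>

theorem (in split_structure) distance_to_free_graphs:
  fixes \<epsilon> :: real
  assumes wb: "1 \<le> w + b" and \<epsilon>: "0 < \<epsilon>"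
  defines "p \<equiv> real w / real (w + b)"
  shows "\<exists>n0 \<eta>. 0 < \<eta> \<and> (\<forall>(U::'v set) E F. finite U \<longrightarrow> n0 \<le> card U \<longrightarrow>
    (\<forall>x y. E x y = E y x) \<longrightarrow> (\<forall>x y. F x y = F y x) \<longrightarrow> (\<forall>x. \<not> F x x) \<longrightarrow>
    (\<forall>X\<subseteq>U. \<forall>Y\<subseteq>U. \<bar>edge_count E X Y - p * (real (card X) * real (card Y))\<bar> \<le> \<eta> * real (card U) ^ 2) \<longrightarrow>
    \<not> (\<exists>f. inj_on f V \<and> f ` V \<subseteq> U \<and> (\<forall>u\<in>V. \<forall>v\<in>V. u \<noteq> v \<longrightarrow> (adj u v \<longleftrightarrow> F (f u) (f v)))) \<longrightarrow>
    (1 / real (w + b) - \<epsilon>) * real (card U) ^ 2 \<le> edge_count (\<lambda>x y. E x y \<noteq> F x y) U U)"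
proof -
  define h where "h = card V"
  define t where "t = real (w + b)"
  have t: "t \<ge> 1" unfolding t_def using wb by simp
  have h1: "h \<ge> 1"
  proof -
    obtain S where "S \<subseteq> V" "card S = w + 1" using clique_ex by blast
    then show ?thesis unfolding h_def using finV card_mono[of V S] by simp
  qed
  \<comment> \<open>Six losses of \<open>\<delta>\<close> occur: four when densities are compared on
    a pair, one for the diagonal of the form and one for the energy in the potential. The bound 1/8
    makes the densities 1/4 and 3/4 inside a set acceptable.\<close>
  define \<delta> where "\<delta> = min (\<epsilon> / 6) (1/8)"
  have \<delta>: "0 < \<delta>" "\<delta> \<le> 1/8" "6 * \<delta> \<le> \<epsilon>" unfolding \<delta>_def using \<epsilon> by auto
  \<comment> \<open>Half of what \<open>greedy_transversal\<close> allows for candidate sets that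
    start full.\<close>
  define \<mu> where "\<mu> = \<delta> ^ h / (2 * real h)"
  have \<mu>: "0 < \<mu>" "real h * \<mu> < 1 * \<delta> ^ h"
    unfolding \<mu>_def using \<delta> h1 by auto
  from homogeneous_clusters[where 'v = 'v, OF \<mu>(1), of h]
  obtain \<gamma>2 :: real where \<gamma>2: "\<gamma>2 > 0" and clusters: "\<forall>(U::'v set) R. finite U \<longrightarrow> U \<noteq> {} \<longrightarrow>
     (\<forall>x y. R x y = R y x) \<longrightarrow>
    (\<exists>Z black. (\<forall>a<h. Z a \<subseteq> U \<and> Z a \<noteq> {} \<and> \<gamma>2 * card U \<le> card (Z a)) \<and>
      (\<forall>a<h. \<forall>b<h. a \<noteq> b \<longrightarrow> (\<forall>A\<subseteq>Z a. \<forall>B\<subseteq>Z b. \<mu> * card (Z a) \<le> card A \<longrightarrow> \<mu> * card (Z b) \<le> card B \<longrightarrow>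
         (if black then 1/4 \<le> edge_density R A B else edge_density R A B \<le> 3/4))))"
    by (elim exE conjE) (rule that)
  \<comment> \<open>A \<open>\<mu>\<close> fraction of a cluster, itself a \<open>\<gamma>2\<close>
    fraction of its set, must be large enough for the regularity of the set.\<close>
  define \<epsilon>1 where "\<epsilon>1 = min \<delta> (\<mu> * \<gamma>2)"
  have \<epsilon>1: "0 < \<epsilon>1" "\<epsilon>1 \<le> 1" "\<epsilon>1 \<le> \<delta>" "\<epsilon>1 \<le> \<mu> * \<gamma>2"
    unfolding \<epsilon>1_def using \<delta> \<mu> \<gamma>2 by auto
  \<comment> \<open>With \<open>k \<ge> 1 / \<delta>\<close> the \<open>k\<close> diagonal terms are
    at most a \<open>\<delta>\<close> fraction of all \<open>k ^ 2\<close> terms.\<close>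
  define k where "k = nat \<lceil>1 / \<delta>\<rceil>"
  have k: "1 \<le> \<delta> * real k" "0 < k"
  proof -
    have "1 / \<delta> \<le> real k" unfolding k_def by linarith
    then show 1: "1 \<le> \<delta> * real k" using \<delta> by (simp add: field_simps)
    show "0 < k" using 1 by (cases k) auto
  qed
  define \<kappa> where "\<kappa> = 1 / \<delta>"
  have \<kappa>: "\<kappa> \<ge> 0" unfolding \<kappa>_def using \<delta> by simp
  define \<gamma>1 where "\<gamma>1 = exp (- (real k ^ 2 * (\<kappa> + 1) / (\<epsilon>1 ^ 4 / 16)))"
  have \<gamma>1: "\<gamma>1 > 0" unfolding \<gamma>1_def by simp
  \<comment> \<open>The discrepancy \<open>\<eta> * n ^ 2\<close> is thereby at most
    \<open>\<delta>\<close> relative to pairs of sets of size at least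
    \<open>\<gamma>1 * n\<close>.\<close>
  define \<eta> where "\<eta> = \<delta> * \<gamma>1 ^ 2"
  have \<eta>: "\<eta> > 0" unfolding \<eta>_def using \<delta> \<gamma>1 by simp
  define n0 where "n0 = nat \<lceil>1 / (\<delta> * (\<mu> * (\<gamma>2 * \<gamma>1)))\<rceil> + 1"
  have main: "(1 / t - \<epsilon>) * real (card U) ^ 2 \<le> edge_count (\<lambda>x y. E x y \<noteq> F x y) U U"
    if U: "finite U" "n0 \<le> card U" and Es: "\<forall>x y. E x y = E y x" and Fs: "\<forall>x y. F x y = F y x"
      and Fi: "\<forall>x. \<not> F x x"
      and qr: "\<forall>X\<subseteq>U. \<forall>Y\<subseteq>U. \<bar>edge_count E X Y - p * (real (card X) * real (card Y))\<bar> \<le> \<eta> * real (card U) ^ 2"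
      and free: "\<not> (\<exists>f. inj_on f V \<and> f ` V \<subseteq> U \<and> (\<forall>u\<in>V. \<forall>v\<in>V. u \<noteq> v \<longrightarrow> (adj u v \<longleftrightarrow> F (f u) (f v))))"
    for U :: "'v set" and E F
  proof -
    define C where "C = (\<lambda>x y. E x y \<noteq> F x y)"
    have Fs': "\<And>x y. F x y = F y x" using Fs by blast
    have Cs: "\<And>x y. C x y = C y x" unfolding C_def using Es Fs by auto
    define n where "n = real (card U)"
    have n: "1 / (\<delta> * (\<mu> * (\<gamma>2 * \<gamma>1))) \<le> n" "n > 0"
    proof -
      have "1 / (\<delta> * (\<mu> * (\<gamma>2 * \<gamma>1))) \<le> real n0" unfolding n0_def by linarith
      then show "1 / (\<delta> * (\<mu> * (\<gamma>2 * \<gamma>1))) \<le> n" unfolding n_def using U by linarith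
      show "n > 0" unfolding n_def using U n0_def by simp
    qed
    have Une: "U \<noteq> {}" using n n_def by auto
    have "\<exists>W. (\<forall>i<k. W i \<subseteq> U \<and> W i \<noteq> {} \<and> \<gamma>1 * card U \<le> card (W i)) \<and>
     (\<forall>i<k. \<forall>j<k. i \<noteq> j \<longrightarrow> regular_pair \<epsilon>1 F (W i) (W j)) \<and>
     \<kappa> * (\<Sum>i<k. \<Sum>j\<in>{..<k}-{i}. edge_density C (W i) (W j)) \<le> \<kappa> * (real k ^ 2 * edge_density C U U) + real k ^ 2"
      unfolding \<gamma>1_def by (rule exists_regular_tuple[OF \<epsilon>1(1,2) \<kappa> U(1) Une]) (rule Fs', rule Cs)
    then obtain W where W: "\<And>i. i < k \<Longrightarrow> W i \<subseteq> U \<and> W i \<noteq> {} \<and> \<gamma>1 * card U \<le> card (W i)"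
      and reg: "\<And>i j. i < k \<Longrightarrow> j < k \<Longrightarrow> i \<noteq> j \<Longrightarrow> regular_pair \<epsilon>1 F (W i) (W j)"
      and cost: "\<kappa> * (\<Sum>i<k. \<Sum>j\<in>{..<k}-{i}. edge_density C (W i) (W j)) \<le> \<kappa> * (real k ^ 2 * edge_density C U U) + real k ^ 2"
      by (elim exE conjE) blast
    have finW: "finite (W i)" "0 < card (W i)" if "i < k" for i
      using W[OF that] U(1) finite_subset by (auto simp: card_gt_0_iff)
    have "\<exists>Z black. (\<forall>a<h. Z a \<subseteq> W i \<and> Z a \<noteq> {} \<and> \<gamma>2 * card (W i) \<le> card (Z a)) \<and>
      (\<forall>a<h. \<forall>b<h. a \<noteq> b \<longrightarrow> (\<forall>A\<subseteq>Z a. \<forall>B\<subseteq>Z b. \<mu> * card (Z a) \<le> card A \<longrightarrow> \<mu> * card (Z b) \<le> card B \<longrightarrow>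
         (if black then 1/4 \<le> edge_density F A B else edge_density F A B \<le> 3/4)))" if "i < k" for i
      using clusters W[OF that] finW[OF that] Fs by simp
    then obtain Z col where Z: "\<And>i a. i < k \<Longrightarrow> a < h \<Longrightarrow> Z i a \<subseteq> W i \<and> Z i a \<noteq> {} \<and> \<gamma>2 * card (W i) \<le> card (Z i a)"
      and inner: "\<And>i a b A B. i < k \<Longrightarrow> a < h \<Longrightarrow> b < h \<Longrightarrow> a \<noteq> b \<Longrightarrow> A \<subseteq> Z i a \<Longrightarrow> B \<subseteq> Z i b \<Longrightarrow>
         \<mu> * card (Z i a) \<le> card A \<Longrightarrow> \<mu> * card (Z i b) \<le> card B \<Longrightarrow>
         (if col i then 1/4 \<le> edge_density F A B else edge_density F A B \<le> 3/4)"
      by metis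
    define d where "d i j = edge_density F (W i) (W j)" for i j
    have ds: "d i j = d j i" for i j unfolding d_def by (rule edge_density_commute, rule Fs')
    \<comment> \<open>After a loss of \<open>\<delta>\<close> through regularity, an edge that is
      not white keeps density at least \<open>2 * \<delta>\<close> and one that is not black at most
      \<open>1 - 2 * \<delta>\<close>, the margin that \<open>full_pair_nonadj\<close> asks
      for.\<close>
    define wh where "wh i j \<longleftrightarrow> d i j < 3 * \<delta>" for i j
    define bl where "bl i j \<longleftrightarrow> d i j > 1 - 3 * \<delta>" for i j
    have nohom: "\<nexists>\<psi>. crg_hom V adj {..<k} col wh bl \<psi>"
    proof
      assume "\<exists>\<psi>. crg_hom V adj {..<k} col wh bl \<psi>"
      then obtain \<psi> where \<psi>: "crg_hom V adj {..<k} col wh bl \<psi>" by blast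
      have \<psi>k: "\<psi> u < k" if "u \<in> V" for u using \<psi> that unfolding crg_hom_def by auto
      obtain e where e: "bij_betw e V {..<h}" unfolding h_def
        using finV by (metis ex_bij_betw_finite_nat lessThan_atLeast0)
      have eh: "e u < h" if "u \<in> V" for u using e that bij_betwE by fastforce
      \<comment> \<open>Distinct vertices with the same image under \<open>\<psi>\<close> get
        distinct cluster indices in that set, because \<open>e\<close> is injective.\<close>
      define X where "X u = Z (\<psi> u) (e u)" for u
      define P where "P u v x y \<longleftrightarrow> x \<noteq> y \<and> (adj u v \<longleftrightarrow> F x y)" for u v x y
      have X: "X u \<subseteq> W (\<psi> u)" "X u \<noteq> {}" "\<gamma>2 * card (W (\<psi> u)) \<le> card (X u)" "finite (X u)"
        if "u \<in> V" for u
        using Z[OF \<psi>k[OF that] eh[OF that]] finW[OF \<psi>k[OF that]] finite_subset unfolding X_def by auto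
      have sizeX: "1 \<le> \<delta> * (\<mu> * card (X u))" if u: "u \<in> V" for u
      proof -
        have "\<gamma>2 * (\<gamma>1 * n) \<le> \<gamma>2 * card (W (\<psi> u))"
          using W[OF \<psi>k[OF u]] \<gamma>2 unfolding n_def by (intro mult_left_mono) auto
        also have "\<dots> \<le> card (X u)" using X u by auto
        finally have "\<delta> * (\<mu> * (\<gamma>2 * (\<gamma>1 * n))) \<le> \<delta> * (\<mu> * card (X u))"
          using \<delta> \<mu> by (intro mult_left_mono) auto
        moreover have "1 \<le> \<delta> * (\<mu> * (\<gamma>2 * (\<gamma>1 * n)))"
        proof -
          have pos: "0 < \<delta> * (\<mu> * (\<gamma>2 * \<gamma>1))" using \<delta> \<mu> \<gamma>1 \<gamma>2 by simp
          have "1 \<le> n * (\<delta> * (\<mu> * (\<gamma>2 * \<gamma>1)))"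
            using n(1) by (subst (asm) pos_divide_le_eq[OF pos]) simp
          then show ?thesis by (simp add: mult_ac)
        qed
        ultimately show ?thesis by linarith
      qed
      have outer: "\<bar>edge_density F A B - d (\<psi> u) (\<psi> v)\<bar> \<le> \<delta>"
        if uv: "u \<in> V" "v \<in> V" "\<psi> u \<noteq> \<psi> v" and AB: "A \<subseteq> X u" "B \<subseteq> X v"
          "\<mu> * card (X u) \<le> card A" "\<mu> * card (X v) \<le> card B" for u v A B
      proof -
        have big: "\<epsilon>1 * card (W (\<psi> z)) \<le> \<mu> * card (X z)" if z: "z \<in> V" for z
        proof -
          have "\<epsilon>1 * card (W (\<psi> z)) \<le> \<mu> * \<gamma>2 * card (W (\<psi> z))" using \<epsilon>1 by (intro mult_right_mono) auto
          also have "\<dots> \<le> \<mu> * card (X z)" using X(3)[OF z] \<mu> by simp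
          finally show ?thesis .
        qed
        have "\<bar>edge_density F A B - edge_density F (W (\<psi> u)) (W (\<psi> v))\<bar> \<le> \<epsilon>1"
          using reg[OF \<psi>k[OF uv(1)] \<psi>k[OF uv(2)] uv(3)] big[OF uv(1)] big[OF uv(2)]
            AB X(1)[OF uv(1)] X(1)[OF uv(2)]
          unfolding regular_pair_def by (meson order_trans)
        then show ?thesis using \<epsilon>1(3) unfolding d_def by linarith
      qed
      have full: "full_pair \<mu> \<delta> (P u v) (X u) (X v)" if uv: "u \<in> V" "v \<in> V" "u \<noteq> v" for u v
      proof -
        have ne: "e u \<noteq> e v" using e uv unfolding bij_betw_def inj_on_def by auto
        have in': "if col (\<psi> u) then 1/4 \<le> edge_density F A B else edge_density F A B \<le> 3/4"
          if "\<psi> u = \<psi> v" "A \<subseteq> X u" "B \<subseteq> X v" "\<mu> * card (X u) \<le> card A" "\<mu> * card (X v) \<le> card B" for A B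
          using inner[of "\<psi> u" "e u" "e v" A B] \<psi>k[OF uv(1)] eh uv ne that unfolding X_def by simp
        have hom: "if \<psi> u = \<psi> v then adj u v \<longleftrightarrow> col (\<psi> u)
            else (adj u v \<longrightarrow> \<not> wh (\<psi> u) (\<psi> v)) \<and> (\<not> adj u v \<longrightarrow> \<not> bl (\<psi> u) (\<psi> v))"
          using \<psi> uv unfolding crg_hom_def by blast
        show ?thesis
        proof (cases "adj u v")
          case True
          have "full_pair \<mu> \<delta> (\<lambda>x y. x \<noteq> y \<and> F x y) (X u) (X v)"
          proof (rule full_pair_adj)
            fix A B assume AB: "A \<subseteq> X u" "B \<subseteq> X v" "\<mu> * card (X u) \<le> card A" "\<mu> * card (X v) \<le> card B"
            show "\<delta> \<le> edge_density F A B"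
            proof (cases "\<psi> u = \<psi> v")
              case eq: True
              then show ?thesis using in'[OF eq AB] hom True \<delta>(2) by auto
            next
              case neq: False
              then show ?thesis using outer[OF uv(1,2) neq AB] hom True \<delta>(1) unfolding wh_def by auto
            qed
          qed (use X uv Fi in auto)
          then show ?thesis unfolding P_def using True by simp
        next
          case False
          have "full_pair \<mu> \<delta> (\<lambda>x y. x \<noteq> y \<and> \<not> F x y) (X u) (X v)"
          proof (rule full_pair_nonadj)
            fix A B assume AB: "A \<subseteq> X u" "B \<subseteq> X v" "\<mu> * card (X u) \<le> card A" "\<mu> * card (X v) \<le> card B"
            show "edge_density F A B \<le> 1 - 2 * \<delta>"
            proof (cases "\<psi> u = \<psi> v")
              case eq: True
              then show ?thesis using in'[OF eq AB] hom False \<delta>(2) by auto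
            next
              case neq: False
              then show ?thesis using outer[OF uv(1,2) neq AB] hom False \<delta>(1) unfolding bl_def by auto
            qed
          qed (use X uv sizeX \<delta> in auto)
          then show ?thesis unfolding P_def using False by simp
        qed
      qed
      have Psym: "P u v x y = P v u y x" for u v x y unfolding P_def using adj_sym Fs' by auto
      have "\<exists>f. \<forall>u\<in>V. f u \<in> X u \<and> (\<forall>v\<in>V. u \<noteq> v \<longrightarrow> P u v (f u) (f v))"
        by (rule greedy_transversal[where h = h and \<mu> = \<mu> and \<delta> = \<delta> and t = 1 and U = X])
          (use finV \<mu> \<delta> Psym X full in \<open>auto simp: h_def\<close>)
      then obtain f where f: "\<And>u. u \<in> V \<Longrightarrow> f u \<in> X u"
        "\<And>u v. u \<in> V \<Longrightarrow> v \<in> V \<Longrightarrow> u \<noteq> v \<Longrightarrow> P u v (f u) (f v)" by blast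
      have "inj_on f V" using f(2) unfolding P_def inj_on_def by blast
      moreover have "f ` V \<subseteq> U" using f(1) X(1) W \<psi>k by blast
      moreover have "\<forall>u\<in>V. \<forall>v\<in>V. u \<noteq> v \<longrightarrow> (adj u v \<longleftrightarrow> F (f u) (f v))"
        using f(2) unfolding P_def by blast
      ultimately have "\<exists>f. inj_on f V \<and> f ` V \<subseteq> U \<and> (\<forall>u\<in>V. \<forall>v\<in>V. u \<noteq> v \<longrightarrow> (adj u v \<longleftrightarrow> F (f u) (f v)))"
        by (intro exI[of _ f] conjI)
      then show False by (rule notE[OF free])
    qed
    let ?M = "crg_cost w b col wh bl"
    have disj: "\<not> (wh i j \<and> bl i j)" for i j unfolding wh_def bl_def using \<delta> by auto
    have "(\<Sum>i<k. 1)\<^sup>2 \<le> quad_form ?M {..<k} (\<lambda>_. 1)"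
      by (rule crg_value[OF _ _ _ disj nohom wb]) (auto simp: wh_def bl_def ds)
    then have val: "real k ^ 2 \<le> (\<Sum>i<k. \<Sum>j<k. ?M i j)" unfolding quad_form_def by simp
    have Mle: "?M i j \<le> t" for i j unfolding crg_cost_def t_def by auto
    have tp: "t * p = w" "t * (1 - p) = b"
    proof -
      show "t * p = w" unfolding p_def t_def using wb by simp
      then show "t * (1 - p) = b" unfolding t_def by (simp add: algebra_simps)
    qed
    \<comment> \<open>A white pair has \<open>F\<close>-density below \<open>3 * \<delta>\<close>
      whereas its \<open>E\<close>-density is within \<open>\<delta>\<close> of \<open>p\<close>, so
      about \<open>p = w / t\<close> must have been edited; black pairs are symmetric.\<close>
    have Mdens: "?M i j \<le> t * (edge_density C (W i) (W j) + 4 * \<delta>)"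
      if ij: "i < k" "j < k" "i \<noteq> j" for i j
    proof -
      have "\<bar>edge_count E (W i) (W j) - p * (real (card (W i)) * real (card (W j)))\<bar> \<le> \<eta> * n ^ 2"
        using qr W ij unfolding n_def by blast
      also have "\<eta> * n ^ 2 = \<delta> * ((\<gamma>1 * n) * (\<gamma>1 * n))" unfolding \<eta>_def by (simp add: power2_eq_square)
      also have "\<dots> \<le> \<delta> * (real (card (W i)) * real (card (W j)))"
        using W[OF ij(1)] W[OF ij(2)] \<delta> \<gamma>1 n unfolding n_def by (intro mult_left_mono mult_mono) auto
      finally have "\<bar>edge_density E (W i) (W j) - p\<bar> * (real (card (W i)) * real (card (W j)))
          \<le> \<delta> * (real (card (W i)) * real (card (W j)))"
        unfolding edge_density_mult[OF finW(1)[OF ij(1)] finW(1)[OF ij(2)]]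
        by (simp add: left_diff_distrib[symmetric] abs_mult)
      then have "\<bar>edge_density E (W i) (W j) - p\<bar> \<le> \<delta>"
        using finW(2)[OF ij(1)] finW(2)[OF ij(2)] by (subst (asm) mult_le_cancel_right_pos) auto
      moreover have "\<bar>edge_density E (W i) (W j) - d i j\<bar> \<le> edge_density C (W i) (W j)"
        unfolding d_def C_def by (rule edge_density_sym_diff)
      ultimately have pd: "\<bar>p - d i j\<bar> \<le> edge_density C (W i) (W j) + \<delta>" by linarith
      show ?thesis
      proof (cases "wh i j")
        case True
        then have "p \<le> edge_density C (W i) (W j) + 4 * \<delta>" using pd unfolding wh_def by linarith
        then have "t * p \<le> t * (edge_density C (W i) (W j) + 4 * \<delta>)" using t
          by (intro mult_left_mono) auto
        then show ?thesis using tp True ij unfolding crg_cost_def by simp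
      next
        case False
        show ?thesis
        proof (cases "bl i j")
          case True
          then have "1 - p \<le> edge_density C (W i) (W j) + 4 * \<delta>" using pd unfolding bl_def by linarith
          then have "t * (1 - p) \<le> t * (edge_density C (W i) (W j) + 4 * \<delta>)" using t
            by (intro mult_left_mono) auto
          then show ?thesis using tp True False ij unfolding crg_cost_def by simp
        next
          case nbl: False
          have "0 \<le> t * (edge_density C (W i) (W j) + 4 * \<delta>)" using t \<delta> edge_density_nonneg[of C] by simp
          then show ?thesis using nbl False ij unfolding crg_cost_def by simp
        qed
      qed
    qed
    define S where "S = (\<Sum>i<k. \<Sum>j\<in>{..<k}-{i}. edge_density C (W i) (W j))"
    have "(\<Sum>i<k. \<Sum>j<k. ?M i j) = (\<Sum>i<k. ?M i i + (\<Sum>j\<in>{..<k}-{i}. ?M i j))"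
      by (intro sum.cong refl sum.remove) auto
    also have "\<dots> \<le> (\<Sum>i<k. t + (\<Sum>j\<in>{..<k}-{i}. t * (edge_density C (W i) (W j) + 4 * \<delta>)))"
      using Mdens Mle by (intro sum_mono add_mono) auto
    also have "\<dots> = k * t + t * S + (\<Sum>i<k. \<Sum>j\<in>{..<k}-{i}. t * (4 * \<delta>))"
      unfolding S_def by (simp add: sum.distrib distrib_left sum_distrib_left)
    also have "(\<Sum>i<k. \<Sum>j\<in>{..<k}-{i}. t * (4 * \<delta>)) \<le> (\<Sum>i<k. \<Sum>j<k. t * (4 * \<delta>))"
      using t \<delta> by (intro sum_mono sum_mono2) auto
    also have "\<dots> = t * (4 * \<delta> * real k ^ 2)" by (simp add: power2_eq_square)
    finally have "real k ^ 2 \<le> k * t + t * S + t * (4 * \<delta> * real k ^ 2)" using val by linarith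
    moreover have "k * t \<le> t * (\<delta> * real k ^ 2)"
    proof -
      have "(t * k) * 1 \<le> (t * k) * (\<delta> * real k)" using k t by (intro mult_left_mono) auto
      then show ?thesis by (simp add: power2_eq_square mult_ac)
    qed
    moreover have "t * S \<le> t * (real k ^ 2 * edge_density C U U + \<delta> * real k ^ 2)"
    proof (intro mult_left_mono)
      have "\<delta> * (\<kappa> * S) \<le> \<delta> * (\<kappa> * (real k ^ 2 * edge_density C U U) + real k ^ 2)"
        using cost \<delta> unfolding S_def by (intro mult_left_mono) auto
      then show "S \<le> real k ^ 2 * edge_density C U U + \<delta> * real k ^ 2"
        unfolding \<kappa>_def using \<delta> by (simp add: distrib_left)
    qed (use t in auto)
    ultimately have "real k ^ 2 * 1 \<le> real k ^ 2 * (t * (edge_density C U U + 6 * \<delta>))"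
      by (simp add: algebra_simps)
    then have "1 \<le> t * (edge_density C U U + 6 * \<delta>)" using k(2)
      by (subst (asm) mult_le_cancel_left_pos) auto
    then have "1 / t \<le> edge_density C U U + 6 * \<delta>" using t by (simp add: field_simps)
    then have "1 / t - \<epsilon> \<le> edge_density C U U" using \<delta>(3) by linarith
    then have "(1 / t - \<epsilon>) * (n * n) \<le> edge_density C U U * (n * n)" by (intro mult_right_mono) auto
    then show ?thesis
      using edge_density_mult[OF U(1) U(1), of C] unfolding n_def C_def by (simp add: power2_eq_square)
  qed
  show ?thesis
    by (rule exI[of _ n0], rule exI[of _ \<eta>], rule conjI[OF \<eta>], intro allI impI,
        rule main[unfolded t_def]; assumption)
qed

section \<open>A quasirandom graph of given density\<close>

lemma sum_mod_shift:
  fixes f :: "int \<Rightarrow> real"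
  assumes "0 < q"
  shows "(\<Sum>x\<in>{0..<q}. f ((c + x) mod q)) = (\<Sum>z\<in>{0..<q}. f z)"
  by (rule sum.reindex_bij_witness[of _ "\<lambda>z. (z - c) mod q" "\<lambda>x. (c + x) mod q"])
    (use assms in \<open>auto simp: mod_simps\<close>)

lemma sum_mod_affine:
  fixes f :: "int \<Rightarrow> real"
  assumes q: "prime q" and d: "\<not> q dvd d"
  shows "(\<Sum>x\<in>{0..<q}. f ((d * x + c) mod q)) = (\<Sum>z\<in>{0..<q}. f z)"
proof -
  let ?h = "\<lambda>x. (d * x + c) mod q"
  have q0: "0 < q" using q by (simp add: prime_gt_0_int)
  have inj: "inj_on ?h {0..<q}"
  proof (rule inj_onI)
    fix x y assume xy: "x \<in> {0..<q}" "y \<in> {0..<q}" "?h x = ?h y"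
    then have "q dvd (d * x + c) - (d * y + c)" by (simp add: mod_eq_dvd_iff)
    then have "q dvd d * (x - y)" by (simp add: algebra_simps)
    then have "q dvd x - y" using q d by (simp add: prime_dvd_mult_iff)
    then show "x = y" using xy by (metis atLeastLessThan_iff mod_eq_dvd_iff mod_pos_pos_trivial)
  qed
  have "?h ` {0..<q} \<subseteq> {0..<q}" using q0 by auto
  then have "?h ` {0..<q} = {0..<q}" using inj by (intro endo_inj_surj) auto
  then show ?thesis using sum.reindex[OF inj, of f] by simp
qed

text \<open>
  For points \<open>y\<close>, \<open>y'\<close> with different first coordinates, the two values of the form at a uniform
  \<open>x\<close> are independent and uniform modulo \<open>q\<close>; so the rows of the matrix \<open>a\<close> are almost orthogonal.
\<close>

lemma quasirandom_form:
  fixes g :: "int \<Rightarrow> real" and \<xi> \<upsilon> :: "int \<times> int \<Rightarrow> real"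
  assumes q: "prime q" and g: "(\<Sum>z\<in>{0..<q}. g z) = 0" "\<And>z. \<bar>g z\<bar> \<le> 1"
    and weights: "\<And>x. 0 \<le> \<xi> x \<and> \<xi> x \<le> c" "\<And>x. 0 \<le> \<upsilon> x \<and> \<upsilon> x \<le> c"
  defines "S \<equiv> {0..<q} \<times> {0..<q}"
  defines "a \<equiv> \<lambda>x y. g ((fst x * fst y + snd x + snd y) mod q)"
  shows "(\<Sum>x\<in>S. \<xi> x * (\<Sum>y\<in>S. \<upsilon> y * a x y))\<^sup>2 \<le> c ^ 4 * real_of_int q ^ 7"
proof -
  have q0: "0 < q" using q by (simp add: prime_gt_0_int)
  define r where "r = real_of_int q"
  have r: "0 < r" unfolding r_def using q0 by simp
  have c: "0 \<le> c" using weights(1) order_trans by blast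
  have cS: "real (card S) = r ^ 2"
    unfolding S_def r_def using q0 by (auto simp: power2_eq_square)
  have orth: "(\<Sum>x\<in>S. a x y * a x y') = 0" if y: "y \<in> S" "y' \<in> S" "fst y \<noteq> fst y'" for y y'
  proof -
    define D where "D = fst y' - fst y"
    define F where "F = snd y' - snd y"
    have nD: "\<not> q dvd D"
    proof
      assume "q dvd D"
      then have "fst y' mod q = fst y mod q" unfolding D_def by (simp add: mod_eq_dvd_iff)
      then show False using y unfolding S_def by auto
    qed
    have "(\<Sum>x\<in>S. a x y * a x y') = (\<Sum>u\<in>{0..<q}. \<Sum>v\<in>{0..<q}. a (u, v) y * a (u, v) y')"
      unfolding S_def by (simp add: sum.cartesian_product)
    also have "\<dots> = (\<Sum>u\<in>{0..<q}. \<Sum>v\<in>{0..<q}.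
       (\<lambda>z. g z * g ((z + u * D + F) mod q)) (((u * fst y + snd y) + v) mod q))"
    proof (intro sum.cong refl)
      fix u v
      have "(((u * fst y + snd y) + v) mod q + u * D + F) mod q = ((u * fst y + snd y) + v + u * D + F) mod q"
        by (simp add: mod_simps add.assoc)
      also have "(u * fst y + snd y) + v + u * D + F = u * fst y' + v + snd y'"
        unfolding D_def F_def by (simp add: algebra_simps)
      finally show "a (u, v) y * a (u, v) y' =
          (\<lambda>z. g z * g ((z + u * D + F) mod q)) (((u * fst y + snd y) + v) mod q)"
        unfolding a_def by (simp add: add_ac)
    qed
    also have "\<dots> = (\<Sum>u\<in>{0..<q}. \<Sum>z\<in>{0..<q}. g z * g ((z + u * D + F) mod q))"
      by (intro sum.cong refl sum_mod_shift q0)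
    \<comment> \<open>As \<open>u\<close> varies, \<open>D * u\<close> runs through all residues
      since the prime \<open>q\<close> does not divide \<open>D\<close>, so the inner sum is the
      full sum of \<open>g\<close>, which is 0.\<close>
    also have "\<dots> = (\<Sum>z\<in>{0..<q}. g z * (\<Sum>u\<in>{0..<q}. g ((D * u + (z + F)) mod q)))"
      by (subst sum.swap) (simp add: sum_distrib_left algebra_simps)
    also have "\<dots> = 0" unfolding sum_mod_affine[OF q nD] g(1) by simp
    finally show ?thesis .
  qed
  have a1: "a x y * a x y' \<le> 1" for x y y'
  proof -
    have "\<bar>a x y\<bar> * \<bar>a x y'\<bar> \<le> 1 * 1" unfolding a_def using g(2) by (intro mult_mono) auto
    then show ?thesis by (simp add: abs_mult[symmetric])
  qed
  \<comment> \<open>Points with equal first coordinate are bounded trivially; only one pair in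
    \<open>q\<close> is of this kind.\<close>
  have pair: "\<upsilon> y * \<upsilon> y' * (\<Sum>x\<in>S. a x y * a x y') \<le> (if fst y = fst y' then c ^ 2 * r ^ 2 else 0)"
    if "y \<in> S" "y' \<in> S" for y y'
  proof (cases "fst y = fst y'")
    case True
    have "(\<Sum>x\<in>S. a x y * a x y') \<le> (\<Sum>x\<in>S. 1)" using a1 by (intro sum_mono)
    then have "\<upsilon> y * \<upsilon> y' * (\<Sum>x\<in>S. a x y * a x y') \<le> \<upsilon> y * \<upsilon> y' * r ^ 2"
      using cS weights(2) by (intro mult_left_mono) auto
    also have "\<dots> \<le> c * c * r ^ 2"
      using weights(2) c by (intro mult_right_mono mult_mono) auto
    finally show ?thesis using True by (simp add: power2_eq_square)
  qed (use orth that in simp)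
  define z where "z x = (\<Sum>y\<in>S. \<upsilon> y * a x y)" for x
  have "(\<Sum>x\<in>S. (z x)\<^sup>2) = (\<Sum>x\<in>S. \<Sum>y\<in>S. \<Sum>y'\<in>S. \<upsilon> y * \<upsilon> y' * (a x y * a x y'))"
    unfolding z_def by (simp add: power2_eq_square sum_product mult_ac)
  also have "\<dots> = (\<Sum>y\<in>S. \<Sum>x\<in>S. \<Sum>y'\<in>S. \<upsilon> y * \<upsilon> y' * (a x y * a x y'))" by (rule sum.swap)
  also have "\<dots> = (\<Sum>y\<in>S. \<Sum>y'\<in>S. \<Sum>x\<in>S. \<upsilon> y * \<upsilon> y' * (a x y * a x y'))"
    by (rule sum.cong[OF refl], rule sum.swap)
  also have "\<dots> \<le> (\<Sum>y\<in>S. \<Sum>y'\<in>S. if fst y = fst y' then c ^ 2 * r ^ 2 else 0)"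
    unfolding sum_distrib_left[symmetric] by (intro sum_mono pair)
  also have "\<dots> = (\<Sum>y\<in>S. c ^ 2 * r ^ 3)"
  proof (rule sum.cong[OF refl])
    fix y assume y: "y \<in> S"
    have "(\<Sum>y'\<in>S. if fst y = fst y' then c ^ 2 * r ^ 2 else 0) =
        (\<Sum>u\<in>{0..<q}. \<Sum>v\<in>{0..<q}. if fst y = u then c ^ 2 * r ^ 2 else 0)"
      unfolding S_def sum.cartesian_product by (simp add: split_beta)
    also have "\<dots> = (\<Sum>u\<in>{0..<q}. if fst y = u then r * (c ^ 2 * r ^ 2) else 0)"
      using q0 by (intro sum.cong refl) (auto simp: r_def)
    also have "\<dots> = r * (c ^ 2 * r ^ 2)" using y unfolding S_def by auto
    finally show "(\<Sum>y'\<in>S. if fst y = fst y' then c ^ 2 * r ^ 2 else 0) = c ^ 2 * r ^ 3"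
      by (simp add: power2_eq_square power3_eq_cube)
  qed
  also have "\<dots> = c ^ 2 * r ^ 5" using cS by (simp add: power_numeral_reduce)
  finally have energy: "(\<Sum>x\<in>S. (z x)\<^sup>2) \<le> c ^ 2 * r ^ 5" .
  \<comment> \<open>Cauchy-Schwarz against the row sums. The trivial bound would be
    \<open>c ^ 4 * r ^ 8\<close>; orthogonality saves one factor \<open>r\<close>.\<close>
  have "(\<Sum>x\<in>S. \<xi> x * z x)\<^sup>2 \<le> (\<Sum>x\<in>S. (\<xi> x)\<^sup>2) * (\<Sum>x\<in>S. (z x)\<^sup>2)"
    by (rule Cauchy_Schwarz_ineq_sum)
  also have "\<dots> \<le> (c ^ 2 * r ^ 2) * (c ^ 2 * r ^ 5)"
  proof (intro mult_mono energy)
    have "(\<Sum>x\<in>S. (\<xi> x)\<^sup>2) \<le> (\<Sum>x\<in>S. c ^ 2)" using weights(1) by (intro sum_mono power_mono) auto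
    then show "(\<Sum>x\<in>S. (\<xi> x)\<^sup>2) \<le> c ^ 2 * r ^ 2" using cS by (simp add: mult.commute)
  qed (auto intro: sum_nonneg)
  also have "\<dots> = c ^ 4 * r ^ 7" by (simp add: power_numeral_reduce)
  finally show ?thesis unfolding r_def z_def .
qed

lemma sum_over_fibres:
  fixes F :: "'b \<Rightarrow> real"
  assumes "finite X" "finite S" "h ` X \<subseteq> S"
  shows "(\<Sum>x\<in>X. F (h x)) = (\<Sum>u\<in>S. real (card {x\<in>X. h x = u}) * F u)"
proof -
  have "(\<Sum>x\<in>X. F (h x)) = (\<Sum>u\<in>S. \<Sum>x\<in>{x\<in>X. h x = u}. F (h x))"
    by (rule sum.group[OF assms, symmetric])
  also have "\<dots> = (\<Sum>u\<in>S. real (card {x\<in>X. h x = u}) * F u)"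
    by (rule sum.cong[OF refl]) simp
  finally show ?thesis .
qed

lemma card_residue_class_le:
  fixes n N j :: nat
  assumes "0 < N"
  shows "card {x. x < n \<and> x mod N = j} \<le> n div N + 1"
proof -
  have "{x. x < n \<and> x mod N = j} \<subseteq> (\<lambda>k. k * N + j) ` {0..n div N}"
  proof
    fix x assume "x \<in> {x. x < n \<and> x mod N = j}"
    then have "x = (x div N) * N + j" "x div N \<le> n div N" by (auto intro: div_le_mono)
    then show "x \<in> (\<lambda>k. k * N + j) ` {0..n div N}" by force
  qed
  then have "card {x. x < n \<and> x mod N = j} \<le> card ((\<lambda>k. k * N + j) ` {0..n div N})"
    by (intro card_mono) auto
  also have "\<dots> \<le> n div N + 1" using card_image_le[of "{0..n div N}"] by fastforce
  finally show ?thesis .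
qed

text \<open>A fixed graph on \<open>q ^ 2\<close> points is blown up along residues modulo
  \<open>N = q ^ 2\<close>: points are joined when the form takes one of the first \<open>s\<close>
  residues, \<open>s\<close> being about \<open>p * q\<close>. The deviation consists of the centred
  form, the missing loops and the rounding of \<open>p\<close>, each kept below a third of the
  allowance.\<close>

theorem exists_quasirandom_graph:
  fixes p \<eta> :: real
  assumes p: "0 \<le> p" "p \<le> 1" and \<eta>: "0 < \<eta>"
  shows "\<exists>n1. \<forall>n\<ge>n1. \<exists>E :: nat \<Rightarrow> nat \<Rightarrow> bool. (\<forall>x y. E x y = E y x) \<and> (\<forall>x. \<not> E x x) \<and>
    (\<forall>X\<subseteq>{..<n}. \<forall>Y\<subseteq>{..<n}. \<bar>edge_count E X Y - p * (real (card X) * real (card Y))\<bar> \<le> \<eta> * real n ^ 2)"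
proof -
  \<comment> \<open>\<open>144 = 16 * 9\<close>: the square of the form is at most
    \<open>16 * l ^ 4 / r\<close>, and a third of \<open>\<eta>\<close> is allowed. The term
    \<open>3 / \<eta>\<close> handles the rounding error \<open>1 / r\<close>.\<close>
  define m where "m = 2 + nat \<lceil>144 / \<eta> ^ 2\<rceil> + nat \<lceil>3 / \<eta>\<rceil>"
  obtain qn :: nat where qn: "prime qn" "m < qn" using bigger_prime by blast
  define q where "q = int qn"
  define r where "r = real qn"
  have q: "prime q" and q0: "0 < q" and rq: "r = real_of_int q"
    unfolding q_def r_def using qn by auto
  have r: "144 / \<eta> ^ 2 \<le> r" "3 / \<eta> \<le> r" "2 \<le> r"
  proof -
    have "144 / \<eta> ^ 2 \<le> real m" "3 / \<eta> \<le> real m" "2 \<le> real m" unfolding m_def by linarith+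
    then show "144 / \<eta> ^ 2 \<le> r" "3 / \<eta> \<le> r" "2 \<le> r" unfolding r_def using qn(2) by linarith+
  qed
  have r1: "144 \<le> \<eta>\<^sup>2 * r" "3 \<le> \<eta> * r" using r \<eta> by (simp_all add: field_simps)
  define s where "s = \<lfloor>p * r\<rfloor>"
  have s: "0 \<le> s" "s \<le> q" "\<bar>real_of_int s / r - p\<bar> \<le> 1 / r"
  proof -
    show "0 \<le> s" unfolding s_def using p r by simp
    have "p * r \<le> 1 * r" using p r by (intro mult_right_mono) auto
    then show "s \<le> q" unfolding s_def rq by linarith
    have "\<bar>real_of_int s - p * r\<bar> \<le> 1" unfolding s_def by linarith
    then have "\<bar>real_of_int s - p * r\<bar> / r \<le> 1 / r" using r by (intro divide_right_mono) auto
    moreover have "real_of_int s / r - p = (real_of_int s - p * r) / r" using r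
      by (simp add: field_simps)
    ultimately show "\<bar>real_of_int s / r - p\<bar> \<le> 1 / r" using r by (simp add: abs_divide)
  qed
  \<comment> \<open>Centred indicator of an edge: its sum over the residues is exactly 0 once
    \<open>p\<close> is rounded to \<open>s / r\<close>.\<close>
  define g where "g z = of_bool (z < s) - real_of_int s / r" for z :: int
  have g0: "(\<Sum>z\<in>{0..<q}. g z) = 0"
  proof -
    have "(\<Sum>z\<in>{0..<q}. of_bool (z < s)) = real (card ({0..<q} \<inter> {z. z < s}))"
      by (simp add: of_bool_def sum.If_cases)
    also have "{0..<q} \<inter> {z. z < s} = {0..<s}" using s by auto
    finally show ?thesis unfolding g_def using s q0 r rq by (simp add: sum_subtractf)
  qed
  have g1: "\<bar>g z\<bar> \<le> 1" for z
  proof -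
    have "0 \<le> real_of_int s / r" "real_of_int s / r \<le> 1" using s r rq by auto
    then show ?thesis unfolding g_def by (auto simp: of_bool_def)
  qed
  define S where "S = {0..<q} \<times> {0..<q}"
  have finS: "finite S" and cS: "real (card S) = r ^ 2"
    unfolding S_def rq using q0 by (auto simp: power2_eq_square)
  define N where "N = card S"
  have N: "0 < N" "real N = r ^ 2" using cS r unfolding N_def by (auto intro: ccontr)
  define f where "f x y = (fst x * fst y + snd x + snd y) mod q" for x y :: "int \<times> int"
  have fsym: "f x y = f y x" for x y unfolding f_def by (simp add: mult.commute add_ac)
  obtain h0 where h0: "bij_betw h0 {0..<N} S" using ex_bij_betw_nat_finite[OF finS] unfolding N_def
    by blast
  define h where "h i = h0 (i mod N)" for i
  have hS: "h i \<in> S" for i unfolding h_def using h0 N bij_betwE by fastforce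
  define E where "E i j \<longleftrightarrow> i \<noteq> j \<and> f (h i) (h j) < s" for i j
  define n1 where "n1 = N + nat \<lceil>3 / \<eta>\<rceil>"
  have disc: "\<bar>edge_count E X Y - p * (real (card X) * real (card Y))\<bar> \<le> \<eta> * real n ^ 2"
    if n: "n1 \<le> n" and XY: "X \<subseteq> {..<n}" "Y \<subseteq> {..<n}" for n X Y
  proof -
    define l where "l = real n"
    have l: "r ^ 2 \<le> l" "3 / \<eta> \<le> l"
    proof -
      have "real N \<le> real n1" "3 / \<eta> \<le> real n1" unfolding n1_def by linarith+
      then show "r ^ 2 \<le> l" "3 / \<eta> \<le> l" using n N unfolding l_def by linarith+
    qed
    have r2: "0 < r ^ 2" using r by simp
    then have l0: "0 < l" using l by linarith
    have fin: "finite X" "finite Y" using XY by (auto intro: finite_subset)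
    \<comment> \<open>A point has at most \<open>n div N + 1\<close> copies, and
      \<open>n \<ge> N\<close> bounds this by twice the average.\<close>
    define c where "c = 2 * l / r ^ 2"
    have fibre: "0 \<le> real (card {x\<in>X. h x = u}) \<and> real (card {x\<in>X. h x = u}) \<le> c"
      if X: "X \<subseteq> {..<n}" for X u
    proof -
      have "card {x\<in>X. h x = u} \<le> n div N + 1"
      proof (cases "{x\<in>X. h x = u} = {}")
        case False
        then obtain y where y: "y \<in> X" "h y = u" by blast
        have "{x\<in>X. h x = u} \<subseteq> {x. x < n \<and> x mod N = y mod N}"
        proof
          fix x assume "x \<in> {x\<in>X. h x = u}"
          then have "x < n" "h0 (x mod N) = h0 (y mod N)" using X y unfolding h_def by auto
          then show "x \<in> {x. x < n \<and> x mod N = y mod N}"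
            using inj_onD[OF bij_betw_imp_inj_on[OF h0]] N by auto
        qed
        then have "card {x\<in>X. h x = u} \<le> card {x. x < n \<and> x mod N = y mod N}" by (intro card_mono) auto
        then show ?thesis using card_residue_class_le[OF N(1), of n "y mod N"] by linarith
      qed (simp only: card.empty zero_le)
      then have "real (card {x\<in>X. h x = u}) \<le> real (n div N) + 1" by linarith
      also have "\<dots> \<le> l / r ^ 2 + 1" using of_nat_div_le_of_nat[of n N, where 'a = real] N unfolding l_def
        by simp
      also have "1 \<le> l / r ^ 2" using l r2 by simp
      finally show ?thesis unfolding c_def by simp
    qed
    define G where "G = (\<Sum>x\<in>X. \<Sum>y\<in>Y. g (f (h x) (h y)))"
    define K where "K = (\<Sum>x\<in>X. \<Sum>y\<in>Y. of_bool (x = y \<and> f (h x) (h y) < s) :: real)"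
    have "G = (\<Sum>x\<in>X. (\<lambda>x'. \<Sum>v\<in>S. real (card {y\<in>Y. h y = v}) * g (f x' v)) (h x))"
      unfolding G_def using fin finS hS by (intro sum.cong refl sum_over_fibres) auto
    also have "\<dots> = (\<Sum>u\<in>S. real (card {x\<in>X. h x = u}) * (\<Sum>v\<in>S. real (card {y\<in>Y. h y = v}) * g (f u v)))"
      using fin finS hS by (intro sum_over_fibres) auto
    finally have "G\<^sup>2 \<le> c ^ 4 * r ^ 7"
      unfolding rq f_def using quasirandom_form[OF q g0 g1 fibre[OF XY(1)] fibre[OF XY(2)], folded S_def]
        by simp
    also have "\<dots> = 16 * l ^ 4 / r" unfolding c_def using r
      by (simp add: field_simps power_numeral_reduce)
    also have "\<dots> \<le> (\<eta> / 3 * l ^ 2)\<^sup>2"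
    proof -
      have "l ^ 4 * 144 \<le> l ^ 4 * (\<eta>\<^sup>2 * r)" using r1 l0 by (intro mult_left_mono) auto
      then show ?thesis using r by (simp add: field_simps power_numeral_reduce)
    qed
    finally have G: "\<bar>G\<bar> \<le> \<eta> / 3 * l ^ 2"
      using \<eta> l0 by (intro power2_le_imp_le[of "\<bar>G\<bar>"]) auto
    have cX: "real (card X) \<le> l" "real (card Y) \<le> l"
      using card_mono[OF _ XY(1)] card_mono[OF _ XY(2)] unfolding l_def by auto
    have "0 \<le> K" unfolding K_def by (intro sum_nonneg) auto
    moreover have "K \<le> (\<Sum>x\<in>X. 1)" unfolding K_def
    proof (intro sum_mono)
      fix x
      have "(\<Sum>y\<in>Y. of_bool (x = y \<and> f (h x) (h y) < s) :: real) \<le> (\<Sum>y\<in>Y. if x = y then 1 else 0)"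
        by (intro sum_mono) auto
      also have "\<dots> \<le> 1" using fin by simp
      finally show "(\<Sum>y\<in>Y. of_bool (x = y \<and> f (h x) (h y) < s) :: real) \<le> 1" .
    qed
    ultimately have "\<bar>K\<bar> \<le> l" using cX by simp
    also have "\<dots> \<le> \<eta> / 3 * l ^ 2"
    proof -
      have "l * 3 \<le> l * (\<eta> * l)" using l \<eta> l0 by (intro mult_left_mono) (auto simp: field_simps)
      then show ?thesis by (simp add: power2_eq_square mult_ac)
    qed
    finally have K: "\<bar>K\<bar> \<le> \<eta> / 3 * l ^ 2" .
    have "edge_count E X Y = (\<Sum>x\<in>X. \<Sum>y\<in>Y. g (f (h x) (h y)) + real_of_int s / r - of_bool (x = y \<and> f (h x) (h y) < s))"
      unfolding edge_count_def E_def g_def by (intro sum.cong refl) (auto simp: of_bool_def)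
    also have "\<dots> = G + real (card X) * (real (card Y) * (real_of_int s / r)) - K"
      unfolding G_def K_def by (simp add: sum.distrib sum_subtractf)
    finally have eq: "edge_count E X Y - p * (real (card X) * real (card Y)) =
        G + (real_of_int s / r - p) * (real (card X) * real (card Y)) - K" by (simp add: algebra_simps)
    have "\<bar>(real_of_int s / r - p) * (real (card X) * real (card Y))\<bar> \<le> 1 / r * (l * l)"
      unfolding abs_mult using s(3) cX r by (intro mult_mono) auto
    also have "\<dots> \<le> \<eta> / 3 * l ^ 2"
    proof -
      have "(l * l) * 3 \<le> (l * l) * (\<eta> * r)" using r1 l0 by (intro mult_left_mono) auto
      then show ?thesis using r by (simp add: field_simps power2_eq_square)
    qed
    finally have M: "\<bar>(real_of_int s / r - p) * (real (card X) * real (card Y))\<bar> \<le> \<eta> / 3 * l ^ 2" .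
    show ?thesis unfolding eq l_def[symmetric] using G K M by linarith
  qed
  have "\<forall>x y. E x y = E y x" "\<forall>x. \<not> E x x" unfolding E_def using fsym by auto
  then show ?thesis using disc by (intro exI[of _ n1] allI impI exI[of _ E]) blast
qed

section \<open>Distance to Forb\<close>

text \<open>\<open>Min\<close> over an empty set would be unspecified. A graph with two vertices has
  an edge or a nonedge, so the edgeless or the complete host omits it.\<close>

lemma Forb_nonempty:
  assumes "fin_simple_graph H" "2 \<le> card (verts H)" "finite S"
  shows "\<exists>G. verts G = S \<and> G \<in> Forb H"
proof -
  obtain u v where uv: "u \<in> verts H" "v \<in> verts H" "u \<noteq> v"
    using assms(2) by (metis card_le_Suc0_iff_eq card.infinite not_less_eq_eq numeral_2_eq_2 zero_le)
  show ?thesis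
  proof (cases "{u, v} \<in> edges H")
    case True
    have "(S, {}) \<in> Forb H"
      using assms uv True unfolding Forb_def fin_simple_graph_def has_induced_copy_def by auto
    then show ?thesis by (intro exI[of _ "(S, {})"]) auto
  next
    case False
    have "\<not> has_induced_copy (S, [S]\<^bsup>2\<^esup>) H"
    proof
      assume "has_induced_copy (S, [S]\<^bsup>2\<^esup>) H"
      then obtain f where f: "inj_on f (verts H)" "f ` verts H \<subseteq> S"
        "{u, v} \<in> edges H \<longleftrightarrow> {f u, f v} \<in> [S]\<^bsup>2\<^esup>"
        using uv unfolding has_induced_copy_def by auto
      have "f u \<noteq> f v" using f uv by (auto dest: inj_onD)
      then show False using f uv False by auto
    qed
    then have "(S, [S]\<^bsup>2\<^esup>) \<in> Forb H" using assms unfolding Forb_def fin_simple_graph_def by auto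
    then show ?thesis by (intro exI[of _ "(S, [S]\<^bsup>2\<^esup>)"]) auto
  qed
qed

lemma Forb_edges: "G \<in> Forb H \<Longrightarrow> edges G \<subseteq> [verts G]\<^bsup>2\<^esup>"
  and Forb_finite: "G \<in> Forb H \<Longrightarrow> finite (verts G)"
  unfolding Forb_def fin_simple_graph_def by auto

lemma finite_graph_dists:
  assumes "finite (verts G)"
  shows "finite {graph_dist G G' |G'. verts G' = verts G \<and> G' \<in> Forb H}"
proof (rule finite_subset)
  show "{graph_dist G G' |G'. verts G' = verts G \<and> G' \<in> Forb H}
    \<subseteq> graph_dist G ` ({verts G} \<times> Pow ([verts G]\<^bsup>2\<^esup>))"
  proof
    fix d assume "d \<in> {graph_dist G G' |G'. verts G' = verts G \<and> G' \<in> Forb H}"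
    then obtain G' where "d = graph_dist G G'" "verts G' = verts G" "G' \<in> Forb H" by blast
    then show "d \<in> graph_dist G ` ({verts G} \<times> Pow ([verts G]\<^bsup>2\<^esup>))"
      using Forb_edges[of G' H] by (cases G') auto
  qed
qed (use assms finite_imp_finite_nsets in auto)

lemma property_dist_le:
  assumes "finite (verts G)" "verts G' = verts G" "G' \<in> Forb H"
  shows "property_dist G (Forb H) \<le> graph_dist G G'"
  unfolding property_dist_def by (intro Min_le finite_graph_dists) (use assms in blast)+

lemma property_dist_attained:
  assumes "fin_simple_graph H" "2 \<le> card (verts H)" "finite (verts G)"
  obtains G' where "verts G' = verts G" "G' \<in> Forb H" "property_dist G (Forb H) = graph_dist G G'"
proof -
  have "property_dist G (Forb H) \<in> {graph_dist G G' |G'. verts G' = verts G \<and> G' \<in> Forb H}"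
    unfolding property_dist_def using Forb_nonempty[OF assms] assms(3)
    by (intro Min_in finite_graph_dists) auto
  then show ?thesis using that by blast
qed

section \<open>The extremal distance at a given density\<close>

definition graphs_of_density :: "nat \<Rightarrow> real \<Rightarrow> nat graph set" where
  "graphs_of_density n p = {G. fin_simple_graph G \<and> card (verts G) = n \<and>
     int (card (edges G)) = \<lfloor>p * real (n choose 2)\<rfloor>}"

definition max_dist :: "'a graph \<Rightarrow> real \<Rightarrow> nat \<Rightarrow> real" where
  "max_dist H p n = Max {property_dist G (Forb H) |G. G \<in> graphs_of_density n p}"

lemma ed_eq_lim: "ed (Forb H) p = lim (max_dist H p)"
  unfolding ed_def max_dist_def graphs_of_density_def by simp

lemma sym_diff_edges:
  assumes "fin_simple_graph G" "verts G' = verts G" "G' \<in> Forb H"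
  shows "sym_diff (edges G) (edges G') \<subseteq> [verts G]\<^bsup>2\<^esup>"
  using assms Forb_edges[of G' H] unfolding fin_simple_graph_def by auto

lemma finite_property_dists:
  assumes H: "fin_simple_graph H" "2 \<le> card (verts H)"
  shows "finite {property_dist G (Forb H) |G. G \<in> graphs_of_density n p}"
proof (rule finite_subset)
  show "{property_dist G (Forb H) |G. G \<in> graphs_of_density n p}
     \<subseteq> (\<lambda>j. real j / real (n choose 2)) ` {..n choose 2}"
  proof
    fix d assume "d \<in> {property_dist G (Forb H) |G. G \<in> graphs_of_density n p}"
    then obtain G where G: "d = property_dist G (Forb H)" "fin_simple_graph G" "card (verts G) = n"
      unfolding graphs_of_density_def by auto
    then have fin: "finite (verts G)" unfolding fin_simple_graph_def by auto
    obtain G' where G': "verts G' = verts G" "G' \<in> Forb H" "property_dist G (Forb H) = graph_dist G G'"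
      using property_dist_attained[OF H fin] .
    have "card (sym_diff (edges G) (edges G')) \<le> card ([verts G]\<^bsup>2\<^esup>)"
      using sym_diff_edges[OF G(2) G'(1,2)] fin by (intro card_mono finite_imp_finite_nsets)
    then show "d \<in> (\<lambda>j. real j / real (n choose 2)) ` {..n choose 2}"
      using G G' unfolding graph_dist_def by auto
  qed
qed simp

lemma graphs_of_density_nonempty:
  assumes "0 \<le> p" "p \<le> 1"
  shows "graphs_of_density n p \<noteq> {}"
proof -
  have "p * real (n choose 2) \<le> 1 * real (n choose 2)" using assms by (intro mult_right_mono) auto
  then have "nat \<lfloor>p * real (n choose 2)\<rfloor> \<le> n choose 2" by linarith
  then have "nat \<lfloor>p * real (n choose 2)\<rfloor> \<le> card ([{..<n}]\<^bsup>2\<^esup>)" by simp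
  then obtain T where T: "T \<subseteq> [{..<n}]\<^bsup>2\<^esup>" "card T = nat \<lfloor>p * real (n choose 2)\<rfloor>"
    by (meson obtain_subset_with_card_n)
  have "({..<n}, T) \<in> graphs_of_density n p"
    using T assms unfolding graphs_of_density_def fin_simple_graph_def by auto
  then show ?thesis by blast
qed

lemma max_dist_ge:
  assumes "fin_simple_graph H" "2 \<le> card (verts H)" "G \<in> graphs_of_density n p"
  shows "property_dist G (Forb H) \<le> max_dist H p n"
  unfolding max_dist_def by (intro Max_ge finite_property_dists) (use assms in blast)+

lemma max_dist_attained:
  assumes "fin_simple_graph H" "2 \<le> card (verts H)" "0 \<le> p" "p \<le> 1"
  obtains G where "G \<in> graphs_of_density n p" "max_dist H p n = property_dist G (Forb H)"
proof -
  have "max_dist H p n \<in> {property_dist G (Forb H) |G. G \<in> graphs_of_density n p}"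
    unfolding max_dist_def using assms graphs_of_density_nonempty[OF assms(3,4), of n]
    by (intro Max_in finite_property_dists) auto
  then show ?thesis using that by blast
qed

lemma property_dist_nonneg:
  assumes "fin_simple_graph H" "2 \<le> card (verts H)" "finite (verts G)"
  shows "0 \<le> property_dist G (Forb H)"
  using property_dist_attained[OF assms] unfolding graph_dist_def
  by (metis divide_nonneg_nonneg of_nat_0_le_iff)

lemma graphs_of_density_finite: "G \<in> graphs_of_density n p \<Longrightarrow> finite (verts G)"
  unfolding graphs_of_density_def fin_simple_graph_def by auto

lemma max_dist_nonneg:
  assumes "fin_simple_graph H" "2 \<le> card (verts H)" "0 \<le> p" "p \<le> 1"
  shows "0 \<le> max_dist H p n"
  using max_dist_attained[OF assms, of n] property_dist_nonneg[OF assms(1,2)] graphs_of_density_finite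
  by metis

section \<open>Upper bounds by colouring\<close>

definition mono_edge :: "('v \<Rightarrow> nat) \<Rightarrow> 'v set \<Rightarrow> bool" where
  "mono_edge \<phi> e \<longleftrightarrow> (\<forall>x\<in>e. \<forall>y\<in>e. \<phi> x = \<phi> y)"

lemma mono_edge_pair: "mono_edge \<phi> {x, y} \<longleftrightarrow> \<phi> x = \<phi> y"
  unfolding mono_edge_def by auto

text \<open>Greedy colouring: a new vertex takes a colour rarest among its neighbours, so at most a
  \<open>1 / w\<close> fraction of its edges becomes monochromatic.\<close>

lemma few_mono_edges:
  assumes "finite V" "F \<subseteq> [V]\<^bsup>2\<^esup>" "1 \<le> w"
  shows "\<exists>\<phi>. (\<forall>v. \<phi> v < w) \<and> w * card {e\<in>F. mono_edge \<phi> e} \<le> card F"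
  using assms
proof (induction V arbitrary: F rule: finite_induct)
  case empty
  then have "F = {}" by (auto simp: nsets_def)
  then show ?case using empty by (intro exI[of _ "\<lambda>_. 0"]) auto
next
  case (insert v V)
  define F0 where "F0 = {e\<in>F. v \<notin> e}"
  define N where "N = {u\<in>V. {v, u} \<in> F}"
  have finF: "finite F" using insert.prems(1) insert.hyps
    by (meson finite.insertI finite_imp_finite_nsets finite_subset)
  have finN: "finite N" unfolding N_def using insert.hyps by auto
  have F0: "F0 \<subseteq> [V]\<^bsup>2\<^esup>" using insert.prems(1) unfolding F0_def nsets_def by auto
  have F_eq: "F = F0 \<union> (\<lambda>u. {v, u}) ` N"
  proof
    show "F \<subseteq> F0 \<union> (\<lambda>u. {v, u}) ` N"
    proof
      fix e assume e: "e \<in> F"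
      show "e \<in> F0 \<union> (\<lambda>u. {v, u}) ` N"
      proof (cases "v \<in> e")
        case True
        obtain x y where xy: "e = {x, y}" "x \<in> insert v V" "y \<in> insert v V" "x \<noteq> y"
          using nsets2_E[of e "insert v V"] insert.prems(1) e by blast
        then obtain u where "e = {v, u}" "u \<in> V" using True by auto
        then show ?thesis using e unfolding N_def by auto
      qed (use e F0_def in auto)
    qed
    show "F0 \<union> (\<lambda>u. {v, u}) ` N \<subseteq> F" unfolding F0_def N_def by auto
  qed
  have inj: "inj_on (\<lambda>u. {v, u}) N" by (auto simp: inj_on_def doubleton_eq_iff)
  have disj: "F0 \<inter> (\<lambda>u. {v, u}) ` N = {}" unfolding F0_def by auto
  have cF: "card F = card F0 + card N"
    using finF finN disj inj by (subst F_eq, subst card_Un_disjoint) (auto simp: F0_def card_image)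
  obtain \<phi> where \<phi>: "\<forall>v. \<phi> v < w" "w * card {e\<in>F0. mono_edge \<phi> e} \<le> card F0"
    using insert.IH[OF F0 insert.prems(2)] by blast
  have "\<exists>c<w. w * card {u\<in>N. \<phi> u = c} \<le> card N"
  proof (rule ccontr)
    assume "\<not> ?thesis"
    then have lt: "card N < w * card {u\<in>N. \<phi> u = c}" if "c < w" for c using that by force
    have "w * card N = (\<Sum>c<w. card N)" by simp
    also have "\<dots> < (\<Sum>c<w. w * card {u\<in>N. \<phi> u = c})"
      using lt insert.prems(2) by (intro sum_strict_mono) (auto simp: lessThan_empty_iff)
    also have "\<dots> = w * (\<Sum>c<w. card {u\<in>N. \<phi> u = c})" by (simp add: sum_distrib_left)
    also have "(\<Sum>c<w. card {u\<in>N. \<phi> u = c}) = card N"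
      using sum.group[of N "{..<w}" \<phi> "\<lambda>_. 1::nat"] finN \<phi> by auto
    finally show False by simp
  qed
  then obtain c where c: "c < w" "w * card {u\<in>N. \<phi> u = c} \<le> card N" by blast
  define \<phi>' where "\<phi>' = \<phi>(v := c)"
  have "{e\<in>F. mono_edge \<phi>' e} \<subseteq> {e\<in>F0. mono_edge \<phi> e} \<union> (\<lambda>u. {v, u}) ` {u\<in>N. \<phi> u = c}"
  proof
    fix e assume e: "e \<in> {e\<in>F. mono_edge \<phi>' e}"
    then consider "e \<in> F0" | u where "u \<in> N" "e = {v, u}" using F_eq by auto
    then show "e \<in> {e\<in>F0. mono_edge \<phi> e} \<union> (\<lambda>u. {v, u}) ` {u\<in>N. \<phi> u = c}"
    proof cases
      case 1
      then have "v \<notin> e" unfolding F0_def by auto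
      then have "mono_edge \<phi> e" using e unfolding mono_edge_def \<phi>'_def by (auto split: if_splits)
      then show ?thesis using 1 by auto
    next
      case 2
      then have "u \<noteq> v" using insert.hyps unfolding N_def by auto
      then show ?thesis using 2 e unfolding \<phi>'_def by (auto simp: mono_edge_pair)
    qed
  qed
  then have "card {e\<in>F. mono_edge \<phi>' e} \<le>
      card ({e\<in>F0. mono_edge \<phi> e} \<union> (\<lambda>u. {v, u}) ` {u\<in>N. \<phi> u = c})"
    using finF finN by (intro card_mono) (auto simp: F0_def)
  also have "\<dots> \<le> card {e\<in>F0. mono_edge \<phi> e} + card {u\<in>N. \<phi> u = c}"
    using finN by (intro order_trans[OF card_Un_le] add_mono card_image_le) auto
  finally have "w * card {e\<in>F. mono_edge \<phi>' e} \<le> w * (card {e\<in>F0. mono_edge \<phi> e} + card {u\<in>N. \<phi> u = c})"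
    by (rule mult_le_mono2)
  also have "\<dots> \<le> card F" using \<phi>(2) c(2) cF by (simp add: distrib_left)
  finally have "w * card {e\<in>F. mono_edge \<phi>' e} \<le> card F" .
  moreover have "\<forall>u. \<phi>' u < w" using \<phi> c unfolding \<phi>'_def by auto
  ultimately show ?case by blast
qed

text \<open>Without its monochromatic edges the graph is properly coloured with \<open>w\<close>
  colours and has no room for a clique of size \<open>w + 1\<close>.\<close>

lemma property_dist_le_clique:
  assumes G: "fin_simple_graph G" and S: "S \<subseteq> verts H" "clique S (edges H)" "card S = w + 1"
    and w: "1 \<le> w"
  shows "real w * (property_dist G (Forb H) * real (card (verts G) choose 2)) \<le> real (card (edges G))"
proof -
  have fin: "finite (verts G)" and E: "edges G \<subseteq> [verts G]\<^bsup>2\<^esup>" using G unfolding fin_simple_graph_def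
    by auto
  obtain \<phi> where \<phi>: "\<forall>v. \<phi> v < w" "w * card {e\<in>edges G. mono_edge \<phi> e} \<le> card (edges G)"
    using few_mono_edges[OF fin E w] by blast
  define G' where "G' = (verts G, {e\<in>edges G. \<not> mono_edge \<phi> e})"
  have finS: "finite S" using S(3) by (intro card_ge_0_finite) auto
  have "\<not> has_induced_copy G' H"
  proof
    assume "has_induced_copy G' H"
    then obtain f where f: "\<forall>u\<in>verts H. \<forall>v\<in>verts H. {u, v} \<in> edges H \<longleftrightarrow> {f u, f v} \<in> edges G'"
      unfolding has_induced_copy_def by blast
    have "inj_on (\<phi> \<circ> f) S"
    proof (rule inj_onI, rule ccontr)
      fix u v assume uv: "u \<in> S" "v \<in> S" "(\<phi> \<circ> f) u = (\<phi> \<circ> f) v" "u \<noteq> v"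
      then have "{u, v} \<in> edges H" using S(2) unfolding clique_def by blast
      then have "{f u, f v} \<in> edges G'" using f uv S(1) by blast
      then show False using uv unfolding G'_def by (simp add: mono_edge_pair)
    qed
    then have "card S \<le> card {..<w}" using \<phi>(1) by (intro card_inj_on_le[of "\<phi> \<circ> f"]) auto
    then show False using S(3) by simp
  qed
  then have G': "G' \<in> Forb H" "verts G' = verts G"
    using fin E unfolding Forb_def fin_simple_graph_def G'_def by auto
  have "sym_diff (edges G) (edges G') = {e\<in>edges G. mono_edge \<phi> e}" unfolding G'_def by auto
  then have "property_dist G (Forb H) \<le>
      real (card {e\<in>edges G. mono_edge \<phi> e}) / real (card (verts G) choose 2)"
    using property_dist_le[OF fin G'(2,1)] unfolding graph_dist_def by simp
  then have "property_dist G (Forb H) * real (card (verts G) choose 2) \<le>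
      real (card {e\<in>edges G. mono_edge \<phi> e}) / real (card (verts G) choose 2) * real (card (verts G) choose 2)"
    by (intro mult_right_mono) auto
  also have "\<dots> \<le> real (card {e\<in>edges G. mono_edge \<phi> e})" by simp
  finally have "real w * (property_dist G (Forb H) * real (card (verts G) choose 2)) \<le>
     real w * real (card {e\<in>edges G. mono_edge \<phi> e})" by (intro mult_left_mono) auto
  also have "\<dots> \<le> real (card (edges G))" using \<phi>(2) by (metis of_nat_le_iff of_nat_mult)
  finally show ?thesis .
qed

text \<open>The dual edit: adding the monochromatic nonedges turns the colour classes into
  \<open>b\<close> cliques, and an independent set of size \<open>b + 1\<close> would have two
  vertices in one of them.\<close>

lemma property_dist_le_indep:
  assumes G: "fin_simple_graph G" and S: "S \<subseteq> verts H" "indep S (edges H)" "card S = b + 1"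
    and b: "1 \<le> b"
  shows "real b * (property_dist G (Forb H) * real (card (verts G) choose 2))
    \<le> real (card (verts G) choose 2) - real (card (edges G))"
proof -
  have fin: "finite (verts G)" and E: "edges G \<subseteq> [verts G]\<^bsup>2\<^esup>" using G unfolding fin_simple_graph_def
    by auto
  define F where "F = [verts G]\<^bsup>2\<^esup> - edges G"
  have fin2: "finite ([verts G]\<^bsup>2\<^esup>)" using fin by (rule finite_imp_finite_nsets)
  have "F \<subseteq> [verts G]\<^bsup>2\<^esup>" unfolding F_def by auto
  then obtain \<phi> where \<phi>: "\<forall>v. \<phi> v < b" "b * card {e\<in>F. mono_edge \<phi> e} \<le> card F"
    using few_mono_edges[OF fin _ b] by blast
  define G' where "G' = (verts G, edges G \<union> {e\<in>F. mono_edge \<phi> e})"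
  have "\<not> has_induced_copy G' H"
  proof
    assume "has_induced_copy G' H"
    then obtain f where f: "inj_on f (verts H)" "f ` verts H \<subseteq> verts G"
      "\<forall>u\<in>verts H. \<forall>v\<in>verts H. {u, v} \<in> edges H \<longleftrightarrow> {f u, f v} \<in> edges G'"
      unfolding has_induced_copy_def G'_def by auto
    have "inj_on (\<phi> \<circ> f) S"
    proof (rule inj_onI, rule ccontr)
      fix u v assume uv: "u \<in> S" "v \<in> S" "(\<phi> \<circ> f) u = (\<phi> \<circ> f) v" "u \<noteq> v"
      then have "{u, v} \<notin> edges H" using S(2) unfolding indep_def by blast
      then have "{f u, f v} \<notin> edges G'" using f uv S(1) by blast
      moreover have "{f u, f v} \<in> [verts G]\<^bsup>2\<^esup>"
      proof -
        have "u \<in> verts H" "v \<in> verts H" using uv S(1) by auto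
        moreover from this have "f u \<noteq> f v" using f(1) uv(4) by (auto dest: inj_onD)
        ultimately show ?thesis using f(2) by auto
      qed
      ultimately show False using uv unfolding G'_def F_def by (simp add: mono_edge_pair)
    qed
    then have "card S \<le> card {..<b}" using \<phi>(1) by (intro card_inj_on_le[of "\<phi> \<circ> f"]) auto
    then show False using S(3) by simp
  qed
  then have G': "G' \<in> Forb H" "verts G' = verts G"
    using fin E unfolding Forb_def fin_simple_graph_def G'_def F_def by auto
  have "sym_diff (edges G) (edges G') = {e\<in>F. mono_edge \<phi> e}" unfolding G'_def F_def by auto
  then have "property_dist G (Forb H) \<le> real (card {e\<in>F. mono_edge \<phi> e}) / real (card (verts G) choose 2)"
    using property_dist_le[OF fin G'(2,1)] unfolding graph_dist_def by simp
  then have "property_dist G (Forb H) * real (card (verts G) choose 2) \<le>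
      real (card {e\<in>F. mono_edge \<phi> e}) / real (card (verts G) choose 2) * real (card (verts G) choose 2)"
    by (intro mult_right_mono) auto
  also have "\<dots> \<le> real (card {e\<in>F. mono_edge \<phi> e})" by simp
  finally have "real b * (property_dist G (Forb H) * real (card (verts G) choose 2)) \<le>
     real b * real (card {e\<in>F. mono_edge \<phi> e})" by (intro mult_left_mono) auto
  also have "\<dots> \<le> real (card F)" using \<phi>(2) by (metis of_nat_le_iff of_nat_mult)
  also have "card F = (card (verts G) choose 2) - card (edges G)"
    unfolding F_def using fin2 E by (simp add: card_Diff_subset finite_subset)
  also have "real \<dots> = real (card (verts G) choose 2) - real (card (edges G))"
    using card_mono[OF fin2 E] by (simp add: of_nat_diff)
  finally show ?thesis .
qed

lemma max_dist_le_clique: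
  assumes H: "fin_simple_graph H" "2 \<le> card (verts H)" and p: "0 \<le> p" "p \<le> 1"
    and S: "S \<subseteq> verts H" "clique S (edges H)" "card S = w + 1" and w: "1 \<le> w" and n: "2 \<le> n"
  shows "max_dist H p n \<le> p / real w"
proof -
  obtain G where G: "G \<in> graphs_of_density n p" "max_dist H p n = property_dist G (Forb H)"
    using max_dist_attained[OF H p] .
  have c: "0 < real (n choose 2)" using n by simp
  have "real w * (max_dist H p n * real (n choose 2)) \<le> real (card (edges G))"
    using property_dist_le_clique[OF _ S w, of G] G unfolding graphs_of_density_def by auto
  also have "\<dots> \<le> p * real (n choose 2)" using G(1) unfolding graphs_of_density_def by simp linarith
  finally have "(real w * max_dist H p n) * real (n choose 2) \<le> p * real (n choose 2)" by simp
  then have "real w * max_dist H p n \<le> p" using c by (subst (asm) mult_le_cancel_right_pos)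
  then show ?thesis using w by (simp add: field_simps)
qed

text \<open>The floor in the prescribed number of edges may add up to one nonedge, hence the term
  \<open>1 / real (n choose 2)\<close>, which vanishes in the limit.\<close>

lemma max_dist_le_indep:
  assumes H: "fin_simple_graph H" "2 \<le> card (verts H)" and p: "0 \<le> p" "p \<le> 1"
    and S: "S \<subseteq> verts H" "indep S (edges H)" "card S = b + 1" and b: "1 \<le> b" and n: "2 \<le> n"
  shows "max_dist H p n \<le> (1 - p) / real b + 1 / real (n choose 2)"
proof -
  obtain G where G: "G \<in> graphs_of_density n p" "max_dist H p n = property_dist G (Forb H)"
    using max_dist_attained[OF H p] .
  define c where "c = real (n choose 2)"
  have c: "0 < c" unfolding c_def using n by simp
  have "real b * (max_dist H p n * c) \<le> c - real (card (edges G))"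
    using property_dist_le_indep[OF _ S b, of G] G unfolding graphs_of_density_def c_def by auto
  also have "\<dots> \<le> (1 - p) * c + 1"
  proof -
    have "p * c - 1 \<le> real (card (edges G))" using G(1) unfolding graphs_of_density_def c_def
      by simp linarith
    then show ?thesis by (simp add: algebra_simps)
  qed
  finally have "max_dist H p n \<le> ((1 - p) * c + 1) / (b * c)" using b c by (simp add: field_simps)
  also have "\<dots> = (1 - p) / b + 1 / (b * c)" using b c by (simp add: add_divide_distrib)
  also have "1 / (b * c) \<le> 1 / (1 * c)" using b c by (intro divide_left_mono mult_right_mono) auto
  finally show ?thesis unfolding c_def by simp
qed

text \<open>Counts over ordered pairs see every edge twice; this factor links
  \<open>edge_count\<close> with cardinalities of edge sets.\<close>

lemma edge_count_edges:
  assumes "finite V" "T \<subseteq> [V]\<^bsup>2\<^esup>"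
  shows "edge_count (\<lambda>x y. {x, y} \<in> T) V V = 2 * real (card T)"
proof -
  have "finite T" using assms finite_imp_finite_nsets finite_subset by blast
  then show ?thesis using assms(2)
  proof (induction T rule: finite_induct)
    case empty
    then show ?case by (simp add: edge_count_def)
  next
    case (insert e T)
    obtain a b where ab: "e = {a, b}" "a \<in> V" "b \<in> V" "a \<noteq> b"
      using nsets2_E[of e V] insert.prems by blast
    have "edge_count (\<lambda>x y. {x, y} \<in> insert e T) V V =
      (\<Sum>x\<in>V. \<Sum>y\<in>V. of_bool ({x, y} \<in> T) + (if x = a then if y = b then 1 else 0 else 0)
         + (if x = b then if y = a then 1 else 0 else 0))"
      unfolding edge_count_def using insert.hyps ab
        by (intro sum.cong refl) (auto simp: doubleton_eq_iff of_bool_def insert_commute)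
    also have "\<dots> = edge_count (\<lambda>x y. {x, y} \<in> T) V V + 1 + 1"
      unfolding edge_count_def using assms(1) ab
      by (simp add: sum.distrib if_distrib[of "sum _"] cong: if_cong)
         (simp add: sum.delta' if_distribR sum.If_cases)
    finally show ?case using insert by simp
  qed
qed

text \<open>The number of edges is prescribed exactly; removing or adding edges, never both, reaches
  it with the least change.\<close>

lemma exists_subset_of_card_near:
  assumes "finite P" "T0 \<subseteq> P" "m \<le> card P"
  shows "\<exists>T\<subseteq>P. card T = m \<and> real (card (sym_diff T T0)) = \<bar>real m - real (card T0)\<bar>"
proof (cases "m \<le> card T0")
  case True
  then obtain T where T: "T \<subseteq> T0" "card T = m" by (meson obtain_subset_with_card_n)
  have "sym_diff T T0 = T0 - T" using T by auto
  moreover have "card (T0 - T) = card T0 - m"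
    using T assms by (simp add: card_Diff_subset finite_subset)
  ultimately have "real (card (sym_diff T T0)) = \<bar>real m - real (card T0)\<bar>" using True
    by (simp add: of_nat_diff)
  then show ?thesis using T assms(2) by (intro exI[of _ T]) auto
next
  case False
  have fin: "finite T0" using assms finite_subset by auto
  have "m - card T0 \<le> card (P - T0)" using assms fin False by (simp add: card_Diff_subset)
  then obtain Y where Y: "Y \<subseteq> P - T0" "card Y = m - card T0" by (meson obtain_subset_with_card_n)
  have finY: "finite Y" using Y assms finite_subset by blast
  have "card (T0 \<union> Y) = m" using Y fin finY False by (subst card_Un_disjoint) auto
  moreover have "sym_diff (T0 \<union> Y) T0 = Y" using Y by auto
  ultimately show ?thesis using Y False assms(2)
    by (intro exI[of _ "T0 \<union> Y"]) (auto simp: of_nat_diff)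
qed

section \<open>Lower bound for the distance\<close>

lemma edge_count_sym_diff_edges:
  assumes "finite V" "T \<subseteq> [V]\<^bsup>2\<^esup>" "T' \<subseteq> [V]\<^bsup>2\<^esup>"
  shows "edge_count (\<lambda>x y. ({x, y} \<in> T) \<noteq> ({x, y} \<in> T')) V V = 2 * real (card (sym_diff T T'))"
proof -
  have "edge_count (\<lambda>x y. ({x, y} \<in> T) \<noteq> ({x, y} \<in> T')) V V = edge_count (\<lambda>x y. {x, y} \<in> sym_diff T T') V V"
    unfolding edge_count_def by (intro sum.cong refl) (auto simp: of_bool_def)
  also have "\<dots> = 2 * real (card (sym_diff T T'))" using assms by (intro edge_count_edges) auto
  finally show ?thesis .
qed

lemma loop_free: "T \<subseteq> [V]\<^bsup>2\<^esup> \<Longrightarrow> {z, z} \<notin> T"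
  by (metis doubleton_in_nsets_2 subsetD)

lemma edge_count_mono:
  assumes "finite V" "U \<subseteq> V"
  shows "edge_count R U U \<le> edge_count R V V"
proof -
  have "edge_count R U U \<le> (\<Sum>x\<in>U. \<Sum>y\<in>V. of_bool (R x y))"
    unfolding edge_count_def using assms by (intro sum_mono sum_mono2) auto
  also have "\<dots> \<le> edge_count R V V"
    unfolding edge_count_def using assms by (intro sum_mono2 sum_nonneg) auto
  finally show ?thesis .
qed

text \<open>Of the \<open>n * n - n' * n'\<close> ordered pairs not inside the first
  \<open>n'\<close> vertices, \<open>n - n'\<close> are diagonal and never edges.\<close>

lemma edge_count_padded:
  fixes n' n :: nat and full :: bool
  assumes n': "n' \<le> n" and irr: "\<And>x. \<not> E0 x x"
  defines "E \<equiv> \<lambda>i j. if i < n' \<and> j < n' then E0 i j else full \<and> i \<noteq> j"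
  shows "edge_count E {..<n} {..<n} = edge_count E0 {..<n'} {..<n'} +
    (if full then real n * real n - real n' * real n' - (real n - real n') else 0)"
proof -
  define c where "c i = (if i < n' then 1 else 0 :: real)" for i :: nat
  have csum: "(\<Sum>i<n. c i * f i) = (\<Sum>i<n'. f i)" for f
  proof -
    have "(\<Sum>i<n. c i * f i) = (\<Sum>i<n. if i < n' then f i else 0)"
      unfolding c_def by (intro sum.cong) auto
    also have "\<dots> = (\<Sum>i<n'. f i)"
      using n' by (subst sum.inter_filter[symmetric]) (auto intro!: sum.cong)
    finally show ?thesis .
  qed
  have "edge_count E {..<n} {..<n} = (\<Sum>i<n. \<Sum>j<n. c i * (c j * of_bool (E0 i j)) +
     of_bool full * (1 - c i * c j - (if j = i then 1 - c i else 0)))"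
    unfolding edge_count_def E_def c_def using irr by (intro sum.cong refl) (auto simp: of_bool_def)
  also have "\<dots> = (\<Sum>i<n. c i * (\<Sum>j<n. c j * of_bool (E0 i j))) +
     of_bool full * (\<Sum>i<n. \<Sum>j<n. 1 - c i * c j - (if j = i then 1 - c i else 0))"
    by (simp only: sum.distrib sum_distrib_left)
  also have "(\<Sum>i<n. c i * (\<Sum>j<n. c j * of_bool (E0 i j))) = edge_count E0 {..<n'} {..<n'}"
    unfolding csum edge_count_def ..
  also have "(\<Sum>i<n. \<Sum>j<n. 1 - c i * c j - (if j = i then 1 - c i else 0)) =
      (\<Sum>i<n. real n - c i * real n' - (1 - c i))"
  proof (rule sum.cong[OF refl])
    fix i assume "i \<in> {..<n}"
    then show "(\<Sum>j<n. 1 - c i * c j - (if j = i then 1 - c i else 0)) = real n - c i * real n' - (1 - c i)"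
      using csum[of "\<lambda>_. 1"] by (simp add: sum_subtractf sum_distrib_left[symmetric])
  qed
  also have "\<dots> = real n * real n - real n' * real n' - (real n - real n')"
    using csum[of "\<lambda>_. 1"] by (simp add: sum_subtractf sum_distrib_right[symmetric])
  finally show ?thesis by simp
qed

text \<open>A quasirandom graph of the critical density \<open>ps\<close> on \<open>x * n\<close> of
  the \<open>n\<close> vertices contains about an \<open>x\<^sup>2\<close> fraction of all pairs, so
  the edits forced inside it alone give the bound. The other pairs are all empty or all full, and
  \<open>px\<close> says that the overall density is then \<open>p\<close>.\<close>

lemma max_dist_lower_bound:
  fixes H :: "'a graph"
  assumes H: "fin_simple_graph H" "2 \<le> card (verts H)"
    and split: "split_structure (verts H) (\<lambda>u v. {u, v} \<in> edges H) A B w b" and wb: "1 \<le> w + b"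
  defines "ps \<equiv> real w / real (w + b)"
  assumes x: "0 < x" "x \<le> 1" and p: "0 \<le> p" "p \<le> 1"
    and px: "if full then 1 - p = x\<^sup>2 * (1 - ps) else p = x\<^sup>2 * ps" and \<epsilon>: "0 < \<epsilon>"
  shows "\<exists>n2. \<forall>n\<ge>n2. x\<^sup>2 / real (w + b) - \<epsilon> \<le> max_dist H p n"
proof -
  interpret split_structure "verts H" "\<lambda>u v. {u, v} \<in> edges H" A B w b by (rule split)
  define t where "t = real (w + b)"
  have t: "1 \<le> t" unfolding t_def using wb by simp
  have ps: "0 \<le> ps" "ps \<le> 1" unfolding ps_def by (auto simp: divide_le_eq_1)
  have \<epsilon>2: "0 < \<epsilon> / 2" using \<epsilon> by simp
  from distance_to_free_graphs[OF wb \<epsilon>2, where 'v = nat, folded ps_def t_def]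
  obtain n0 \<eta>0 where \<eta>0: "0 < \<eta>0" and dist: "\<forall>(U::nat set) E F. finite U \<longrightarrow> n0 \<le> card U \<longrightarrow>
    (\<forall>x y. E x y = E y x) \<longrightarrow> (\<forall>x y. F x y = F y x) \<longrightarrow> (\<forall>x. \<not> F x x) \<longrightarrow>
    (\<forall>X\<subseteq>U. \<forall>Y\<subseteq>U. \<bar>edge_count E X Y - ps * (real (card X) * real (card Y))\<bar> \<le> \<eta>0 * real (card U) ^ 2) \<longrightarrow>
    \<not> (\<exists>f. inj_on f (verts H) \<and> f ` verts H \<subseteq> U \<and>
       (\<forall>u\<in>verts H. \<forall>v\<in>verts H. u \<noteq> v \<longrightarrow> ({u, v} \<in> edges H) = F (f u) (f v))) \<longrightarrow>
    (1 / t - \<epsilon> / 2) * real (card U) ^ 2 \<le> edge_count (\<lambda>x y. E x y \<noteq> F x y) U U"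
    by (elim exE conjE) (rule that)
  define \<eta> where "\<eta> = min \<eta>0 (\<epsilon> / 8)"
  have \<eta>: "0 < \<eta>" "\<eta> \<le> \<eta>0" "\<eta> \<le> \<epsilon> / 8" unfolding \<eta>_def using \<eta>0 \<epsilon> by auto
  obtain n1 where n1: "\<forall>n\<ge>n1. \<exists>E :: nat \<Rightarrow> nat \<Rightarrow> bool. (\<forall>x y. E x y = E y x) \<and> (\<forall>x. \<not> E x x) \<and>
    (\<forall>X\<subseteq>{..<n}. \<forall>Y\<subseteq>{..<n}. \<bar>edge_count E X Y - ps * (real (card X) * real (card Y))\<bar> \<le> \<eta> * real n ^ 2)"
    using exists_quasirandom_graph[OF ps \<eta>(1)] by (elim exE) (rule that)
  \<comment> \<open>The first quotient makes \<open>x * n - 1\<close> reach both thresholds;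
    \<open>28 / \<epsilon>\<close> absorbs the lower order terms
    \<open>5 * l + 2 \<le> 7 * l\<close> into \<open>\<epsilon> / 4 * (l * l)\<close>.\<close>
  define n2 where "n2 = 2 + nat \<lceil>real (n0 + n1 + 1) / x\<rceil> + nat \<lceil>28 / \<epsilon>\<rceil>"
  have "x\<^sup>2 / t - \<epsilon> \<le> max_dist H p n" if n: "n2 \<le> n" for n
  proof -
    define l where "l = real n"
    have l: "real (n0 + n1 + 1) / x \<le> l" "28 / \<epsilon> \<le> l" "2 \<le> l" "2 \<le> n"
    proof -
      have "real (n0 + n1 + 1) / x \<le> real n2" "28 / \<epsilon> \<le> real n2" "2 \<le> n2" unfolding n2_def by linarith+
      then show "real (n0 + n1 + 1) / x \<le> l" "28 / \<epsilon> \<le> l" "2 \<le> l" "2 \<le> n" unfolding l_def using n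
        by linarith+
    qed
    define n' where "n' = nat \<lfloor>x * l\<rfloor>"
    define l' where "l' = real n'"
    have l': "x * l - 1 \<le> l'" "l' \<le> x * l" "0 \<le> l'"
    proof -
      have "0 \<le> x * l" using x l by simp
      then show "x * l - 1 \<le> l'" "l' \<le> x * l" "0 \<le> l'" unfolding l'_def n'_def by linarith+
    qed
    have "x * l \<le> 1 * l" using x l by (intro mult_right_mono) auto
    then have "l' \<le> l" using l' by linarith
    then have n'n: "n' \<le> n" unfolding l'_def l_def by simp
    have "real (n0 + n1 + 1) \<le> x * l" using l(1) x by (simp add: field_simps)
    then have "real (n0 + n1) \<le> l'" using l' by linarith
    then have big: "n0 \<le> n'" "n1 \<le> n'" unfolding l'_def by linarith+
    obtain E0 :: "nat \<Rightarrow> nat \<Rightarrow> bool" where E0: "\<forall>x y. E0 x y = E0 y x" "\<forall>x. \<not> E0 x x"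
      and qr: "\<forall>X\<subseteq>{..<n'}. \<forall>Y\<subseteq>{..<n'}. \<bar>edge_count E0 X Y - ps * (real (card X) * real (card Y))\<bar> \<le> \<eta> * real n' ^ 2"
      using n1[rule_format, OF big(2)] by (elim exE conjE) (rule that)
    define E where "E = (\<lambda>i j. if i < n' \<and> j < n' then E0 i j else full \<and> i \<noteq> j)"
    have Esym: "E x y = E y x" and Eirr: "\<not> E x x" for x y
      unfolding E_def using E0 by auto
    define V where "V = {..<n}"
    define P where "P = [V]\<^bsup>2\<^esup>"
    have finV: "finite V" and cV: "card V = n" and finP: "finite P" and cP: "card P = n choose 2"
      unfolding V_def P_def by (auto simp: finite_imp_finite_nsets)
    define T0 where "T0 = {e\<in>P. \<exists>i j. e = {i, j} \<and> E i j}"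
    have T0: "{i, j} \<in> T0 \<longleftrightarrow> E i j" if "i \<in> V" "j \<in> V" for i j
      using that Esym Eirr unfolding T0_def P_def by (auto simp: doubleton_eq_iff)
    have T0P: "T0 \<subseteq> P" unfolding T0_def by auto
    define C where "C = real (n choose 2)"
    have C: "2 * C = l * l - l" "0 < C"
    proof -
      have "2 dvd n * (n - 1)" using l(4) by (cases "even n") auto
      then have "2 * (n choose 2) = n * (n - 1)" unfolding choose_two by (rule dvd_mult_div_cancel)
      then have "2 * C = real (n * (n - 1))" unfolding C_def by (metis of_nat_mult of_nat_numeral)
      then show "2 * C = l * l - l" unfolding l_def using l(4) by (simp add: of_nat_diff algebra_simps)
      show "0 < C" unfolding C_def using l(4) by simp
    qed
    define m where "m = nat \<lfloor>p * C\<rfloor>"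
    have "p * C \<le> 1 * C" using p C by (intro mult_right_mono) auto
    then have m: "m \<le> card P" "\<bar>real m - p * C\<bar> \<le> 1" "int m = \<lfloor>p * C\<rfloor>"
    proof -
      have pc: "0 \<le> p * C" using p C by simp
      show "m \<le> card P" using \<open>p * C \<le> 1 * C\<close> pc unfolding cP m_def C_def by linarith
      show "\<bar>real m - p * C\<bar> \<le> 1" "int m = \<lfloor>p * C\<rfloor>" using pc unfolding m_def by linarith+
    qed
    \<comment> \<open>The construction only approximates the required number of edges;
      \<open>T\<close> has it exactly and differs from \<open>T0\<close> by the numerical
      gap.\<close>
    obtain T where T: "T \<subseteq> P" "card T = m" "real (card (sym_diff T T0)) = \<bar>real m - real (card T0)\<bar>"
      using exists_subset_of_card_near[OF finP T0P m(1)] by blast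
    have ecE: "edge_count E V V = 2 * real (card T0)"
    proof -
      have "edge_count E V V = edge_count (\<lambda>x y. {x, y} \<in> T0) V V"
        unfolding edge_count_def using T0 by (intro sum.cong refl) auto
      then show ?thesis using edge_count_edges[OF finV, of T0] T0P unfolding P_def by simp
    qed
    have "\<bar>edge_count E0 {..<n'} {..<n'} - ps * (l' * l')\<bar> \<le> \<eta> * l' ^ 2"
      using qr unfolding l'_def by (metis card_lessThan order_refl)
    then have e0: "\<bar>edge_count E0 {..<n'} {..<n'} - ps * (l' * l')\<bar> \<le> \<eta> * (l' * l')"
      by (simp add: power2_eq_square)
    have ecpad: "edge_count E V V = edge_count E0 {..<n'} {..<n'} + (if full then l * l - l' * l' - (l - l') else 0)"
      unfolding E_def V_def l_def l'_def using E0 by (intro edge_count_padded[OF n'n]) auto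
    define X where "X = (x * l) * (x * l)"
    have X: "l' * l' \<le> X" "X \<le> l' * l' + 2 * l" "X \<le> l * l" "0 \<le> X" "X = x\<^sup>2 * (l * l)"
    proof -
      show "l' * l' \<le> X" unfolding X_def using l' by (intro mult_mono) auto
      show "X \<le> l * l" unfolding X_def using x l \<open>x * l \<le> 1 * l\<close> by (intro mult_mono) auto
      show "0 \<le> X" unfolding X_def by simp
      have "(x * l - l') * (x * l + l') \<le> 1 * (l + l)"
        using l' \<open>l' \<le> l\<close> \<open>x * l \<le> 1 * l\<close> by (intro mult_mono) auto
      then show "X \<le> l' * l' + 2 * l" unfolding X_def by (simp add: algebra_simps)
      show "X = x\<^sup>2 * (l * l)" unfolding X_def by (simp add: power2_eq_square)
    qed
    have gap: "c * (X - l' * l') \<le> 2 * l" "0 \<le> c * (X - l' * l')" if "0 \<le> c" "c \<le> 1" for c :: real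
    proof -
      have Y: "0 \<le> X - l' * l'" "X - l' * l' \<le> 2 * l" using X(1,2) by linarith+
      show "0 \<le> c * (X - l' * l')" using that(1) Y(1) by (rule mult_nonneg_nonneg)
      show "c * (X - l' * l') \<le> 2 * l"
        using mult_left_le_one_le[OF Y(1) that] Y(2) by linarith
    qed
    have pl: "0 \<le> p * l" "p * l \<le> l" using p l by (auto simp: mult_left_le_one_le)
    have \<eta>l: "\<eta> * (l' * l') \<le> \<eta> * (l * l)" using X \<eta> by (intro mult_left_mono) auto
    have main_count: "\<bar>edge_count E V V - p * (2 * C)\<bar> \<le> \<eta> * (l * l) + 3 * l"
    proof (cases full)
      case False
      have "p * (l * l) = ps * X" using px False X(5) by simp
      then have "p * (2 * C) = ps * X - p * l" unfolding C by (simp add: algebra_simps)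
      moreover have "ps * X - ps * (l' * l') \<le> 2 * l" "0 \<le> ps * X - ps * (l' * l')"
        using gap[OF ps] by (simp_all add: algebra_simps)
      ultimately show ?thesis using ecpad False e0 \<eta>l pl by (simp add: abs_le_iff)
    next
      case True
      have pe: "p = 1 - x\<^sup>2 * (1 - ps)" using px True by simp
      have "p * (l * l) = l * l - x\<^sup>2 * (1 - ps) * (l * l)" unfolding pe by (simp add: algebra_simps)
      also have "\<dots> = l * l - (1 - ps) * X" unfolding X(5) by simp
      finally have "p * (2 * C) = l * l - (1 - ps) * X - p * l" unfolding C by (simp add: algebra_simps)
      moreover have "X - ps * X - l' * l' + ps * (l' * l') \<le> 2 * l" "0 \<le> X - ps * X - l' * l' + ps * (l' * l')"
        using gap[of "1 - ps"] ps by (simp_all add: algebra_simps)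
      moreover have "(1 - ps) * X = X - ps * X" by (simp add: algebra_simps)
      ultimately show ?thesis using ecpad True e0 \<eta>l pl \<open>l' \<le> l\<close> l'(3) by (simp add: abs_le_iff)
    qed
    have sd0: "2 * real (card (sym_diff T T0)) \<le> \<eta> * (l * l) + 3 * l + 2"
    proof -
      define z where "z = p * C"
      define y where "y = \<eta> * (l * l) + 3 * l"
      have "p * (2 * C) = 2 * z" unfolding z_def by simp
      then have "\<bar>2 * real (card T0) - 2 * z\<bar> \<le> y" "\<bar>real m - z\<bar> \<le> 1"
        using main_count m(2) unfolding ecE y_def z_def by simp_all
      then have "\<bar>real m - real (card T0)\<bar> \<le> y / 2 + 1" by linarith
      then have "2 * \<bar>real m - real (card T0)\<bar> \<le> 2 * (y / 2 + 1)" by (rule mult_left_mono) simp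
      then show ?thesis unfolding T(3) y_def[symmetric] by (simp add: distrib_left)
    qed
    have G: "(V, T) \<in> graphs_of_density n p"
      unfolding graphs_of_density_def fin_simple_graph_def
      using finV cV T m(3) unfolding P_def C_def by simp
    have finG: "finite (verts (V, T))" using finV by simp
    obtain G' where G': "verts G' = V" "G' \<in> Forb H" "property_dist (V, T) (Forb H) = graph_dist (V, T) G'"
      using property_dist_attained[OF H finG] by (metis fst_conv)
    define T' where "T' = edges G'"
    have T'P: "T' \<subseteq> P" using Forb_edges[OF G'(2)] G'(1) unfolding T'_def P_def by simp
    define F where "F x y \<longleftrightarrow> {x, y} \<in> T'" for x y
    \<comment> \<open>An induced subgraph of an \<open>H\<close>-free graph is
      \<open>H\<close>-free, so \<open>distance_to_free_graphs\<close> applies to the first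
      \<open>n'\<close> vertices.\<close>
    have free: "\<not> (\<exists>f. inj_on f (verts H) \<and> f ` verts H \<subseteq> {..<n'} \<and>
       (\<forall>u\<in>verts H. \<forall>v\<in>verts H. u \<noteq> v \<longrightarrow> ({u, v} \<in> edges H) = F (f u) (f v)))"
    proof
      assume "\<exists>f. inj_on f (verts H) \<and> f ` verts H \<subseteq> {..<n'} \<and>
       (\<forall>u\<in>verts H. \<forall>v\<in>verts H. u \<noteq> v \<longrightarrow> ({u, v} \<in> edges H) = F (f u) (f v))"
      then obtain f where f: "inj_on f (verts H)" "f ` verts H \<subseteq> {..<n'}"
        "\<forall>u\<in>verts H. \<forall>v\<in>verts H. u \<noteq> v \<longrightarrow> ({u, v} \<in> edges H) = F (f u) (f v)"
        by (elim exE conjE) (rule that)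
      have "({u, v} \<in> edges H) = ({f u, f v} \<in> edges G')" if uv: "u \<in> verts H" "v \<in> verts H" for u v
      proof (cases "u = v")
        case True
        have "edges H \<subseteq> [verts H]\<^bsup>2\<^esup>" using H(1) unfolding fin_simple_graph_def by simp
        then have "{u, u} \<notin> edges H" "{f u, f u} \<notin> edges G'"
          using loop_free Forb_edges[OF G'(2)] by metis+
        then show ?thesis using True by simp
      next
        case False
        show ?thesis using f(3)[rule_format, OF uv False] unfolding F_def T'_def .
      qed
      moreover have "f ` verts H \<subseteq> verts G'" using f(2) n'n G'(1) unfolding V_def by auto
      ultimately have "has_induced_copy G' H" using f(1) unfolding has_induced_copy_def by blast
      then show False using G'(2) unfolding Forb_def by simp
    qed
    have qr': "\<forall>X\<subseteq>{..<n'}. \<forall>Y\<subseteq>{..<n'}.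
       \<bar>edge_count E0 X Y - ps * (real (card X) * real (card Y))\<bar> \<le> \<eta>0 * real (card {..<n'}) ^ 2"
    proof (intro allI impI)
      fix X Y assume "X \<subseteq> {..<n'}" "Y \<subseteq> {..<n'}"
      then have "\<bar>edge_count E0 X Y - ps * (real (card X) * real (card Y))\<bar> \<le> \<eta> * real n' ^ 2" using qr
        by blast
      also have "\<dots> \<le> \<eta>0 * real n' ^ 2" using \<eta>(2) by (intro mult_right_mono) auto
      finally show "\<bar>edge_count E0 X Y - ps * (real (card X) * real (card Y))\<bar> \<le> \<eta>0 * real (card {..<n'}) ^ 2" by simp
    qed
    have Fs: "\<forall>x y. F x y = F y x" unfolding F_def by (simp add: insert_commute)
    have Fi: "\<forall>x. \<not> F x x" using loop_free[of T' V] T'P unfolding F_def P_def by simp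
    have cn': "n0 \<le> card {..<n'}" using big by simp
    have "(1 / t - \<epsilon> / 2) * real (card {..<n'}) ^ 2 \<le> edge_count (\<lambda>x y. E0 x y \<noteq> F x y) {..<n'} {..<n'}"
      by (rule dist[THEN spec, THEN spec, THEN spec, THEN mp, THEN mp, THEN mp, THEN mp, THEN mp,
            THEN mp, THEN mp, OF finite_lessThan cn' E0(1) Fs Fi qr' free])
    also have "edge_count (\<lambda>x y. E0 x y \<noteq> F x y) {..<n'} {..<n'} = edge_count (\<lambda>x y. ({x, y} \<in> T0) \<noteq> F x y) {..<n'} {..<n'}"
      unfolding edge_count_def using T0 n'n by (intro sum.cong refl) (auto simp: E_def V_def)
    also have "\<dots> \<le> edge_count (\<lambda>x y. ({x, y} \<in> T0) \<noteq> F x y) V V"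
      using n'n finV unfolding V_def by (intro edge_count_mono) auto
    also have "\<dots> = 2 * real (card (sym_diff T0 T'))"
      unfolding F_def using T0P T'P finV unfolding P_def by (intro edge_count_sym_diff_edges)
    finally have d1: "(1 / t - \<epsilon> / 2) * (l' * l') \<le> 2 * real (card (sym_diff T0 T'))"
      unfolding l'_def by (simp add: power2_eq_square)
    have "card (sym_diff T0 T') \<le> card (sym_diff T T0 \<union> sym_diff T T')"
      using finP T(1) T0P T'P by (intro card_mono) (auto intro: finite_subset)
    also have "\<dots> \<le> card (sym_diff T T0) + card (sym_diff T T')" by (rule card_Un_le)
    finally have d2: "real (card (sym_diff T0 T')) \<le> real (card (sym_diff T T0)) + real (card (sym_diff T T'))"
      by linarith
    \<comment> \<open>The coefficient is negative when \<open>\<epsilon>\<close> is large, so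
      replacing \<open>l' * l'\<close> by \<open>X\<close> has to treat both signs.\<close>
    have d3: "(1 / t - \<epsilon> / 2) * X - 2 * l \<le> (1 / t - \<epsilon> / 2) * (l' * l')"
    proof (cases "0 \<le> 1 / t - \<epsilon> / 2")
      case True
      have "1 / t \<le> 1" using t by simp
      then have "1 / t - \<epsilon> / 2 \<le> 1" using \<epsilon> by linarith
      then show ?thesis using gap(1)[OF True] by (simp add: right_diff_distrib)
    next
      case False
      then have "(1 / t - \<epsilon> / 2) * X \<le> (1 / t - \<epsilon> / 2) * (l' * l')"
        using X by (intro mult_left_mono_neg) auto
      then show ?thesis using l by linarith
    qed
    have d4: "(1 / t - \<epsilon> / 2) * X = x\<^sup>2 / t * (l * l) - \<epsilon> / 2 * X" unfolding X(5)
      by (simp add: algebra_simps)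
    have "\<epsilon> / 2 * X \<le> \<epsilon> / 2 * (l * l)" using X \<epsilon> by (intro mult_left_mono) auto
    then have "x\<^sup>2 / t * (l * l) - \<epsilon> / 2 * (l * l) - 2 * l - (\<eta> * (l * l) + 3 * l + 2)
       \<le> 2 * real (card (sym_diff T T'))" using d1 d2 d3 d4 sd0 by linarith
    moreover have "\<eta> * (l * l) \<le> \<epsilon> / 8 * (l * l)" using \<eta>(3) by (intro mult_right_mono) auto
    moreover have "5 * l + 2 \<le> \<epsilon> / 4 * (l * l)"
    proof -
      have "28 \<le> \<epsilon> * l" using l(2) \<epsilon> by (simp add: field_simps)
      then have "l * 28 \<le> l * (\<epsilon> * l)" using l by (intro mult_left_mono) auto
      moreover have "\<epsilon> / 4 * (l * l) = l * (\<epsilon> * l) / 4" by simp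
      ultimately show ?thesis using l(3) by linarith
    qed
    moreover have "0 \<le> \<epsilon> * (l * l)" using \<epsilon> l by simp
    \<comment> \<open>The budget for \<open>\<epsilon>\<close>: one half from the distance theorem,
      an eighth from the discrepancy and a quarter for lower order terms.\<close>
    ultimately have d5: "(x\<^sup>2 / t - \<epsilon>) * (l * l) \<le> 2 * real (card (sym_diff T T'))"
      by (simp add: algebra_simps)
    have "x\<^sup>2 / t - \<epsilon> \<le> real (card (sym_diff T T')) / C"
    proof (cases "0 \<le> x\<^sup>2 / t - \<epsilon>")
      case True
      have "(x\<^sup>2 / t - \<epsilon>) * (2 * C) \<le> (x\<^sup>2 / t - \<epsilon>) * (l * l)"
        using True C l by (intro mult_left_mono) auto
      moreover have "(x\<^sup>2 / t - \<epsilon>) * (2 * C) = 2 * ((x\<^sup>2 / t - \<epsilon>) * C)" by simp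
      ultimately have "2 * ((x\<^sup>2 / t - \<epsilon>) * C) \<le> 2 * real (card (sym_diff T T'))" using d5 by simp
      then have "(x\<^sup>2 / t - \<epsilon>) * C \<le> real (card (sym_diff T T'))" by (rule mult_left_le_imp_le) simp
      then show ?thesis using C by (simp add: pos_le_divide_eq)
    next
      case False
      moreover have "0 \<le> real (card (sym_diff T T')) / C" using C by simp
      ultimately show ?thesis by linarith
    qed
    also have "\<dots> = property_dist (V, T) (Forb H)"
      unfolding G'(3) graph_dist_def T'_def C_def by (simp add: cV)
    also have "\<dots> \<le> max_dist H p n" by (rule max_dist_ge[OF H G])
    finally show ?thesis .
  qed
  then show ?thesis unfolding t_def by blast
qed

section \<open>The edit distance function\<close>

lemma clique_number_props:
  assumes "fin_simple_graph H" "verts H \<noteq> {}"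
  shows "\<exists>S\<subseteq>verts H. clique S (edges H) \<and> card S = clique_number H"
    and "\<And>S. S \<subseteq> verts H \<Longrightarrow> clique S (edges H) \<Longrightarrow> card S \<le> clique_number H"
    and "1 \<le> clique_number H"
proof -
  let ?X = "{card S |S. S \<subseteq> verts H \<and> clique S (edges H)}"
  have fin: "finite (verts H)" using assms unfolding fin_simple_graph_def by auto
  have "?X \<subseteq> card ` Pow (verts H)" by blast
  then have finX: "finite ?X" using fin by (meson finite_Pow_iff finite_imageI finite_subset)
  have "card {} \<in> ?X" by (intro CollectI exI[of _ "{}"]) auto
  then have "Max ?X \<in> ?X" using finX by (intro Max_in) auto
  then show "\<exists>S\<subseteq>verts H. clique S (edges H) \<and> card S = clique_number H"
    unfolding clique_number_def by (auto simp: eq_commute)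
  show le: "card S \<le> clique_number H" if "S \<subseteq> verts H" "clique S (edges H)" for S
    unfolding clique_number_def using finX that by (intro Max_ge) auto
  obtain v where "v \<in> verts H" using assms by auto
  then show "1 \<le> clique_number H" using le[of "{v}"] by (simp add: clique_def)
qed

lemma independence_number_props:
  assumes "fin_simple_graph H" "verts H \<noteq> {}"
  shows "\<exists>S\<subseteq>verts H. indep S (edges H) \<and> card S = independence_number H"
    and "\<And>S. S \<subseteq> verts H \<Longrightarrow> indep S (edges H) \<Longrightarrow> card S \<le> independence_number H"
    and "1 \<le> independence_number H"
proof -
  let ?X = "{card S |S. S \<subseteq> verts H \<and> indep S (edges H)}"
  have fin: "finite (verts H)" using assms unfolding fin_simple_graph_def by auto
  have "?X \<subseteq> card ` Pow (verts H)" by blast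
  then have finX: "finite ?X" using fin by (meson finite_Pow_iff finite_imageI finite_subset)
  have "card {} \<in> ?X" by (intro CollectI exI[of _ "{}"]) auto
  then have "Max ?X \<in> ?X" using finX by (intro Max_in) auto
  then show "\<exists>S\<subseteq>verts H. indep S (edges H) \<and> card S = independence_number H"
    unfolding independence_number_def by (auto simp: eq_commute)
  show le: "card S \<le> independence_number H" if "S \<subseteq> verts H" "indep S (edges H)" for S
    unfolding independence_number_def using finX that by (intro Max_ge) auto
  obtain v where "v \<in> verts H" using assms by auto
  then show "1 \<le> independence_number H" using le[of "{v}"] by (simp add: indep_def)
qed

lemma split_graph_structure:
  assumes H: "fin_simple_graph H" "split_graph H" "verts H \<noteq> {}"
    and w: "clique_number H = w + 1" and b: "independence_number H = b + 1"
  shows "\<exists>A B. split_structure (verts H) (\<lambda>u v. {u, v} \<in> edges H) A B w b"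
proof -
  obtain A B where AB: "A \<union> B = verts H" "A \<inter> B = {}" "clique A (edges H)" "indep B (edges H)"
    using H(2) unfolding split_graph_def by blast
  have cl: "pairwise_adj (\<lambda>u v. {u, v} \<in> edges H) S \<longleftrightarrow> clique S (edges H)" for S
    unfolding pairwise_adj_def clique_def ..
  have ind: "pairwise_adj (\<lambda>u v. {u, v} \<notin> edges H) S \<longleftrightarrow> indep S (edges H)" for S
    unfolding pairwise_adj_def indep_def ..
  have "split_structure (verts H) (\<lambda>u v. {u, v} \<in> edges H) A B w b"
    by unfold_locales
      (use H AB clique_number_props[OF H(1,3)] independence_number_props[OF H(1,3)] w b
        in \<open>auto simp: cl ind insert_commute fin_simple_graph_def\<close>)
  then show ?thesis by blast
qed

lemma LIMSEQ_squeeze_eps: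
  fixes X :: "nat \<Rightarrow> real"
  assumes "\<And>e. 0 < e \<Longrightarrow> \<exists>n0. \<forall>n\<ge>n0. L - e \<le> X n"
    and "\<And>e. 0 < e \<Longrightarrow> \<exists>n0. \<forall>n\<ge>n0. X n \<le> L + e"
  shows "X \<longlonglongrightarrow> L"
proof (rule LIMSEQ_I)
  fix r :: real assume r: "0 < r"
  obtain n0 where n0: "\<forall>n\<ge>n0. L - r / 2 \<le> X n" using assms(1)[of "r / 2"] r by auto
  obtain n1 where n1: "\<forall>n\<ge>n1. X n \<le> L + r / 2" using assms(2)[of "r / 2"] r by auto
  have "norm (X n - L) < r" if "max n0 n1 \<le> n" for n
  proof -
    have "L - r / 2 \<le> X n" "X n \<le> L + r / 2" using n0 n1 that by auto
    then show ?thesis using r by (simp add: abs_less_iff)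
  qed
  then show "\<exists>no. \<forall>n\<ge>no. norm (X n - L) < r" by blast
qed

text \<open>For positive \<open>w\<close> and \<open>b\<close> the branches agree at
  \<open>w / (w + b)\<close>. The guard \<open>1 \<le> w\<close> excludes the default
  \<open>0 / 0 = 0\<close> at \<open>p = 0\<close> for an edgeless \<open>H\<close>, where the limit
  is \<open>1 / b\<close>; for a complete \<open>H\<close>, that is \<open>b = 0\<close>, the
  breakpoint is 1 and the second branch is never reached.\<close>

lemma ed_Forb_split_graph:
  assumes H: "fin_simple_graph H" "2 \<le> card (verts H)"
    and split: "split_structure (verts H) (\<lambda>u v. {u, v} \<in> edges H) A B w b" and wb: "1 \<le> w + b"
    and p: "0 \<le> p" "p \<le> 1"
  shows "ed (Forb H) p =
    (if p \<le> real w / real (w + b) \<and> 1 \<le> w then p / real w else (1 - p) / real b)"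
proof -
  interpret split_structure "verts H" "\<lambda>u v. {u, v} \<in> edges H" A B w b by (rule split)
  define ps where "ps = real w / real (w + b)"
  have t: "0 < real (w + b)" using wb by simp
  have pst: "ps * real (w + b) = w" "(1 - ps) * real (w + b) = b"
  proof -
    show "ps * real (w + b) = w" unfolding ps_def using t by simp
    then show "(1 - ps) * real (w + b) = b" by (simp add: algebra_simps)
  qed
  have "max_dist H p \<longlonglongrightarrow> (if p \<le> ps \<and> 1 \<le> w then p / real w else (1 - p) / real b)"
  proof (cases "p \<le> ps \<and> 1 \<le> w")
    case True
    have ps: "0 < ps" unfolding ps_def using True by simp
    obtain S where S: "S \<subseteq> verts H" "clique S (edges H)" "card S = w + 1"
      using clique_ex unfolding pairwise_adj_def clique_def by blast
    have "max_dist H p \<longlonglongrightarrow> p / real w"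
    proof (rule LIMSEQ_squeeze_eps)
      fix e :: real assume e: "0 < e"
      show "\<exists>n0. \<forall>n\<ge>n0. max_dist H p n \<le> p / real w + e"
      proof (intro exI[of _ 2] allI impI)
        fix n :: nat assume "2 \<le> n"
        then have "max_dist H p n \<le> p / real w" using True by (intro max_dist_le_clique[OF H p S]) auto
        then show "max_dist H p n \<le> p / real w + e" using e by linarith
      qed
      show "\<exists>n0. \<forall>n\<ge>n0. p / real w - e \<le> max_dist H p n"
      \<comment> \<open>\<open>x\<close> must be positive, so \<open>p = 0\<close> is treated apart;
        there nonnegativity of the distance is enough.\<close>
      proof (cases "p = 0")
        case p0: True
        have "p / real w - e \<le> max_dist H p n" for n
          using max_dist_nonneg[OF H p, of n] e p0 by simp
        then show ?thesis by blast
      next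
        case False
        \<comment> \<open>Solves \<open>p = x\<^sup>2 * ps\<close>; then \<open>x \<le> 1\<close> is
          the branch condition \<open>p \<le> ps\<close>.\<close>
        define x where "x = sqrt (p / ps)"
        have x2: "x\<^sup>2 = p / ps" unfolding x_def using p ps by simp
        have x: "0 < x" "x \<le> 1" unfolding x_def using p ps False True by auto
        have "x\<^sup>2 / real (w + b) = p / (ps * real (w + b))" unfolding x2 by simp
        then have "x\<^sup>2 / real (w + b) = p / real w" unfolding pst .
        moreover have "if False then 1 - p = x\<^sup>2 * (1 - real w / real (w + b)) else p = x\<^sup>2 * (real w / real (w + b))"
          unfolding ps_def[symmetric] x2 using ps by simp
        ultimately show ?thesis using max_dist_lower_bound[OF H split wb x p _ e] by metis
      qed
    qed
    then show ?thesis using True by simp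
  next
    case False
    \<comment> \<open>With \<open>b = 0\<close> one would have \<open>ps = 1\<close> and
      \<open>w \<ge> 1\<close>, so that every \<open>p \<le> 1\<close> falls into the first
      branch.\<close>
    have b: "1 \<le> b" and pps: "ps \<le> p"
    proof -
      show "1 \<le> b"
      proof (rule ccontr)
        assume "\<not> 1 \<le> b"
        then have "1 \<le> w" "ps = 1" using wb unfolding ps_def by auto
        then show False using False p by simp
      qed
      show "ps \<le> p"
      proof (cases "p \<le> ps")
        case True
        then have "w = 0" using False by simp
        then show ?thesis using p unfolding ps_def by simp
      qed simp
    qed
    have ps: "0 < 1 - ps"
    proof -
      have "0 < (1 - ps) * real (w + b)" unfolding pst using b by simp
      then show ?thesis using t by (simp only: zero_less_mult_pos2)
    qed
    obtain S where S: "S \<subseteq> verts H" "indep S (edges H)" "card S = b + 1"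
      using indep_ex unfolding pairwise_adj_def indep_def by blast
    have "max_dist H p \<longlonglongrightarrow> (1 - p) / real b"
    proof (rule LIMSEQ_squeeze_eps)
      fix e :: real assume e: "0 < e"
      show "\<exists>n0. \<forall>n\<ge>n0. max_dist H p n \<le> (1 - p) / real b + e"
      proof (intro exI[of _ "2 + nat \<lceil>1 / e\<rceil>"] allI impI)
        fix n :: nat assume n: "2 + nat \<lceil>1 / e\<rceil> \<le> n"
        have "max_dist H p n \<le> (1 - p) / real b + 1 / real (n choose 2)"
          using n by (intro max_dist_le_indep[OF H p S b]) auto
        moreover have "1 / real (n choose 2) \<le> e"
        proof -
          have "n - 1 \<le> n choose 2"
          proof -
            have "2 * (n - 1) \<le> n * (n - 1)" using n by (intro mult_right_mono) auto
            then show ?thesis unfolding choose_two by linarith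
          qed
          moreover have "1 / e \<le> real (n - 1)" using n by linarith
          ultimately have "1 / e \<le> real (n choose 2)" by linarith
          moreover have "0 < 1 / e" using e by simp
          then have "0 < real (n choose 2)" using calculation by linarith
          ultimately show ?thesis using e by (simp add: field_simps)
        qed
        ultimately show "max_dist H p n \<le> (1 - p) / real b + e" by linarith
      qed
      show "\<exists>n0. \<forall>n\<ge>n0. (1 - p) / real b - e \<le> max_dist H p n"
      proof (cases "p = 1")
        case p1: True
        have "(1 - p) / real b - e \<le> max_dist H p n" for n
          using max_dist_nonneg[OF H p, of n] e p1 by simp
        then show ?thesis by blast
      next
        case False
        define x where "x = sqrt ((1 - p) / (1 - ps))"
        have x2: "x\<^sup>2 = (1 - p) / (1 - ps)" unfolding x_def using p ps by simp
        have x: "0 < x" "x \<le> 1" unfolding x_def using p ps False pps by auto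
        have "x\<^sup>2 / real (w + b) = (1 - p) / ((1 - ps) * real (w + b))" unfolding x2 by simp
        then have "x\<^sup>2 / real (w + b) = (1 - p) / real b" unfolding pst .
        moreover have "if True then 1 - p = x\<^sup>2 * (1 - real w / real (w + b)) else p = x\<^sup>2 * (real w / real (w + b))"
          unfolding ps_def[symmetric] x2 using ps by simp
        ultimately show ?thesis using max_dist_lower_bound[OF H split wb x p _ e] by metis
      qed
    qed
    then show ?thesis unfolding if_not_P[OF False] .
  qed
  then show ?thesis unfolding ed_eq_lim ps_def by (rule limI)
qed

text \<open>The limit function is linear and strictly increasing before \<open>ps\<close>, linear
  and strictly decreasing after it. Strictness makes the maximiser unique, which is what the
  definite description in \<open>p_star\<close> needs.\<close>

theorem corollary2:
  fixes H :: "'a graph" and \<alpha> \<omega> :: nat and \<H> :: "nat graph set"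
  assumes "fin_simple_graph H" and "split_graph H" and "card (verts H) \<ge> 2"
    and "\<alpha> = independence_number H" and "\<omega> = clique_number H" and "\<H> = Forb H"
  shows "(p_star \<H>, d_star \<H>) =
           ((real \<omega> - 1) / (real \<alpha> + real \<omega> - 2), 1 / (real \<alpha> + real \<omega> - 2)) \<and>
         (\<forall>p\<in>{0..1}. ed \<H> p \<le> d_star \<H>) \<and>
         {p\<in>{0..1}. ed \<H> p = d_star \<H>} = {p_star \<H>}"
proof -
  have ne: "verts H \<noteq> {}" using assms(3) by auto
  note cn = clique_number_props[OF assms(1) ne] and ind = independence_number_props[OF assms(1) ne]
  define w where "w = \<omega> - 1"
  define b where "b = \<alpha> - 1"
  have w: "\<omega> = w + 1" and b: "\<alpha> = b + 1" unfolding w_def b_def using cn(3) ind(3) assms(4,5) by auto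
  \<comment> \<open>Two vertices form a clique or an independent set, so the denominator
    \<open>w + b\<close> is positive.\<close>
  have wb: "1 \<le> w + b"
  proof -
    obtain u v where uv: "u \<in> verts H" "v \<in> verts H" "u \<noteq> v"
      using assms(3) by (metis card_le_Suc0_iff_eq card.infinite not_less_eq_eq numeral_2_eq_2 zero_le)
    have "2 \<le> \<omega> \<or> 2 \<le> \<alpha>"
    proof (cases "{u, v} \<in> edges H")
      case True
      then have "clique {u, v} (edges H)" by (auto simp: clique_def insert_commute)
      then show ?thesis using cn(2)[of "{u, v}"] uv assms(5) by simp
    next
      case False
      then have "indep {u, v} (edges H)" by (auto simp: indep_def insert_commute)
      then show ?thesis using ind(2)[of "{u, v}"] uv assms(4) by simp
    qed
    then show ?thesis using w b by auto
  qed
  obtain A B where split: "split_structure (verts H) (\<lambda>u v. {u, v} \<in> edges H) A B w b"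
    using split_graph_structure[OF assms(1,2) ne, of w b] w b assms(4,5) by auto
  define t where "t = real (w + b)"
  define ps where "ps = real w / t"
  have t: "0 < t" unfolding t_def using wb by simp
  have ps01: "ps \<in> {0..1}" unfolding ps_def t_def by (auto simp: divide_le_eq_1)
  have ed: "ed \<H> p = (if p \<le> ps \<and> 1 \<le> w then p / real w else (1 - p) / real b)" if "p \<in> {0..1}" for p
    using ed_Forb_split_graph[OF assms(1,3) split wb] that unfolding assms(6) ps_def t_def by simp
  have compl: "(1 - ps) * t = real b" unfolding ps_def using t by (simp add: t_def left_diff_distrib)
  have edps: "ed \<H> ps = 1 / t"
  proof (cases "1 \<le> w")
    case True
    then show ?thesis using ed[OF ps01] by (simp add: ps_def)
  next
    case False
    then have "w = 0" by simp
    then show ?thesis using ed[OF ps01] by (simp add: ps_def t_def)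
  qed
  have less: "ed \<H> p < 1 / t" if p: "p \<in> {0..1}" "p \<noteq> ps" for p
  proof (cases "p \<le> ps \<and> 1 \<le> w")
    case True
    then have "p / real w < ps / real w" using p by (intro divide_strict_right_mono) auto
    also have "ps / real w = 1 / t" unfolding ps_def using True by simp
    finally show ?thesis unfolding ed[OF p(1)] using True by simp
  next
    case False
    have gt: "ps < p"
    proof (cases "p \<le> ps")
      case True
      then have "w = 0" using False by simp
      then show ?thesis using p unfolding ps_def by auto
    qed simp
    then have "ps < 1" using p by auto
    then have bpos: "0 < real b" using compl t by (metis diff_gt_0_iff_gt mult_pos_pos)
    then have "(1 - p) / real b < (1 - ps) / real b" using gt by (intro divide_strict_right_mono) auto
    also have "(1 - ps) / real b = 1 / t" using compl bpos t by (simp add: field_simps)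
    finally show ?thesis unfolding ed[OF p(1)] if_not_P[OF False] .
  qed
  have le: "ed \<H> p \<le> 1 / t" if "p \<in> {0..1}" for p using less[OF that] edps by (cases "p = ps") auto
  have d: "d_star \<H> = 1 / t"
    unfolding d_star_def using ps01 edps le by (intro Greatest_equality) (auto intro: rev_image_eqI)
  have ps: "p_star \<H> = ps"
    unfolding p_star_def d using ps01 edps less by (intro the_equality) force+
  have tt: "real \<alpha> + real \<omega> - 2 = t" "real \<omega> - 1 = real w" unfolding t_def w b by auto
  have "{p\<in>{0..1}. ed \<H> p = d_star \<H>} = {p_star \<H>}"
    unfolding d ps using ps01 edps less by force
  then show ?thesis unfolding tt using le d ps ps_def by simp
qed

end
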